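(* Let $s$ and $\alpha$ be real numbers. Then the operators $$\mathcal D^s,\ \mathcal I^{-s}:F_\alpha^p\to\begin{cases}F_{\alpha+2sp}^p & \text{if } 0<p<\infty,\\ F_{\alpha+2s}^\infty & \text{if } p=\infty,\end{cases}$$ are bounded.
   Context: Fix an integer $n\ge1$. $dV$ is Lebesgue volume measure on $\mathbb{C}^n$ normalized so that $\int_{\mathbb{C}^n}e^{-|z|^2}dV(z)=1$, and $H(\mathbb{C}^n)$ is the space of entire functions on $\mathbb{C}^n$. For $\alpha$ real put $dV_\alpha(z)=(1+|z|)^{-\alpha}dV(z)$. For $0<p<\infty$, $F_\alpha^p$ is the space of $f\in H(\mathbb{C}^n)$ with $\|f\|_{F_\alpha^p}=\left\{\int_{\mathbb{C}^n}|f(z)e^{-|z|^2/2}|^p\,dV_\alpha(z)\right\}^{1/p}<\infty$; $F_\alpha^\infty$ is the space of $f\in H(\mathbb{C}^n)$ with $\|f\|_{F_\alpha^\infty}=\sup_{z}\frac{|f(z)|e^{-|z|^2/2}}{(1+|z|)^\alpha}<\infty$. (The term "norm" is used even for $p<1$; a linear operator $T$ is bounded if $\|Tf\|\le C\|f\|$ for some constant $C$ and all $f$.) Let $f\in H(\mathbb{C}^n)$ have homogeneous expansion $f=\sum_{k\ge0}f_k$, with $f_k$ a homogeneous polynomial of degree $k$. For $s$ real define $\mathcal D^sf=\sum_{k}\frac{\Gamma(n+s+k)}{\Gamma(n+k)}f_k$ and $\mathcal I^sf=\sum_{k}\frac{\Gamma(n+k)}{\Gamma(n+s+k)}f_k$,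 where in both cases the sum is over all $k\ge0$ if $s\ge0$ and over $k>|s|$ only if $s<0$; these series define entire functions. *)

theory Defs
  imports "HOL-Probability.Probability"
begin

text \<open>
  The space of \<^term>\<open>n\<close>-tuples of complex numbers is \<^typ>\<open>complex ^ 'n\<close> with
  \<open>n = CARD('n)\<close>; its norm is the Euclidean norm.
\<close>

subsection \<open>Entire functions and homogeneous expansions\<close>

text \<open>A Frechet derivative is only real-linear, so complex homogeneity is required explicitly.\<close>

definition entire :: "(complex ^ 'n \<Rightarrow> complex) \<Rightarrow> bool" where
  "entire f \<longleftrightarrow>
     (\<forall>z. \<exists>f'. (f has_derivative f') (at z) \<and> (\<forall>c v. f' (c *s v) = c * f' v))"

definition multi_indices :: "nat \<Rightarrow> ('n::finite \<Rightarrow> nat) set" where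
  "multi_indices k = {m. (\<Sum>i\<in>UNIV. m i) = k}"

lemma finite_multi_indices [simp]: "finite (multi_indices k :: ('n::finite \<Rightarrow> nat) set)"
proof (rule finite_subset)
  show "multi_indices k \<subseteq> (PiE UNIV (\<lambda>_. {..k}) :: ('n \<Rightarrow> nat) set)"
  proof
    fix m :: "'n \<Rightarrow> nat" assume "m \<in> multi_indices k"
    then have "m i \<le> k" for i
      unfolding multi_indices_def by (auto intro: member_le_sum)
    then show "m \<in> PiE UNIV (\<lambda>_. {..k})" by auto
  qed
qed (auto intro: finite_PiE)

definition homogeneous_polynomial :: "nat \<Rightarrow> (complex ^ 'n \<Rightarrow> complex) \<Rightarrow> bool" where
  "homogeneous_polynomial k P \<longleftrightarrow>
     (\<exists>c. \<forall>z. P z = (\<Sum>m\<in>multi_indices k. c m * (\<Prod>i\<in>UNIV. (z $ i) ^ m i)))"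

definition homogeneous_expansion ::
    "(complex ^ 'n \<Rightarrow> complex) \<Rightarrow> (nat \<Rightarrow> complex ^ 'n \<Rightarrow> complex) \<Rightarrow> bool" where
  "homogeneous_expansion f F \<longleftrightarrow>
     (\<forall>k. homogeneous_polynomial k (F k)) \<and> (\<forall>z. (\<lambda>k. F k z) sums f z)"

text \<open>The expansion exists and is unique for every entire function.\<close>

definition homogeneous_part ::
    "(complex ^ 'n \<Rightarrow> complex) \<Rightarrow> nat \<Rightarrow> complex ^ 'n \<Rightarrow> complex" where
  "homogeneous_part f = (THE F. homogeneous_expansion f F)"

subsection \<open>Fractional radial differentiation and integration\<close>

text \<open>
  For \<open>s < 0\<close> dropping the terms with \<open>k \<le> \<bar>s\<bar>\<close> keeps \<open>CARD('n) + s + k\<close> positive, so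
  \<^const>\<open>Gamma\<close> is never evaluated at a pole.
\<close>

definition frac_indices :: "real \<Rightarrow> nat set" where
  "frac_indices s = (if s \<ge> 0 then UNIV else {k. real k > \<bar>s\<bar>})"

definition frac_D :: "real \<Rightarrow> (complex ^ 'n \<Rightarrow> complex) \<Rightarrow> complex ^ 'n \<Rightarrow> complex" where
  "frac_D s f z =
     (\<Sum>k. if k \<in> frac_indices s
          then of_real (Gamma (real CARD('n) + s + real k) / Gamma (real CARD('n) + real k))
                 * homogeneous_part f k z
          else 0)"

definition frac_I :: "real \<Rightarrow> (complex ^ 'n \<Rightarrow> complex) \<Rightarrow> complex ^ 'n \<Rightarrow> complex" where
  "frac_I s f z =
     (\<Sum>k. if k \<in> frac_indices s
          then of_real (Gamma (real CARD('n) + real k) / Gamma (real CARD('n) + s + real k))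
                 * homogeneous_part f k z
          else 0)"

subsection \<open>Measures\<close>

definition gauss_vol :: "(complex ^ 'n) measure" where
  "gauss_vol =
     scale_measure (inverse (\<integral>\<^sup>+z. ennreal (exp (- (norm (z :: complex ^ 'n))\<^sup>2)) \<partial>lborel)) lborel"

definition gauss_vol_weighted :: "real \<Rightarrow> (complex ^ 'n) measure" where
  "gauss_vol_weighted \<alpha> = density gauss_vol (\<lambda>z. ennreal ((1 + norm z) powr (- \<alpha>)))"

text \<open>The normalizing integral is positive and finite, so \<^const>\<open>gauss_vol\<close> is indeed normalized.\<close>

lemma nn_integral_gauss_line: "(\<integral>\<^sup>+x. ennreal (exp (- x\<^sup>2)) \<partial>lborel) = ennreal (sqrt pi)"
proof -
  have "has_bochner_integral lborel (\<lambda>x::real. exp (- x\<^sup>2)) (sqrt pi)"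
    using has_bochner_integral_even_function[OF gaussian_moment_0] by simp
  then show ?thesis
    by (subst nn_integral_eq_integral) (auto simp: has_bochner_integral_iff)
qed

lemma nn_integral_gauss:
  "(\<integral>\<^sup>+z. ennreal (exp (- (norm (z :: complex ^ 'n))\<^sup>2)) \<partial>lborel) =
     ennreal (sqrt pi) ^ DIM(complex ^ 'n)"
proof -
  have "ennreal (exp (- (norm z)\<^sup>2)) = (\<Prod>b\<in>Basis. ennreal (exp (- (z \<bullet> b)\<^sup>2)))"
    for z :: "complex ^ 'n"
  proof -
    have "(norm z)\<^sup>2 = (\<Sum>b\<in>Basis. (z \<bullet> b)\<^sup>2)"
      unfolding power2_norm_eq_inner by (subst euclidean_inner) (simp add: power2_eq_square)
    then show ?thesis
      by (simp add: prod_ennreal flip: exp_sum sum_negf)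
  qed
  moreover have "(\<integral>\<^sup>+z. (\<Prod>b\<in>Basis. ennreal (exp (- ((z :: complex ^ 'n) \<bullet> b)\<^sup>2))) \<partial>lborel) =
      (\<Prod>b\<in>(Basis :: (complex ^ 'n) set). \<integral>\<^sup>+x. ennreal (exp (- x\<^sup>2)) \<partial>lborel)"
    by (rule nn_integral_lborel_prod) auto
  ultimately show ?thesis
    by (simp only: nn_integral_gauss_line prod_constant)
qed

lemma gauss_vol_normalized:
  "(\<integral>\<^sup>+z. ennreal (exp (- (norm z)\<^sup>2)) \<partial>(gauss_vol :: (complex ^ 'n) measure)) = 1"
proof -
  have "inverse a * a = 1" if "a \<noteq> 0" "a < \<top>" for a :: ennreal
    using that ennreal_divide_self[of a] by (simp add: divide_ennreal_def mult.commute)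
  moreover have "ennreal (sqrt pi) ^ m \<noteq> 0" "ennreal (sqrt pi) ^ m < \<top>" for m
    by (auto simp: ennreal_power)
  ultimately show ?thesis
    unfolding gauss_vol_def by (subst nn_integral_scale_measure) (auto simp: nn_integral_gauss)
qed

subsection \<open>Weighted Fock spaces\<close>

definition fock :: "real \<Rightarrow> real \<Rightarrow> (complex ^ 'n \<Rightarrow> complex) set" where
  "fock p \<alpha> =
     {f. entire f \<and>
         integrable (gauss_vol_weighted \<alpha>) (\<lambda>z. norm (f z * of_real (exp (- (norm z)\<^sup>2 / 2))) powr p)}"

definition fock_norm :: "real \<Rightarrow> real \<Rightarrow> (complex ^ 'n \<Rightarrow> complex) \<Rightarrow> real" where
  "fock_norm p \<alpha> f =
     (\<integral>z. norm (f z * of_real (exp (- (norm z)\<^sup>2 / 2))) powr p \<partial>gauss_vol_weighted \<alpha>) powr (1 / p)"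

definition fock_inf :: "real \<Rightarrow> (complex ^ 'n \<Rightarrow> complex) set" where
  "fock_inf \<alpha> =
     {f. entire f \<and>
         bdd_above (range (\<lambda>z. norm (f z) * exp (- (norm z)\<^sup>2 / 2) / (1 + norm z) powr \<alpha>))}"

definition fock_inf_norm :: "real \<Rightarrow> (complex ^ 'n \<Rightarrow> complex) \<Rightarrow> real" where
  "fock_inf_norm \<alpha> f =
     (SUP z. norm (f z) * exp (- (norm z)\<^sup>2 / 2) / (1 + norm z) powr \<alpha>)"

text \<open>
  For \<open>p < 1\<close> the norm below need not satisfy the triangle inequality, so
  \<^const>\<open>bounded_linear\<close> does not apply.
\<close>

definition bounded_operator ::
    "(complex ^ 'n \<Rightarrow> complex) set \<Rightarrow> ((complex ^ 'n \<Rightarrow> complex) \<Rightarrow> real) \<Rightarrow>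
     (complex ^ 'n \<Rightarrow> complex) set \<Rightarrow> ((complex ^ 'n \<Rightarrow> complex) \<Rightarrow> real) \<Rightarrow>
     ((complex ^ 'n \<Rightarrow> complex) \<Rightarrow> complex ^ 'n \<Rightarrow> complex) \<Rightarrow> bool" where
  "bounded_operator X NX Y NY T \<longleftrightarrow>
     T ` X \<subseteq> Y \<and>
     (\<forall>f\<in>X. \<forall>g\<in>X. T (\<lambda>z. f z + g z) = (\<lambda>z. T f z + T g z)) \<and>
     (\<forall>c. \<forall>f\<in>X. T (\<lambda>z. c * f z) = (\<lambda>z. c * T f z)) \<and>
     (\<exists>C. \<forall>f\<in>X. NY (T f) \<le> C * NX f)"

end

theory Submission
  imports Defs "HOL-Complex_Analysis.Complex_Analysis"
begin

text \<open>
  Both operators multiply the \<open>k\<close>-th homogeneous part \<open>f\<^sub>k\<close> by a ratio of Gamma values of size \<open>k\<^sup>s\<close>.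
  Such a ratio factors as \<open>\<Gamma>(x + k)/\<Gamma>(x + k + \<sigma>)\<close>, \<open>\<sigma> > 0\<close>, times a polynomial in \<open>k\<close> of
  degree \<open>m\<close> with \<open>m - \<sigma> = s\<close>. Call a weight \<open>\<omega>\<close> moderate if \<open>\<omega> x \<le> \<omega> y exp(L |x - y|)\<close>.
  Pointwise, \<open>|f| \<le> \<omega> exp(|z|\<^sup>2/2)\<close> implies \<open>|T f| \<le> C \<omega> (1 + |z|) powr 2s exp(|z|\<^sup>2/2)\<close>
  with \<open>C\<close> depending on \<open>L\<close> only: a factor linear in \<open>k\<close> is a radial derivative, estimated by Cauchy's
  inequality on a circle of radius about \<open>1/(1 + |z|)\<close>; the Gamma ratio is a Beta integral of
  \<open>f(t z)\<close> over \<open>0 < t < 1\<close>, which concentrates at \<open>1 - t\<close> of order \<open>1/(1 + |z|)\<^sup>2\<close>.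
  For \<open>p = \<infinity>\<close> take \<open>\<omega> = A (1 + |z|) powr \<alpha>\<close>. For \<open>p < \<infinity>\<close> take for \<open>\<omega>\<^sup>p\<close> the average of
  \<open>|f exp(-|u|\<^sup>2/2)|\<^sup>p\<close> against \<open>exp(-K |u - z|)\<close>: it is moderate, dominates by the mean value
  inequality (also for \<open>p < 1\<close>), and has weighted integral comparable to that of \<open>f\<close>.
\<close>

text \<open>\<open>homogeneous_part\<close> is a definite description, so existence and uniqueness
  of the homogeneous expansion have to be derived first. Differentiability yields one-variable
  holomorphy on complex lines only; hence the Taylor coefficients of the slices
  \<open>w \<mapsto> f (w *s z)\<close> serve as candidates, and their being polynomials in
  \<open>z\<close> is a Liouville argument in each coordinate. The operators are bounded pointwise
  because for \<open>p < 1\<close> Jensen's inequality and duality are not at hand; the exponent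
  \<open>p\<close> enters only through the majorant. The price is that the class of weights must be
  stable under composition of operators. When \<open>s < 0\<close>, the shift \<open>b\<close> in
  \<open>Gamma (b + k)\<close> may be nonpositive, and then \<open>t powr (b - 1)\<close> is not
  integrable at 0. Dropping the low-order terms repairs this: without its first
  \<open>k\<^sub>0\<close> homogeneous parts, \<open>f (t z)\<close> is of size
  \<open>t ^ k\<^sub>0\<close> near \<open>t = 0\<close>. That estimate has to be uniform in
  \<open>z\<close>, which is the purpose of \<open>cutoff_bound\<close>.\<close>

unbundle no fps_syntax

subsection \<open>Entire functions\<close>

lemma norm_vector_smult: "norm (c *s (z :: complex ^ 'n)) = norm c * norm z"
proof -
  have "L2_set (\<lambda>i. norm c * norm (z $ i)) UNIV = norm c * L2_set (\<lambda>i. norm (z $ i)) UNIV"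
    by (simp add: L2_set_right_distrib)
  then show ?thesis by (simp add: norm_vec_def norm_mult)
qed

lemma bounded_linear_vector_smult_left: "bounded_linear (\<lambda>c. c *s (v :: complex ^ 'n))"
  by (rule bounded_linear_intro[where K = "norm v"])
     (auto simp: vec_eq_iff algebra_simps norm_vector_smult)

lemma entireE:
  assumes "entire f"
  obtains f' where "\<And>z. (f has_derivative f' z) (at z)" "\<And>z c v. f' z (c *s v) = c * f' z v"
  using assms unfolding entire_def by metis

lemma entireI:
  assumes "\<And>z. (f has_derivative f' z) (at z)" "\<And>z c v. f' z (c *s v) = c * f' z v"
  shows "entire f"
  using assms unfolding entire_def by blast

lemma entire_continuous: "entire f \<Longrightarrow> continuous_on S f"
  by (meson entireE has_derivative_at_withinI has_derivative_continuous_on)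

text \<open>Complex homogeneity of the Frechet derivative makes
  \<open>h \<mapsto> f' (h *s v)\<close> multiplication by the number \<open>f' v\<close>, that is,
  a complex derivative. Through this, one-variable theory becomes available on complex
  lines.\<close>

lemma entire_line_holomorphic:
  fixes f :: "complex ^ 'n \<Rightarrow> complex"
  assumes "entire f"
  shows "(\<lambda>w. f (a + w *s v)) holomorphic_on S"
proof -
  obtain f' where f': "\<And>z. (f has_derivative f' z) (at z)" "\<And>z c v. f' z (c *s v) = c * f' z v"
    using entireE[OF assms] by blast
  have "((\<lambda>w. f (a + w *s v)) has_field_derivative f' (a + w *s v) v) (at w)" for w
  proof -
    have "((\<lambda>w. a + w *s v) has_derivative (\<lambda>h. h *s v)) (at w)"
      by (auto intro!: derivative_eq_intros
          bounded_linear.has_derivative[OF bounded_linear_vector_smult_left])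
    note has_derivative_compose[OF this f'(1)]
    then show ?thesis
      unfolding has_field_derivative_def by (rule has_derivative_eq_rhs) (simp add: f'(2) fun_eq_iff mult.commute)
  qed
  then show ?thesis
    by (meson field_differentiable_at_within field_differentiable_def holomorphic_on_def)
qed

lemma entire_const: "entire (\<lambda>_. c)"
  by (rule entireI[where f' = "\<lambda>_ _. 0"]) auto

lemma entire_nth: "entire (\<lambda>z. z $ i)"
  by (rule entireI[where f' = "\<lambda>_ v. v $ i"])
     (auto intro!: bounded_linear_imp_has_derivative bounded_linear_vec_nth)

lemma entire_add:
  assumes "entire f" "entire g"
  shows "entire (\<lambda>z. f z + g z)"
proof -
  obtain f' where f': "\<And>z. (f has_derivative f' z) (at z)" "\<And>z c v. f' z (c *s v) = c * f' z v"
    using entireE[OF assms(1)] by blast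
  obtain g' where g': "\<And>z. (g has_derivative g' z) (at z)" "\<And>z c v. g' z (c *s v) = c * g' z v"
    using entireE[OF assms(2)] by blast
  show ?thesis
    by (rule entireI[where f' = "\<lambda>z v. f' z v + g' z v"])
       (auto intro!: derivative_eq_intros f' g' simp: f'(2) g'(2) algebra_simps)
qed

lemma entire_mult:
  assumes "entire f" "entire g"
  shows "entire (\<lambda>z. f z * g z)"
proof -
  obtain f' where f': "\<And>z. (f has_derivative f' z) (at z)" "\<And>z c v. f' z (c *s v) = c * f' z v"
    using entireE[OF assms(1)] by blast
  obtain g' where g': "\<And>z. (g has_derivative g' z) (at z)" "\<And>z c v. g' z (c *s v) = c * g' z v"
    using entireE[OF assms(2)] by blast
  show ?thesis
    by (rule entireI[where f' = "\<lambda>z v. f z * g' z v + f' z v * g z"])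
       (auto intro!: derivative_eq_intros f' g' simp: f'(2) g'(2) algebra_simps)
qed

lemma entire_sum:
  assumes "\<And>i. i \<in> A \<Longrightarrow> entire (f i)"
  shows "entire (\<lambda>z. \<Sum>i\<in>A. f i z)"
  using assms by (induction A rule: infinite_finite_induct) (auto simp: entire_const intro!: entire_add)

lemma entire_prod:
  assumes "\<And>i. i \<in> A \<Longrightarrow> entire (f i)"
  shows "entire (\<lambda>z. \<Prod>i\<in>A. f i z)"
  using assms by (induction A rule: infinite_finite_induct) (auto simp: entire_const intro!: entire_mult)

lemma entire_power: "entire f \<Longrightarrow> entire (\<lambda>z. f z ^ k)"
  by (induction k) (auto simp: entire_const intro!: entire_mult)

lemma entire_exp:
  assumes "entire f"
  shows "entire (\<lambda>z. exp (f z))"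
proof -
  obtain f' where f': "\<And>z. (f has_derivative f' z) (at z)" "\<And>z c v. f' z (c *s v) = c * f' z v"
    using entireE[OF assms(1)] by blast
  have "((\<lambda>z. exp (f z)) has_derivative (\<lambda>v. f' z v * exp (f z))) (at z)" for z
    using has_derivative_compose[OF f'(1) DERIV_exp[unfolded has_field_derivative_def]]
    by (simp add: mult.commute)
  then show ?thesis
    by (rule entireI) (simp add: f'(2))
qed

lemma entire_translate:
  assumes "entire f"
  shows "entire (\<lambda>z. f (a + z))"
proof -
  obtain f' where f': "\<And>z. (f has_derivative f' z) (at z)" "\<And>z c v. f' z (c *s v) = c * f' z v"
    using entireE[OF assms(1)] by blast
  have "((\<lambda>z. f (a + z)) has_derivative f' (a + z)) (at z)" for z
  proof -
    have "((\<lambda>z. a + z) has_derivative (\<lambda>h. h)) (at z)"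
      by (auto intro!: derivative_eq_intros)
    from has_derivative_compose[OF this f'(1)] show ?thesis by simp
  qed
  then show ?thesis
    by (rule entireI) (simp add: f'(2))
qed

section \<open>Homogeneous polynomials and uniqueness of power series\<close>

lemma homogeneous_polynomial_entire: "homogeneous_polynomial k P \<Longrightarrow> entire P"
  unfolding homogeneous_polynomial_def
  by (elim exE, subst fun_eq_iff[THEN iffD2], assumption)
     (intro entire_sum entire_mult entire_const entire_prod entire_power entire_nth)

lemma homogeneous_polynomial_smult:
  assumes "homogeneous_polynomial k P"
  shows "P (c *s z) = c ^ k * P z"
proof -
  obtain a where P: "\<And>z. P z = (\<Sum>m\<in>multi_indices k. a m * (\<Prod>i\<in>UNIV. (z $ i) ^ m i))"
    using assms unfolding homogeneous_polynomial_def by blast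
  have "(\<Prod>i\<in>UNIV. ((c *s z) $ i) ^ m i) = c ^ k * (\<Prod>i\<in>UNIV. (z $ i) ^ m i)"
    if "m \<in> multi_indices k" for m
    using that by (simp add: power_mult_distrib prod.distrib multi_indices_def flip: power_sum)
  then show ?thesis
    by (simp add: P sum_distrib_left mult_ac)
qed

text \<open>The difference of the two series vanishes identically, whereas a series with a nonzero
  coefficient has at most an isolated zero at 0.\<close>

lemma power_series_unique:
  fixes a b :: "nat \<Rightarrow> complex"
  assumes "\<And>w. (\<lambda>k. a k * w ^ k) sums f w" "\<And>w. (\<lambda>k. b k * w ^ k) sums f w"
  shows "a k = b k"
proof (rule ccontr)
  assume ne: "a k \<noteq> b k"
  have d: "(\<lambda>k. (a k - b k) * w ^ k) sums 0" for w
    using sums_diff[OF assms(1)[of w] assms(2)[of w]] by (simp add: algebra_simps)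
  \<comment> \<open>The isolated-zero theorem wants a nonzero coefficient of positive index, so
    index 0 is settled by evaluation at the centre.\<close>
  have "a 0 - b 0 = 0"
    using d[of 0] by (simp add: powser_sums_zero_iff)
  with ne have "k > 0" by (cases k) auto
  obtain s where s: "s > 0" "\<And>z. z \<in> cball 0 s - {0} \<Longrightarrow> (\<lambda>_::complex. 0 :: complex) z \<noteq> 0"
    by (rule powser_0_nonzero[of 1 0 "\<lambda>k. a k - b k" "\<lambda>_. 0" k]) (use d ne \<open>k > 0\<close> in auto)
  from s(2)[of "of_real s"] s(1) show False
    by simp
qed

subsection \<open>Homogeneous parts\<close>

text \<open>Taylor coefficient at 0 of the slice through \<open>z\<close>: the prospective value of
  the \<open>k\<close>-th homogeneous part at \<open>z\<close>, computed without knowing that such a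
  part exists.\<close>

definition slice_coeff :: "(complex ^ 'n \<Rightarrow> complex) \<Rightarrow> nat \<Rightarrow> complex ^ 'n \<Rightarrow> complex" where
  "slice_coeff f k z = (deriv ^^ k) (\<lambda>w. f (w *s z)) 0 / fact k"

lemma slice_coeff_sums_smult:
  assumes "entire f"
  shows "(\<lambda>k. slice_coeff f k z * w ^ k) sums f (w *s z)"
  using holomorphic_power_series[of "\<lambda>w. f (w *s z)" 0 "norm w + 1" w]
    entire_line_holomorphic[OF assms, of 0 z]
  by (simp add: slice_coeff_def)

lemma slice_coeff_sums:
  assumes "entire f"
  shows "(\<lambda>k. slice_coeff f k z) sums f z"
  using slice_coeff_sums_smult[OF assms, of z 1] by simp

lemma slice_coeff_unique:
  assumes "entire f" "\<And>w. (\<lambda>k. a k * w ^ k) sums f (w *s z)"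
  shows "a k = slice_coeff f k z"
  by (rule power_series_unique[OF assms(2) slice_coeff_sums_smult[OF assms(1)]])

lemma slice_coeff_smult:
  assumes "entire f"
  shows "slice_coeff f k (c *s z) = c ^ k * slice_coeff f k z"
proof -
  have "(\<lambda>k. (c ^ k * slice_coeff f k z) * w ^ k) sums f (w *s (c *s z))" for w
    using slice_coeff_sums_smult[OF assms, of z "w * c"]
    by (simp add: vector_smult_assoc power_mult_distrib mult_ac)
  from slice_coeff_unique[OF assms this] show ?thesis by simp
qed

text \<open>Cauchy's inequality for the slice on the circle of radius \<open>r / norm z\<close>,
  which \<open>z\<close> carries to vectors of norm \<open>r\<close>.\<close>

lemma slice_coeff_bound:
  assumes "entire f" "r > 0" "\<And>z. norm z \<le> r \<Longrightarrow> norm (f z) \<le> M"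
  shows "norm (slice_coeff f k z) \<le> M * (norm z / r) ^ k"
proof (cases "z = 0")
  case True
  have "norm (f 0) \<le> M" using assms(2,3) by simp
  \<comment> \<open>At the origin that radius would be infinite. Homogeneity kills the coefficients
    with \<open>k > 0\<close>, and \<open>0 ^ 0 = 1\<close> leaves the value
    \<open>f 0\<close>.\<close>
  have "slice_coeff f k 0 = 0 ^ k * slice_coeff f k 0"
    using slice_coeff_smult[OF assms(1), of k 0 0] by simp
  moreover have "slice_coeff f 0 0 = f 0" by (simp add: slice_coeff_def)
  ultimately show ?thesis using True \<open>norm (f 0) \<le> M\<close>
    by (cases k) auto
next
  case False
  have "norm ((deriv ^^ k) (\<lambda>w. f (w *s z)) 0) \<le> fact k * M / (r / norm z) ^ k"
  proof (rule Cauchy_inequality)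
    show hol: "(\<lambda>w. f (w *s z)) holomorphic_on ball 0 (r / norm z)"
      using entire_line_holomorphic[OF assms(1), of 0 z] by simp
    show "continuous_on (cball 0 (r / norm z)) (\<lambda>w. f (w *s z))"
      using entire_line_holomorphic[OF assms(1), of 0 z] by (simp add: holomorphic_on_imp_continuous_on)
    show "norm (f (x *s z)) \<le> M" if "cmod (0 - x) = r / norm z" for x
      using that False by (intro assms(3)) (simp add: norm_vector_smult)
  qed (use assms False in auto)
  then show ?thesis
    by (simp add: slice_coeff_def norm_divide field_simps power_divide)
qed

lemma entire_bounded_cball:
  fixes f :: "complex ^ 'n \<Rightarrow> complex"
  assumes "entire f"
  obtains M where "M > 0" "\<And>z. norm z \<le> r \<Longrightarrow> norm (f z) \<le> M"
proof -
  have "compact (f ` cball 0 r)"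
    by (intro compact_continuous_image entire_continuous assms compact_cball)
  then obtain M where "\<And>x. x \<in> f ` cball 0 r \<Longrightarrow> norm x \<le> M"
    using compact_imp_bounded bounded_iff by metis
  then have "norm (f z) \<le> max M 1" if "norm z \<le> r" for z
    using that by (force simp: le_max_iff_disj)
  then show ?thesis by (intro that[of "max M 1"]) auto
qed

text \<open>Expanding \<open>f (q *s y)\<close> in powers of \<open>q\<close>, with
  \<open>y = a + w *s v\<close>, gives the \<open>k\<close>-th coefficient as the limit of
  (\<open>f (q *s y)\<close> minus the lower terms) divided by \<open>q ^ k\<close> for
  \<open>q\<close> tending to 0. The lower terms are holomorphic in \<open>w\<close> by induction,
  and the limit is locally uniform.\<close>

lemma slice_coeff_line_holomorphic:
  fixes f :: "complex ^ 'n \<Rightarrow> complex"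
  assumes f: "entire f"
  shows "(\<lambda>w. slice_coeff f k (a + w *s v)) holomorphic_on UNIV"
proof (induction k rule: less_induct)
  case (less k)
  define g where "g j w = slice_coeff f j (a + w *s v)" for j w
  \<comment> \<open>The quotient for \<open>q = 1 / (m + 2)\<close>; the shift by 2 gives
    \<open>norm q \<le> 1/2\<close>, hence a geometric remainder of size at most
    \<open>2 * M * norm q\<close>.\<close>
  define h where "h m w = (f ((1 / of_nat (m + 2)) *s (a + w *s v)) - (\<Sum>j<k. g j w / of_nat (m + 2) ^ j)) *
    of_nat (m + 2) ^ k" for m :: nat and w
  have "g k holomorphic_on UNIV"
  proof (rule holomorphic_uniform_sequence)
    show "h m holomorphic_on UNIV" for m
    proof -
      have "(\<lambda>w. f ((1 / of_nat (m + 2)) *s (a + w *s v))) =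
        (\<lambda>w. f ((1 / of_nat (m + 2)) *s a + w *s ((1 / of_nat (m + 2)) *s v)))"
        by (simp add: vector_add_ldistrib vector_smult_assoc mult.commute)
      then have "(\<lambda>w. f ((1 / of_nat (m + 2)) *s (a + w *s v))) holomorphic_on UNIV"
        using entire_line_holomorphic[OF f, of "(1 / of_nat (m + 2)) *s a" "(1 / of_nat (m + 2)) *s v" UNIV]
        by presburger
      moreover have "g j holomorphic_on UNIV" if "j < k" for j
        using less that by (simp add: g_def[abs_def])
      ultimately show ?thesis
        unfolding h_def[abs_def] by (intro holomorphic_intros) (auto simp del: of_nat_add)
    qed
    fix x :: complex
    \<comment> \<open>Bounds \<open>norm (a + w *s v)\<close> for all \<open>w\<close> within 1 of
      \<open>x\<close>, so that the ratio in \<open>slice_coeff_bound\<close> is at most 1 and one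
      \<open>M\<close> serves all coefficients.\<close>
    define r where "r = norm a + (norm x + 1) * norm v + 1"
    have r: "r > 0" by (auto simp: r_def intro!: add_nonneg_pos)
    obtain M where M: "M > 0" "\<And>z. norm z \<le> r \<Longrightarrow> norm (f z) \<le> M"
      using entire_bounded_cball[OF f] by blast
    have gM: "norm (g j w) \<le> M" if "w \<in> cball x 1" for w j
    proof -
      have "norm w \<le> norm x + 1"
        using that norm_triangle_ineq[of x "w - x"] by (simp add: dist_norm norm_minus_commute)
      then have "norm w * norm v \<le> (norm x + 1) * norm v"
        by (intro mult_right_mono) auto
      with norm_triangle_ineq[of a "w *s v"] have "norm (a + w *s v) \<le> r"
        unfolding r_def by (simp add: norm_vector_smult)
      then have "(norm (a + w *s v) / r) ^ j \<le> 1" using r by (intro power_le_one) auto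
      then have "M * (norm (a + w *s v) / r) ^ j \<le> M * 1" using M by (intro mult_left_mono) auto
      with slice_coeff_bound[OF f r M(2), of j "a + w *s v"] show ?thesis
        by (simp add: g_def)
    qed
    have est: "norm (h m w - g k w) \<le> 2 * M / of_nat (m + 2)" if "w \<in> cball x 1" for m w
    proof -
      define q :: complex where "q = 1 / of_nat (m + 2)"
      have "(of_nat (m + 2) :: complex) \<noteq> 0" by (subst of_nat_eq_0_iff) simp
      then have q0: "q \<noteq> 0" by (simp add: q_def del: of_nat_add)
      have nq: "norm q = 1 / real (m + 2)" by (simp only: q_def norm_divide norm_of_nat norm_one)
      have nq2: "norm q \<le> 1/2" by (simp add: nq field_simps)
      have S: "(\<lambda>j. g j w * q ^ j) sums f (q *s (a + w *s v))"
        unfolding g_def by (rule slice_coeff_sums_smult[OF f])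
      have "(\<lambda>j. g (j + Suc k) w * q ^ (j + Suc k)) sums
           (f (q *s (a + w *s v)) - (\<Sum>j<Suc k. g j w * q ^ j))"
        using sums_split_initial_segment[OF S] .
      from sums_mult[OF this, of "(1 / q) ^ k"]
      have "(\<lambda>j. (1 / q) ^ k * (g (j + Suc k) w * q ^ (j + Suc k))) sums
           ((1/q)^k * (f (q *s (a + w *s v)) - (\<Sum>j<Suc k. g j w * q ^ j)))" .
      moreover have qk: "(1 / q) ^ k * q ^ k = 1" using q0 by (simp flip: power_mult_distrib)
      have "(1 / q) ^ k * (g (j + Suc k) w * q ^ (j + Suc k)) = g (j + Suc k) w * q ^ Suc j" for j
      proof -
        have "(1 / q) ^ k * (g (j + Suc k) w * q ^ (j + Suc k)) =
          ((1 / q) ^ k * q ^ k) * (g (j + Suc k) w * q ^ Suc j)"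
          by (simp only: power_add power_Suc mult_ac)
        then show ?thesis unfolding qk by simp
      qed
      moreover have "(1/q)^k * (f (q *s (a + w *s v)) - (\<Sum>j<Suc k. g j w * q ^ j)) = h m w - g k w"
      proof -
        have "(\<Sum>j<k. g j w * q ^ j) = (\<Sum>j<k. g j w / of_nat (m + 2) ^ j)"
          by (simp only: q_def power_one_over times_divide_eq_right mult_1_right)
        moreover have "1 / q = of_nat (m + 2)" by (simp add: q_def)
        moreover have "(1/q)^k * (X - (Y + g k w * q ^ k)) = (X - Y) * (1/q)^k - ((1/q)^k * q^k) * g k w" for X Y
          by (simp only: algebra_simps)
        ultimately show ?thesis unfolding h_def q_def[symmetric] qk sum.lessThan_Suc by simp
      qed
      ultimately have S2: "(\<lambda>j. g (j + Suc k) w * q ^ Suc j) sums (h m w - g k w)" by (simp only:)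
      have G: "(\<lambda>j. M * norm q * (1/2) ^ j) sums (M * norm q * (1 / (1 - 1/2)))"
        by (intro sums_mult geometric_sums) auto
      have "norm (\<Sum>j. g (j + Suc k) w * q ^ Suc j) \<le> (\<Sum>j. M * norm q * (1/2) ^ j)"
      proof (rule norm_suminf_le)
        show "norm (g (j + Suc k) w * q ^ Suc j) \<le> M * norm q * (1/2) ^ j" for j
        proof -
          have "norm (g (j + Suc k) w * q ^ Suc j) \<le> M * (norm q * norm q ^ j)"
            unfolding norm_mult norm_power power_Suc
            using gM[OF that] M(1) by (intro mult_mono) auto
          also have "\<dots> \<le> M * (norm q * (1/2) ^ j)"
            using M nq2 by (intro mult_left_mono power_mono) auto
          finally show ?thesis by simp
        qed
      qed (use G in \<open>auto simp: sums_iff\<close>)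
      then show ?thesis using S2 G by (simp add: sums_iff nq mult.commute)
    qed
    have "uniform_limit (cball x 1) h (g k) sequentially"
      unfolding uniform_limit_iff
    proof (intro allI impI)
      fix e :: real assume e: "e > 0"
      have "(\<lambda>m. 2 * M / of_nat (m + 2)) \<longlonglongrightarrow> 0"
        by (rule LIMSEQ_ignore_initial_segment[of "\<lambda>m. 2 * M / of_nat m" 0 2])
           (rule lim_const_over_n)
      then have "\<forall>\<^sub>F m in sequentially. 2 * M / of_nat (m + 2) < e"
        using e by (rule order_tendstoD)
      then show "\<forall>\<^sub>F m in sequentially. \<forall>w\<in>cball x 1. dist (h m w) (g k w) < e"
      proof eventually_elim
        case (elim m)
        show ?case
        proof
          fix w assume "w \<in> cball x 1"
          from est[OF this, of m] elim show "dist (h m w) (g k w) < e"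
            unfolding dist_norm by linarith
        qed
      qed
    qed
    then show "\<exists>d>0. cball x d \<subseteq> UNIV \<and> uniform_limit (cball x d) h (g k) sequentially"
      by (intro exI[of _ 1]) auto
  qed auto
  then show ?case by (simp add: g_def[abs_def])
qed

section \<open>Polynomials as finite sums of homogeneous ones\<close>

inductive polynomial_sum :: "(complex ^ 'n \<Rightarrow> complex) \<Rightarrow> bool" where
  zero: "polynomial_sum (\<lambda>_. 0)"
| add: "homogeneous_polynomial k P \<Longrightarrow> polynomial_sum G \<Longrightarrow> polynomial_sum (\<lambda>z. P z + G z)"

lemma homogeneous_polynomial_zero: "homogeneous_polynomial k (\<lambda>_. 0)"
  unfolding homogeneous_polynomial_def by (intro exI[of _ "\<lambda>_. 0"]) auto

lemma homogeneous_polynomial_const: "homogeneous_polynomial 0 (\<lambda>_ :: complex ^ 'n. c)"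
proof -
  have "multi_indices 0 = {\<lambda>_::'n. 0}" by (auto simp: multi_indices_def fun_eq_iff)
  then show ?thesis unfolding homogeneous_polynomial_def by (intro exI[of _ "\<lambda>_. c"]) auto
qed

lemma homogeneous_polynomial_add:
  assumes "homogeneous_polynomial k P" "homogeneous_polynomial k Q"
  shows "homogeneous_polynomial k (\<lambda>z. P z + Q z)"
proof -
  obtain a b where "\<And>z. P z = (\<Sum>m\<in>multi_indices k. a m * (\<Prod>i\<in>UNIV. (z $ i) ^ m i))"
    "\<And>z. Q z = (\<Sum>m\<in>multi_indices k. b m * (\<Prod>i\<in>UNIV. (z $ i) ^ m i))"
    using assms unfolding homogeneous_polynomial_def by blast
  then show ?thesis unfolding homogeneous_polynomial_def
    by (intro exI[of _ "\<lambda>m. a m + b m"]) (simp add: sum.distrib algebra_simps)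
qed

lemma homogeneous_polynomial_cmult:
  assumes "homogeneous_polynomial k P"
  shows "homogeneous_polynomial k (\<lambda>z. c * P z)"
proof -
  obtain a where "\<And>z. P z = (\<Sum>m\<in>multi_indices k. a m * (\<Prod>i\<in>UNIV. (z $ i) ^ m i))"
    using assms unfolding homogeneous_polynomial_def by blast
  then show ?thesis unfolding homogeneous_polynomial_def
    by (intro exI[of _ "\<lambda>m. c * a m"]) (simp add: sum_distrib_left algebra_simps)
qed

lemma homogeneous_polynomial_nth_mult:
  fixes P :: "complex ^ 'n \<Rightarrow> complex"
  assumes "homogeneous_polynomial k P"
  shows "homogeneous_polynomial (Suc k) (\<lambda>z. z $ i * P z)"
proof -
  obtain a where a: "\<And>z. P z = (\<Sum>m\<in>multi_indices k. a m * (\<Prod>i\<in>UNIV. (z $ i) ^ m i))"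
    using assms unfolding homogeneous_polynomial_def by blast
  define up where "up m = m(i := Suc (m i))" for m :: "'n \<Rightarrow> nat"
  have inj: "inj_on up A" for A
    by (rule inj_on_inverseI[where g = "\<lambda>m. m(i := m i - 1)"]) (simp add: up_def)
  have down: "(up m)(i := up m i - 1) = m" for m by (auto simp: up_def)
  have sub: "up ` multi_indices k \<subseteq> multi_indices (Suc k)"
  proof (clarify)
    fix m :: "'n \<Rightarrow> nat" assume m: "m \<in> multi_indices k"
    have "(\<Sum>j\<in>UNIV. up m j) = up m i + (\<Sum>j\<in>UNIV - {i}. up m j)"
      by (rule sum.remove) auto
    also have "(\<Sum>j\<in>UNIV - {i}. up m j) = (\<Sum>j\<in>UNIV - {i}. m j)"
      by (rule sum.cong) (auto simp: up_def)
    also have "up m i + \<dots> = Suc (\<Sum>j\<in>UNIV. m j)"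
      by (subst (2) sum.remove[of _ i]) (auto simp: up_def)
    finally show "up m \<in> multi_indices (Suc k)" using m by (simp add: multi_indices_def)
  qed
  \<comment> \<open>Monomials of degree \<open>Suc k\<close> without the variable \<open>i\<close>
    lie outside the image of \<open>up\<close> and get coefficient 0; on the image the truncated
    subtraction undoes \<open>up\<close>.\<close>
  define b where "b m = (if m \<in> up ` multi_indices k then a (m(i := m i - 1)) else 0)" for m
  have bup: "b (up m) = a m" if "m \<in> multi_indices k" for m
  proof -
    have "b (up m) = a ((up m)(i := up m i - 1))"
      unfolding b_def by (rule if_P) (rule imageI, rule that)
    then show ?thesis unfolding down .
  qed
  have mono: "(\<Prod>j\<in>UNIV. (z $ j) ^ up m j) = z $ i * (\<Prod>j\<in>UNIV. (z $ j) ^ m j)" for z :: "complex ^ 'n" and m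
  proof -
    have "(\<Prod>j\<in>UNIV. (z $ j) ^ up m j) = (z $ i) ^ up m i * (\<Prod>j\<in>UNIV-{i}. (z $ j) ^ up m j)"
      by (rule prod.remove) auto
    also have "(\<Prod>j\<in>UNIV-{i}. (z $ j) ^ up m j) = (\<Prod>j\<in>UNIV-{i}. (z $ j) ^ m j)"
      by (rule prod.cong) (auto simp: up_def)
    also have "(z $ i) ^ up m i * \<dots> = z $ i * (\<Prod>j\<in>UNIV. (z $ j) ^ m j)"
      by (subst (2) prod.remove[of _ i]) (auto simp: up_def)
    finally show ?thesis .
  qed
  have "z $ i * P z = (\<Sum>m\<in>multi_indices (Suc k). b m * (\<Prod>j\<in>UNIV. (z $ j) ^ m j))" for z
  proof -
    have "(\<Sum>m\<in>multi_indices (Suc k). b m * (\<Prod>j\<in>UNIV. (z $ j) ^ m j)) =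
      (\<Sum>m\<in>up ` multi_indices k. b m * (\<Prod>j\<in>UNIV. (z $ j) ^ m j))"
      by (rule sum.mono_neutral_right) (use sub in \<open>auto simp: b_def\<close>)
    also have "\<dots> = (\<Sum>m\<in>multi_indices k. b (up m) * (\<Prod>j\<in>UNIV. (z $ j) ^ up m j))"
      by (simp add: sum.reindex[OF inj])
    also have "\<dots> = (\<Sum>m\<in>multi_indices k. a m * (z $ i * (\<Prod>j\<in>UNIV. (z $ j) ^ m j)))"
      by (rule sum.cong) (simp_all only: mono bup)
    finally show ?thesis by (simp add: a sum_distrib_left mult_ac)
  qed
  then show ?thesis unfolding homogeneous_polynomial_def by blast
qed

lemma polynomial_sum_homogeneous: "homogeneous_polynomial k P \<Longrightarrow> polynomial_sum P"
  using polynomial_sum.add[OF _ polynomial_sum.zero] by fastforce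

lemma polynomial_sum_add:
  "polynomial_sum F \<Longrightarrow> polynomial_sum G \<Longrightarrow> polynomial_sum (\<lambda>z. F z + G z)"
  by (induction rule: polynomial_sum.induct) (auto simp: add.assoc intro: polynomial_sum.add)

lemma polynomial_sum_cmult: "polynomial_sum F \<Longrightarrow> polynomial_sum (\<lambda>z. c * F z)"
  by (induction rule: polynomial_sum.induct)
     (auto simp: distrib_left intro: polynomial_sum.intros homogeneous_polynomial_cmult)

lemma polynomial_sum_nth_mult: "polynomial_sum F \<Longrightarrow> polynomial_sum (\<lambda>z. z $ i * F z)"
  by (induction rule: polynomial_sum.induct)
     (auto simp: distrib_left intro: polynomial_sum.intros homogeneous_polynomial_nth_mult)

lemma polynomial_sum_sum:
  "(\<And>i. i \<in> A \<Longrightarrow> polynomial_sum (F i)) \<Longrightarrow> polynomial_sum (\<lambda>z. \<Sum>i\<in>A. F i z)"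
  by (induction A rule: infinite_finite_induct) (auto intro: polynomial_sum.zero polynomial_sum_add)

lemma polynomial_sum_poly_mult:
  assumes "polynomial_sum F"
  shows "polynomial_sum (\<lambda>z. poly p (z $ i) * F z)"
proof (induction p)
  case 0
  then show ?case by (simp add: polynomial_sum.zero)
next
  case (pCons a p)
  have "polynomial_sum (\<lambda>z. a * F z + z $ i * (poly p (z $ i) * F z))"
    by (intro polynomial_sum_add polynomial_sum_cmult polynomial_sum_nth_mult assms pCons)
  then show ?case by (simp add: algebra_simps)
qed

lemma polynomial_sum_decompose:
  fixes G :: "complex ^ 'n \<Rightarrow> complex"
  assumes "polynomial_sum G"
  obtains P K where "\<And>k. homogeneous_polynomial k (P k)" "\<And>z. G z = (\<Sum>k<K. P k z)"
proof -
  \<comment> \<open>The vanishing of \<open>P k\<close> from \<open>K\<close> on strengthens the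
    claim for the induction: the range of summation may then be extended to make room for a new
    component.\<close>
  have "\<exists>P K. (\<forall>k. homogeneous_polynomial k (P k)) \<and> (\<forall>k\<ge>K. P k = (\<lambda>_. 0)) \<and> (\<forall>z. G z = (\<Sum>k<K. P k z))"
    using assms
  proof (induction rule: polynomial_sum.induct)
    case zero
    show ?case by (intro exI[of _ "\<lambda>_ _. 0"] exI[of _ 0]) (simp add: homogeneous_polynomial_zero)
  next
    case (add k Q G)
    then obtain P K where P: "\<And>k. homogeneous_polynomial k (P k)" "\<And>k. k \<ge> K \<Longrightarrow> P k = (\<lambda>_. 0)"
      "\<And>z. G z = (\<Sum>k<K. P k z)" by blast
    define P' where "P' j = (if j = k then (\<lambda>z. Q z + P k z) else P j)" for j
    define N where "N = max K (Suc k)"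
    have "homogeneous_polynomial j (P' j)" for j
      using add P by (auto simp: P'_def homogeneous_polynomial_add)
    moreover have "P' j = (\<lambda>_. 0)" if "j \<ge> N" for j
      using that P by (auto simp: P'_def N_def)
    moreover have "Q z + G z = (\<Sum>j<N. P' j z)" for z
    proof -
      have "(\<Sum>j<N. P' j z) = (\<Sum>j<N. P j z + (if j = k then Q z else 0))"
        by (rule sum.cong) (auto simp: P'_def)
      also have "\<dots> = (\<Sum>j<N. P j z) + Q z"
        by (subst sum.distrib) (simp add: N_def sum.delta)
      also have "(\<Sum>j<N. P j z) = (\<Sum>j<K. P j z)"
        by (rule sum.mono_neutral_right) (auto simp: N_def P(2))
      finally show ?thesis by (simp add: P(3))
    qed
    ultimately show ?case by blast
  qed
  then show ?thesis using that by blast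
qed

section \<open>Functions that are polynomial in each variable\<close>

definition vec_upd :: "complex ^ 'n \<Rightarrow> 'n \<Rightarrow> complex \<Rightarrow> complex ^ 'n" where
  "vec_upd z i w = (\<chi> j. if j = i then w else z $ j)"

lemma vec_upd_line: "vec_upd z i w = vec_upd z i 0 + w *s axis i 1"
  by (simp add: vec_upd_def vec_eq_iff axis_def)

lemma vec_upd_swap: "i \<noteq> j \<Longrightarrow> vec_upd (vec_upd z i a) j b = vec_upd (vec_upd z j b) i a"
  by (auto simp: vec_upd_def vec_eq_iff)

lemma vec_upd_nth [simp]: "vec_upd z i (z $ i) = z"
  by (simp add: vec_upd_def vec_eq_iff)

text \<open>Interpolation at the nodes \<open>0, ..., k\<close>. The basis \<open>l\<close> does not
  depend on \<open>p\<close>, so the formula can be applied with the other variables as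
  parameters.\<close>

lemma lagrange_interpolation:
  "\<exists>l :: nat \<Rightarrow> complex poly. \<forall>p. degree p \<le> k \<longrightarrow> p = (\<Sum>j\<le>k. smult (poly p (of_nat j)) (l j))"
proof -
  define q :: "nat \<Rightarrow> complex poly" where "q j = (\<Prod>i\<in>{..k}-{j}. [:- of_nat i, 1:])" for j
  define l where "l j = smult (1 / poly (q j) (of_nat j)) (q j)" for j
  have q0: "poly (q j) (of_nat j) \<noteq> 0" for j
    by (auto simp: q_def poly_prod)
  have ld: "poly (l j) (of_nat i) = (if i = j then 1 else 0)" if "i \<le> k" for i j
    using that q0 by (auto simp: l_def q_def poly_prod)
  have dq: "degree (q j) \<le> k" if "j \<le> k" for j
  proof -
    have "degree (q j) = (\<Sum>i\<in>{..k}-{j}. degree [:- of_nat i, 1 :: complex:])"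
      unfolding q_def by (rule degree_prod_eq_sum_degree) auto
    with that show ?thesis by simp
  qed
  have dl: "degree (l j) \<le> k" if "j \<le> k" for j
    using dq[OF that] degree_smult_le[of "1 / poly (q j) (of_nat j)" "q j"] by (simp add: l_def)
  have "p = (\<Sum>j\<le>k. smult (poly p (of_nat j)) (l j))" if p: "degree p \<le> k" for p
  proof (rule poly_eqI_degree)
    show "poly p x = poly (\<Sum>j\<le>k. smult (poly p (of_nat j)) (l j)) x" if x: "x \<in> of_nat ` {..k}" for x
    proof -
      obtain i where i: "i \<le> k" "x = of_nat i" using x by auto
      have "poly (\<Sum>j\<le>k. smult (poly p (of_nat j)) (l j)) x = (\<Sum>j\<le>k. if i = j then poly p (of_nat j) else 0)"
        unfolding i(2) poly_sum by (rule sum.cong) (use i ld in auto)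
      also have "\<dots> = poly p x" using i by (simp add: sum.delta')
      finally show ?thesis by simp
    qed
    have c: "card (of_nat ` {..k} :: complex set) = Suc k"
      by (subst card_image) (auto simp: inj_on_def)
    show "degree p < card (of_nat ` {..k} :: complex set)" using p c by simp
    have "degree (\<Sum>j\<le>k. smult (poly p (of_nat j)) (l j)) \<le> k"
      by (intro degree_sum_le order_trans[OF degree_smult_le] dl) auto
    then show "degree (\<Sum>j\<le>k. smult (poly p (of_nat j)) (l j)) < card (of_nat ` {..k} :: complex set)"
      using c by simp
  qed
  then show ?thesis by blast
qed

text \<open>Induction on the set of variables on which \<open>G\<close> may depend. Interpolation in
  \<open>z $ i\<close> writes \<open>G z\<close> as a combination of
  \<open>poly (l j) (z $ i)\<close> with the values of \<open>G\<close> at \<open>z $ i = j\<close>,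
  and these depend on one variable less. The common degree bound \<open>k\<close> allows the same
  nodes whatever the remaining variables are.\<close>

lemma separately_polynomial_imp_polynomial:
  fixes G :: "complex ^ 'n \<Rightarrow> complex"
  assumes "finite S" "\<And>i z. i \<in> S \<Longrightarrow> \<exists>p. degree p \<le> k \<and> (\<forall>w. G (vec_upd z i w) = poly p w)"
    "\<And>i z w. i \<notin> S \<Longrightarrow> G (vec_upd z i w) = G z"
  shows "polynomial_sum G"
  using assms
proof (induction S arbitrary: G rule: finite_induct)
  case empty
  have const: "G z = G 0" for z
  proof -
    \<comment> \<open>All coordinates are replaced by 0, one at a time.\<close>
    have "G z = G (\<chi> i. if i \<in> A then 0 else z $ i)" if "finite A" for A
      using that
    proof (induction A)
      case (insert i A)
      have "(\<chi> j. if j \<in> insert i A then 0 else z $ j) = vec_upd (\<chi> i. if i \<in> A then 0 else z $ i) i 0"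
        by (auto simp: vec_upd_def vec_eq_iff)
      with insert empty(2) show ?case by simp
    qed simp
    from this[of UNIV] show ?thesis by (simp add: zero_vec_def)
  qed
  have "G = (\<lambda>_. G 0)" by (rule ext) (rule const)
  then show ?case
    by (rule ssubst[where P = polynomial_sum])
       (rule polynomial_sum_homogeneous[OF homogeneous_polynomial_const])
next
  case (insert i S)
  obtain l :: "nat \<Rightarrow> complex poly" where
    l: "\<And>p. degree p \<le> k \<Longrightarrow> p = (\<Sum>j\<le>k. smult (poly p (of_nat j)) (l j))"
    using lagrange_interpolation by metis
  have eq: "G z = (\<Sum>j\<le>k. poly (l j) (z $ i) * G (vec_upd z i (of_nat j)))" for z
  proof -
    obtain p where p: "degree p \<le> k" "\<And>w. G (vec_upd z i w) = poly p w"
      using insert.prems(1) by blast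
    have "G z = poly p (z $ i)" using p(2)[of "z $ i"] by simp
    also have "\<dots> = poly (\<Sum>j\<le>k. smult (poly p (of_nat j)) (l j)) (z $ i)"
      by (rule arg_cong[where f = "\<lambda>q. poly q (z $ i)", OF l[OF p(1)]])
    also have "\<dots> = (\<Sum>j\<le>k. poly (l j) (z $ i) * G (vec_upd z i (of_nat j)))"
      by (simp add: poly_sum p(2) mult.commute)
    finally show ?thesis .
  qed
  have "polynomial_sum (\<lambda>z. G (vec_upd z i (of_nat j)))" for j
  proof (rule insert.IH)
    show "\<exists>p. degree p \<le> k \<and> (\<forall>w. G (vec_upd (vec_upd z i' w) i (of_nat j)) = poly p w)" if "i' \<in> S" for i' z
    proof -
      have "i' \<noteq> i" using that insert by auto
      then show ?thesis using insert.prems(1)[of i' "vec_upd z i (of_nat j)"] that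
        by (simp add: vec_upd_swap)
    qed
    show "G (vec_upd (vec_upd z i' w) i (of_nat j)) = G (vec_upd z i (of_nat j))" if "i' \<notin> S" for i' z w
    proof (cases "i' = i")
      case True
      then have "vec_upd (vec_upd z i' w) i (of_nat j) = vec_upd z i (of_nat j)"
        by (simp add: vec_upd_def vec_eq_iff)
      then show ?thesis by simp
    next
      case False
      with that have "i' \<notin> insert i S" by simp
      then show ?thesis by (subst vec_upd_swap[OF False]) (rule insert.prems(2))
    qed
  qed
  then have sum: "polynomial_sum (\<lambda>z. \<Sum>j\<le>k. poly (l j) (z $ i) * G (vec_upd z i (of_nat j)))"
    by (intro polynomial_sum_sum polynomial_sum_poly_mult)
  have "G = (\<lambda>z. \<Sum>j\<le>k. poly (l j) (z $ i) * G (vec_upd z i (of_nat j)))"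
    by (rule ext) (rule eq)
  then show ?case
    by (rule ssubst[where P = polynomial_sum]) (rule sum)
qed

text \<open>As a function of one coordinate the coefficient is entire and grows like the
  \<open>k\<close>-th power, so by Liouville it is a polynomial of degree at most \<open>k\<close>.
  Homogeneity under scalars then eliminates all components of other degrees.\<close>

lemma slice_coeff_homogeneous_polynomial:
  fixes f :: "complex ^ 'n \<Rightarrow> complex"
  assumes f: "entire f"
  shows "homogeneous_polynomial k (slice_coeff f k)"
proof -
  obtain M where M: "M > 0" "\<And>z. norm z \<le> 1 \<Longrightarrow> norm (f z) \<le> M"
    using entire_bounded_cball[OF f] by blast
  have "polynomial_sum (slice_coeff f k)"
  proof (rule separately_polynomial_imp_polynomial[of UNIV k])
    fix i :: 'n and z :: "complex ^ 'n"
    let ?g = "\<lambda>w. slice_coeff f k (vec_upd z i w)"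
    let ?a = "vec_upd z i 0"
    define c where "c j = (deriv ^^ j) ?g 0 / fact j" for j
    define p where "p = (\<Sum>j\<le>k. monom (c j) j)"
    have "?g w = (\<Sum>j\<le>k. c j * w ^ j)" for w
      unfolding c_def
    \<comment> \<open>Once \<open>norm w\<close> is at least \<open>norm ?a\<close>, the vector has
      norm at most \<open>2 * norm w\<close>; this gives the threshold and the factor
      \<open>2 ^ k\<close>.\<close>
    proof (rule Liouville_polynomial[where A = "norm ?a" and B = "M * 2 ^ k"])
      show "?g holomorphic_on UNIV"
        by (subst vec_upd_line) (rule slice_coeff_line_holomorphic[OF f])
      show "norm (?g w) \<le> M * 2 ^ k * norm w ^ k" if "norm ?a \<le> norm w" for w
      proof -
        have "norm (vec_upd z i w) \<le> norm ?a + norm w * norm (axis i 1 :: complex ^ 'n)"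
          by (subst vec_upd_line) (metis norm_triangle_ineq norm_vector_smult)
        also have "\<dots> \<le> 2 * norm w" using that by (simp add: norm_Basis axis_in_Basis_iff)
        finally have "M * norm (vec_upd z i w) ^ k \<le> M * (2 * norm w) ^ k"
          using M by (intro mult_left_mono power_mono) auto
        with slice_coeff_bound[OF f zero_less_one M(2), where z = "vec_upd z i w" and k = k] show ?thesis
          by (simp add: power_mult_distrib)
      qed
    qed
    then have "?g w = poly p w" for w by (simp add: p_def poly_sum poly_monom)
    moreover have "degree p \<le> k" unfolding p_def
      by (rule degree_sum_le) (auto intro: order_trans[OF degree_monom_le])
    ultimately show "\<exists>p. degree p \<le> k \<and> (\<forall>w. slice_coeff f k (vec_upd z i w) = poly p w)" by blast
  qed auto
  then obtain P K where P: "\<And>k. homogeneous_polynomial k (P k)" "\<And>z. slice_coeff f k z = (\<Sum>k<K. P k z)"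
    by (rule polynomial_sum_decompose) blast
  \<comment> \<open>\<open>w \<mapsto> slice_coeff f k (w *s z)\<close> has two expansions: the one
    with coefficients \<open>P j z\<close>, and the single term
    \<open>slice_coeff f k z * w ^ k\<close>. For \<open>k \<ge> K\<close> the coefficient is
    therefore zero.\<close>
  have "slice_coeff f k = (\<lambda>z. if k < K then P k z else 0)"
  proof
    fix z
    have "(\<lambda>j. (if j < K then P j z else 0) * w ^ j) sums (slice_coeff f k (w *s z))" for w
    proof -
      have "(\<lambda>j. (if j < K then P j z else 0) * w ^ j) sums (\<Sum>j<K. (if j < K then P j z else 0) * w ^ j)"
        by (rule sums_finite) auto
      also have "(\<Sum>j<K. (if j < K then P j z else 0) * w ^ j) = (\<Sum>j<K. P j (w *s z))"
        by (rule sum.cong) (auto simp: homogeneous_polynomial_smult[OF P(1)])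
      finally show ?thesis by (simp add: P(2))
    qed
    moreover have "(\<lambda>j. (if j = k then slice_coeff f k z else 0) * w ^ j) sums (slice_coeff f k (w *s z))" for w
    proof -
      have "(\<lambda>j. if j = k then slice_coeff f j z * w ^ j else 0) sums (slice_coeff f k z * w ^ k)"
        by (rule sums_single)
      moreover have "(\<lambda>j. if j = k then slice_coeff f j z * w ^ j else 0) =
         (\<lambda>j. (if j = k then slice_coeff f k z else 0) * w ^ j)" by auto
      ultimately show ?thesis by (simp add: slice_coeff_smult[OF f] mult.commute)
    qed
    ultimately have "(if k < K then P k z else 0) = (if k = k then slice_coeff f k z else 0)"
      by (rule power_series_unique)
    then show "slice_coeff f k z = (if k < K then P k z else 0)" by simp
  qed
  then show ?thesis using P(1) homogeneous_polynomial_zero by (cases "k < K") simp_all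
qed

lemma homogeneous_expansion_slice_coeff:
  "entire f \<Longrightarrow> homogeneous_expansion f (slice_coeff f)"
  unfolding homogeneous_expansion_def
  by (simp add: slice_coeff_homogeneous_polynomial slice_coeff_sums)

text \<open>On the line through \<open>z\<close> the expansion is a power series of the slice, so
  its coefficients are determined.\<close>

lemma homogeneous_expansion_unique:
  assumes "entire f" "homogeneous_expansion f F"
  shows "F = slice_coeff f"
proof (intro ext)
  fix k z
  have "(\<lambda>k. F k z * w ^ k) sums f (w *s z)" for w
  proof -
    have "(\<lambda>k. F k (w *s z)) sums f (w *s z)"
      using assms(2) unfolding homogeneous_expansion_def by blast
    moreover have "F k (w *s z) = F k z * w ^ k" for k
      using assms(2) homogeneous_polynomial_smult unfolding homogeneous_expansion_def
      by (metis mult.commute)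
    ultimately show ?thesis by simp
  qed
  from slice_coeff_unique[OF assms(1) this] show "F k z = slice_coeff f k z" .
qed

lemma homogeneous_part_eq_slice_coeff:
  assumes "entire f"
  shows "homogeneous_part f = slice_coeff f"
  unfolding homogeneous_part_def
  by (rule the_equality) (use assms homogeneous_expansion_slice_coeff homogeneous_expansion_unique in blast)+

subsection \<open>Radial multipliers\<close>

text \<open>Cauchy's inequality on the circle of radius \<open>1 / norm v\<close> in the direction
  \<open>v\<close>. A sup bound becomes an operator norm bound on the derivative, as termwise
  differentiation demands.\<close>

lemma entire_deriv_bound:
  fixes P :: "complex ^ 'n \<Rightarrow> complex"
  assumes P: "entire P" "(P has_derivative P') (at z)" "\<And>c v. P' (c *s v) = c * P' v"
    and M: "\<And>u. norm (u - z) \<le> 1 \<Longrightarrow> norm (P u) \<le> M"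
  shows "norm (P' v) \<le> M * norm v"
proof (cases "v = 0")
  case True
  then show ?thesis using P(3)[of 0 v] by simp
next
  case False
  let ?g = "\<lambda>w. P (z + w *s v)"
  have "((\<lambda>w. z + w *s v) has_derivative (\<lambda>h. h *s v)) (at 0)"
    by (auto intro!: derivative_eq_intros
        bounded_linear.has_derivative[OF bounded_linear_vector_smult_left])
  then have "(?g has_derivative (\<lambda>h. P' (h *s v))) (at 0)"
    by (rule has_derivative_compose) (simp add: P(2))
  then have "(?g has_field_derivative P' v) (at 0)"
    unfolding has_field_derivative_def by (rule has_derivative_eq_rhs) (simp add: P(3) fun_eq_iff mult.commute)
  then have "deriv ?g 0 = P' v" by (rule DERIV_imp_deriv)
  moreover have "norm ((deriv ^^ 1) ?g 0) \<le> fact 1 * M / (1 / norm v) ^ 1"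
  proof (rule Cauchy_inequality)
    show "?g holomorphic_on ball 0 (1 / norm v)" "continuous_on (cball 0 (1 / norm v)) ?g"
      using entire_line_holomorphic[OF P(1), of z v]
      by (auto intro: holomorphic_on_imp_continuous_on)
    show "norm (?g x) \<le> M" if "norm (0 - x) = 1 / norm v" for x
      using that False by (intro M) (simp add: norm_vector_smult)
  qed (use False in auto)
  ultimately show ?thesis by simp
qed

definition slice_mult :: "(nat \<Rightarrow> real) \<Rightarrow> (complex ^ 'n \<Rightarrow> complex) \<Rightarrow> complex ^ 'n \<Rightarrow> complex" where
  "slice_mult c f z = (\<Sum>k. of_real (c k) * slice_coeff f k z)"

lemma slice_mult_term_bound:
  assumes "entire f" "R > 0" "q > 0" "\<And>k. \<bar>c k\<bar> \<le> B * q ^ k"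
  obtains M where "M \<ge> 0" "\<And>k z. norm z \<le> R \<Longrightarrow> norm (of_real (c k) * slice_coeff f k z) \<le> M * (1 / 2) ^ k"
proof -
  \<comment> \<open>With this Cauchy radius the \<open>k\<close>-th term is at most
    \<open>B * M * (q * R / r) ^ k\<close>, and the ratio is \<open>1 / 2\<close>: any geometric
    growth of the multiplier is beaten.\<close>
  define r where "r = 2 * q * R"
  have r: "r > 0" using assms by (simp add: r_def)
  obtain M where M: "M > 0" "\<And>z. norm z \<le> r \<Longrightarrow> norm (f z) \<le> M"
    using entire_bounded_cball[OF assms(1)] by blast
  have B: "B \<ge> 0" using assms(4)[of 0] by simp
  have "norm (of_real (c k) * slice_coeff f k z) \<le> (B * M) * (1 / 2) ^ k" if z: "norm z \<le> R" for k z
  proof -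
    have "norm (slice_coeff f k z) \<le> M * (norm z / r) ^ k"
      by (rule slice_coeff_bound[OF assms(1) r M(2)])
    also have "\<dots> \<le> M * (R / r) ^ k"
      using z M r by (intro mult_left_mono power_mono divide_right_mono) auto
    finally have "norm (of_real (c k) * slice_coeff f k z) \<le> (B * q ^ k) * (M * (R / r) ^ k)"
      unfolding norm_mult using assms(4)[of k] by (intro mult_mono) auto
    also have "\<dots> = (B * M) * (q * (R / r)) ^ k" unfolding power_mult_distrib by (simp only: mult_ac)
    also have "q * (R / r) = 1 / 2" using assms(2,3) by (simp add: r_def)
    finally show ?thesis .
  qed
  then show ?thesis using that[of "B * M"] B M by simp
qed

lemma slice_mult_summable:
  assumes "entire f" "q > 0" "\<And>k. \<bar>c k\<bar> \<le> B * q ^ k"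
  shows "summable (\<lambda>k. norm (of_real (c k) * slice_coeff f k z))"
proof -
  obtain M where M: "\<And>k u. norm u \<le> norm z + 1 \<Longrightarrow> norm (of_real (c k) * slice_coeff f k u) \<le> M * (1 / 2) ^ k"
    by (rule slice_mult_term_bound[OF assms(1) _ assms(2,3), of "norm z + 1"])
       (auto intro: add_nonneg_pos)
  have "summable (\<lambda>k. M * (1 / 2 :: real) ^ k)"
    by (intro summable_mult summable_geometric) simp
  then show ?thesis
    by (rule summable_comparison_test'[where N = 0]) (use M in simp)
qed

text \<open>Termwise differentiation on a ball containing \<open>z\<close>: both the series and that
  of the derivatives are dominated by geometric series, and complex homogeneity of the derivative
  survives the summation.\<close>

lemma slice_mult_entire:
  fixes f :: "complex ^ 'n \<Rightarrow> complex"
  assumes f: "entire f" and q: "q > 0" and c: "\<And>k. \<bar>c k\<bar> \<le> B * q ^ k"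
  shows "entire (slice_mult c f)"
proof -
  define P where "P k z = of_real (c k) * slice_coeff f k z" for k z
  have Pe: "entire (P k)" for k
    unfolding P_def[abs_def]
    by (intro entire_mult entire_const homogeneous_polynomial_entire[OF slice_coeff_homogeneous_polynomial[OF f]])
  have "\<exists>P'. \<forall>z. (P k has_derivative P' z) (at z) \<and> (\<forall>c v. P' z (c *s v) = c * P' z v)" for k
    using entireE[OF Pe[of k]] by metis
  then obtain P' where P': "\<And>k z. (P k has_derivative P' k z) (at z)"
    "\<And>k z c v. P' k z (c *s v) = c * P' k z v"
    by metis
  define G where "G z v = (\<Sum>k. P' k z v)" for z v
  have ex: "(slice_mult c f has_derivative G z) (at z) \<and> (\<forall>c v. G z (c *s v) = c * G z v)" for z
  proof -
    define R where "R = norm z + 1"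
    have R: "R > 0" by (auto simp: R_def intro!: add_nonneg_pos)
    \<comment> \<open>Radius \<open>R + 1\<close>, since the derivative at a point of the ball is
      controlled by values up to distance 1.\<close>
    obtain M where M: "M \<ge> 0" "\<And>k u. norm u \<le> R + 1 \<Longrightarrow> norm (P k u) \<le> M * (1 / 2) ^ k"
      unfolding P_def by (rule slice_mult_term_bound[OF f _ q c, of "R + 1"]) (use R in auto)
    have bd: "norm (P' k u v) \<le> (M * norm v) * (1 / 2) ^ k" if "u \<in> ball 0 R" for k u v
    proof -
      have "norm (P' k u v) \<le> (M * (1 / 2) ^ k) * norm v"
      proof (rule entire_deriv_bound[OF Pe P'])
        fix x assume "norm (x - u) \<le> 1"
        then have "norm x \<le> R + 1" using that norm_triangle_ineq[of u "x - u"] by simp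
        then show "norm (P k x) \<le> M * (1 / 2) ^ k" by (rule M)
      qed
      then show ?thesis by (simp add: mult_ac)
    qed
    have geo: "summable (\<lambda>k. C * (1 / 2 :: real) ^ k)" for C
      by (intro summable_mult summable_geometric) auto
    have summ: "summable (\<lambda>k. P' k u v)" if "u \<in> ball 0 R" for u v
      by (rule summable_comparison_test'[OF geo bd[OF that]])
    \<comment> \<open>The remainder must be proportional to \<open>norm v\<close>, for convergence
      of the derivatives is required uniformly as linear maps.\<close>
    have tail: "norm ((\<Sum>k<n. P' k u v) - G u v) \<le> (2 * M * norm v) * (1 / 2) ^ n" if "u \<in> ball 0 R" for u v n
    proof -
      have "G u v - (\<Sum>k<n. P' k u v) = (\<Sum>k. P' (k + n) u v)"
        unfolding G_def using suminf_split_initial_segment[OF summ[OF that, of v], of n] by simp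
      also have "norm \<dots> \<le> (\<Sum>k. (M * norm v * (1 / 2) ^ n) * (1 / 2) ^ k)"
      proof (rule norm_suminf_le[OF _ geo])
        show "norm (P' (k + n) u v) \<le> (M * norm v * (1 / 2) ^ n) * (1 / 2) ^ k" for k
          using bd[OF that, where k = "k + n" and v = v] by (simp add: power_add mult_ac)
      qed
      also have "\<dots> = (M * norm v * (1 / 2) ^ n) * 2"
        by (subst suminf_mult) (auto simp: suminf_geometric)
      finally show ?thesis by (simp add: norm_minus_commute mult_ac)
    qed
    have "\<exists>g. \<forall>u\<in>ball 0 R. (\<lambda>n. P n u) sums g u \<and> (g has_derivative G u) (at u within ball 0 R)"
    proof (rule has_derivative_series)
      show "(P n has_derivative P' n u) (at u within ball 0 R)" for n u
        by (rule has_derivative_at_withinI[OF P'(1)])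
      show "\<forall>\<^sub>F n in sequentially. \<forall>u\<in>ball 0 R. \<forall>h. norm ((\<Sum>i<n. P' i u h) - G u h) \<le> e * norm h"
        if e: "e > 0" for e
      proof -
        have "(\<lambda>n. (2 * M) * (1 / 2 :: real) ^ n) \<longlonglongrightarrow> (2 * M) * 0"
          by (intro tendsto_mult tendsto_const LIMSEQ_realpow_zero) auto
        then have "\<forall>\<^sub>F n in sequentially. (2 * M) * (1 / 2 :: real) ^ n < e"
          using e by (intro order_tendstoD(2)[where y = "2 * M * 0"]) auto
        then show ?thesis
        proof eventually_elim
          case (elim n)
          show ?case
          proof (intro ballI allI)
            fix u :: "complex ^ 'n" and h assume u: "u \<in> ball 0 R"
            have "norm ((\<Sum>i<n. P' i u h) - G u h) \<le> (2 * M * (1 / 2) ^ n) * norm h"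
              using tail[OF u, where n = n and v = h] by (simp add: mult_ac)
            also have "\<dots> \<le> e * norm h" using elim by (intro mult_right_mono) auto
            finally show "norm ((\<Sum>i<n. P' i u h) - G u h) \<le> e * norm h" .
          qed
        qed
      qed
      show "0 \<in> ball (0 :: complex ^ 'n) R" using R by simp
      show "convex (ball (0 :: complex ^ 'n) R)" by (rule convex_ball)
      show "(\<lambda>n. P n 0) sums (\<Sum>n. P n 0)"
        unfolding P_def by (intro summable_sums summable_norm_cancel[OF slice_mult_summable[OF f q c]])
    qed
    then obtain g where g: "\<And>u. u \<in> ball 0 R \<Longrightarrow> (\<lambda>n. P n u) sums g u"
      "\<And>u. u \<in> ball 0 R \<Longrightarrow> (g has_derivative G u) (at u within ball 0 R)" by blast
    have z: "z \<in> ball 0 R" by (simp add: R_def)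
    have "(g has_derivative G z) (at z)"
      using g(2)[OF z] at_within_open[OF z] by simp
    then have "(slice_mult c f has_derivative G z) (at z)"
    proof (rule has_derivative_transform_within_open[OF _ open_ball z])
      fix u :: "complex ^ 'n" assume "u \<in> ball 0 R"
      from g(1)[OF this] show "g u = slice_mult c f u"
        by (simp add: slice_mult_def P_def sums_iff)
    qed
    moreover have "G z (a *s v) = a * G z v" for a v
      unfolding G_def P'(2) by (rule suminf_mult[OF summ[OF z]])
    ultimately show ?thesis by blast
  qed
  show ?thesis unfolding entire_def using ex by blast
qed

lemma slice_coeff_add:
  assumes "entire f" "entire g"
  shows "slice_coeff (\<lambda>z. f z + g z) k z = slice_coeff f k z + slice_coeff g k z"
proof -
  have "(\<lambda>k. (slice_coeff f k z + slice_coeff g k z) * w ^ k) sums (f (w *s z) + g (w *s z))" for w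
    using sums_add[OF slice_coeff_sums_smult[OF assms(1)] slice_coeff_sums_smult[OF assms(2)]]
    by (simp add: distrib_right)
  from slice_coeff_unique[OF entire_add[OF assms] this] show ?thesis by simp
qed

lemma slice_coeff_cmult:
  assumes "entire f"
  shows "slice_coeff (\<lambda>z. c * f z) k z = c * slice_coeff f k z"
proof -
  have "(\<lambda>k. (c * slice_coeff f k z) * w ^ k) sums (c * f (w *s z))" for w
    using sums_mult[OF slice_coeff_sums_smult[OF assms]] by (simp add: mult.assoc)
  from slice_coeff_unique[OF entire_mult[OF entire_const assms] this] show ?thesis by simp
qed

lemma slice_mult_add:
  assumes "entire f" "entire g" "q > 0" "\<And>k. \<bar>c k\<bar> \<le> B * q ^ k"
  shows "slice_mult c (\<lambda>z. f z + g z) z = slice_mult c f z + slice_mult c g z"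
  using suminf_add[OF slice_mult_summable[OF assms(1,3,4), THEN summable_norm_cancel]
      slice_mult_summable[OF assms(2,3,4), THEN summable_norm_cancel]]
  by (simp add: slice_mult_def slice_coeff_add assms distrib_left)

lemma slice_mult_cmult:
  assumes "entire f" "q > 0" "\<And>k. \<bar>c k\<bar> \<le> B * q ^ k"
  shows "slice_mult c (\<lambda>z. a * f z) z = a * slice_mult c f z"
  using suminf_mult[OF slice_mult_summable[OF assms, THEN summable_norm_cancel], of a]
  by (simp add: slice_mult_def slice_coeff_cmult assms mult.left_commute)

subsection \<open>Multipliers of finite order\<close>

text \<open>For positive \<open>\<omega>\<close> this is Lipschitz continuity of
  \<open>ln \<omega>\<close> with constant \<open>L\<close>. The multiplicative form admits the zero
  weight too, which is the majorant of \<open>f = 0\<close>.\<close>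

definition moderate :: "real \<Rightarrow> ('a::real_normed_vector \<Rightarrow> real) \<Rightarrow> bool" where
  "moderate L \<omega> \<longleftrightarrow> (\<forall>x. 0 \<le> \<omega> x) \<and> (\<forall>x y. \<omega> x \<le> \<omega> y * exp (L * norm (x - y)))"

lemma moderateD:
  assumes "moderate L \<omega>"
  shows "0 \<le> \<omega> x" "\<omega> x \<le> \<omega> y * exp (L * norm (x - y))"
  using assms by (auto simp: moderate_def)

text \<open>Peetre's inequality: \<open>1 + norm u\<close> is at most
  \<open>(1 + norm v) * (1 + norm (u - v))\<close>, and the last factor is below the exponential.
  For negative \<open>t\<close> it is used with the points exchanged.\<close>

lemma one_plus_norm_powr_le:
  fixes x y :: "'a::real_normed_vector"
  shows "(1 + norm x) powr t \<le> (1 + norm y) powr t * exp (\<bar>t\<bar> * norm (x - y))"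
proof -
  have *: "1 + norm u \<le> (1 + norm v) * exp (norm (u - v))" for u v :: 'a
  proof -
    have "1 + norm u \<le> (1 + norm v) * (1 + norm (u - v))"
    proof -
      have "0 \<le> norm v * norm (u - v)" by simp
      moreover have "norm u \<le> norm v + norm (u - v)" using norm_triangle_ineq[of v "u - v"] by simp
      ultimately show ?thesis unfolding distrib_left distrib_right by linarith
    qed
    also have "\<dots> \<le> (1 + norm v) * exp (norm (u - v))"
      by (intro mult_left_mono exp_ge_add_one_self) auto
    finally show ?thesis .
  qed
  have pos: "0 < 1 + norm u" for u :: 'a by (rule add_pos_nonneg) auto
  show ?thesis
  proof (cases "t \<ge> 0")
    case True
    have "(1 + norm x) powr t \<le> ((1 + norm y) * exp (norm (x - y))) powr t"
      using * True by (intro powr_mono2) auto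
    also have "\<dots> = (1 + norm y) powr t * exp (\<bar>t\<bar> * norm (x - y))"
      using True by (simp add: powr_mult exp_powr_real mult.commute)
    finally show ?thesis .
  next
    case False
    have "((1 + norm x) * exp (norm (x - y))) powr t \<le> (1 + norm y) powr t"
      using *[of y x] False pos[of y] by (intro powr_mono2') (auto simp: norm_minus_commute)
    then have "(1 + norm x) powr t * exp (t * norm (x - y)) \<le> (1 + norm y) powr t"
      by (simp add: powr_mult exp_powr_real mult.commute)
    then have "(1 + norm x) powr t * exp (t * norm (x - y)) * exp (- (t * norm (x - y))) \<le>
      (1 + norm y) powr t * exp (- (t * norm (x - y)))"
      by (intro mult_right_mono) auto
    then show ?thesis using False by (simp add: mult.assoc flip: exp_add)
  qed
qed

lemma moderate_one_plus_norm_powr: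
  assumes "moderate L \<omega>" "C \<ge> 0"
  shows "moderate (L + \<bar>t\<bar>) (\<lambda>x. C * \<omega> x * (1 + norm x) powr t)"
  unfolding moderate_def
proof (intro conjI allI)
  fix x y
  have "C * \<omega> x * (1 + norm x) powr t \<le>
    (C * (\<omega> y * exp (L * norm (x - y)))) * ((1 + norm y) powr t * exp (\<bar>t\<bar> * norm (x - y)))"
    using assms moderateD[OF assms(1)]
    by (intro mult_mono mult_left_mono one_plus_norm_powr_le) (auto intro!: mult_nonneg_nonneg)
  then show "C * \<omega> x * (1 + norm x) powr t \<le> C * \<omega> y * (1 + norm y) powr t * exp ((L + \<bar>t\<bar>) * norm (x - y))"
    by (simp add: distrib_right exp_add mult_ac)
qed (use assms moderateD[OF assms(1)] in auto)

text \<open>The quantifiers carry the meaning: \<open>C\<close> may depend on \<open>L\<close> but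
  not on \<open>\<omega>\<close> or \<open>f\<close>, so that the weight can be adapted to each
  function; and every \<open>L\<close> is allowed, because composition enlarges it.\<close>

definition fock_order :: "real \<Rightarrow> ((complex ^ 'n \<Rightarrow> complex) \<Rightarrow> complex ^ 'n \<Rightarrow> complex) \<Rightarrow> bool" where
  "fock_order s T \<longleftrightarrow> (\<forall>L\<ge>0. \<exists>C\<ge>0. \<forall>\<omega> f. moderate L \<omega> \<longrightarrow> entire f \<longrightarrow>
     (\<forall>z. norm (f z) \<le> \<omega> z * exp ((norm z)\<^sup>2 / 2)) \<longrightarrow>
     (\<forall>z. norm (T f z) \<le> C * \<omega> z * (1 + norm z) powr (2 * s) * exp ((norm z)\<^sup>2 / 2)))"

lemma fock_orderI:
  assumes "\<And>L. L \<ge> 0 \<Longrightarrow> \<exists>C\<ge>0. \<forall>\<omega> f z. moderate L \<omega> \<longrightarrow> entire f \<longrightarrow>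
     (\<forall>z. norm (f z) \<le> \<omega> z * exp ((norm z)\<^sup>2 / 2)) \<longrightarrow>
     norm (T f z) \<le> C * \<omega> z * (1 + norm z) powr (2 * s) * exp ((norm z)\<^sup>2 / 2)"
  shows "fock_order s T"
  unfolding fock_order_def using assms by meson

lemma fock_orderE:
  assumes "fock_order s T" "L \<ge> 0"
  obtains C where "C \<ge> 0" "\<And>\<omega> f z. moderate L \<omega> \<Longrightarrow> entire f \<Longrightarrow>
     (\<And>z. norm (f z) \<le> \<omega> z * exp ((norm z)\<^sup>2 / 2)) \<Longrightarrow>
     norm (T f z) \<le> C * \<omega> z * (1 + norm z) powr (2 * s) * exp ((norm z)\<^sup>2 / 2)"
  using assms unfolding fock_order_def by meson

text \<open>The bound for \<open>T f\<close> is again a weighted Gaussian bound, with weight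
  \<open>C * \<omega> z * (1 + norm z) powr (2 * t)\<close> and slope
  \<open>L + \<bar>2 * t\<bar>\<close>; the bound for \<open>S\<close> is applied to that
  weight.\<close>

lemma fock_order_compose:
  fixes S T :: "(complex ^ 'n \<Rightarrow> complex) \<Rightarrow> complex ^ 'n \<Rightarrow> complex"
  assumes S: "fock_order s S" and T: "fock_order t T" and e: "\<And>f. entire f \<Longrightarrow> entire (T f)"
  shows "fock_order (s + t) (\<lambda>f. S (T f))"
proof (rule fock_orderI)
  fix L :: real assume L: "L \<ge> 0"
  obtain C where C: "C \<ge> 0" "\<And>\<omega> f z. moderate L \<omega> \<Longrightarrow> entire f \<Longrightarrow>
     (\<And>z. norm (f z) \<le> \<omega> z * exp ((norm z)\<^sup>2 / 2)) \<Longrightarrow>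
     norm (T f z) \<le> C * \<omega> z * (1 + norm z) powr (2 * t) * exp ((norm z)\<^sup>2 / 2)"
    using fock_orderE[OF T L] by blast
  have L': "L + \<bar>2 * t\<bar> \<ge> 0" using L by simp
  obtain D where D: "D \<ge> 0" "\<And>\<omega> f z. moderate (L + \<bar>2 * t\<bar>) \<omega> \<Longrightarrow> entire f \<Longrightarrow>
     (\<And>z. norm (f z) \<le> \<omega> z * exp ((norm z)\<^sup>2 / 2)) \<Longrightarrow>
     norm (S f z) \<le> D * \<omega> z * (1 + norm z) powr (2 * s) * exp ((norm z)\<^sup>2 / 2)"
    using fock_orderE[OF S L'] by blast
  show "\<exists>C\<ge>0. \<forall>\<omega> f z. moderate L \<omega> \<longrightarrow> entire f \<longrightarrow>
     (\<forall>z. norm (f z) \<le> \<omega> z * exp ((norm z)\<^sup>2 / 2)) \<longrightarrow>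
     norm (S (T f) z) \<le> C * \<omega> z * (1 + norm z) powr (2 * (s + t)) * exp ((norm z)\<^sup>2 / 2)"
  proof (intro exI[of _ "D * C"] conjI allI impI)
    fix \<omega> and f :: "complex ^ 'n \<Rightarrow> complex" and z :: "complex ^ 'n"
    assume w: "moderate L \<omega>" and f: "entire f" "\<forall>z. norm (f z) \<le> \<omega> z * exp ((norm z)\<^sup>2 / 2)"
    have "norm (S (T f) z) \<le> D * (C * \<omega> z * (1 + norm z) powr (2 * t)) * (1 + norm z) powr (2 * s) * exp ((norm z)\<^sup>2 / 2)"
      using D(2)[where \<omega> = "\<lambda>x. C * \<omega> x * (1 + norm x) powr (2 * t)" and f = "T f" and z = z,
          OF moderate_one_plus_norm_powr[OF w C(1)] e[OF f(1)]] C(2)[OF w f(1)] f(2) by blast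
    then show "norm (S (T f) z) \<le> D * C * \<omega> z * (1 + norm z) powr (2 * (s + t)) * exp ((norm z)\<^sup>2 / 2)"
      by (simp add: distrib_left powr_add mult_ac)
  qed (use C D in auto)
qed

text \<open>Geometric growth of the multiplier does not spoil convergence of the series on the whole
  space. The condition is qualitative: no constant from it enters the norm estimates.\<close>

definition geo_bounded :: "(nat \<Rightarrow> real) \<Rightarrow> bool" where
  "geo_bounded c \<longleftrightarrow> (\<exists>B q. q > 0 \<and> (\<forall>k. \<bar>c k\<bar> \<le> B * q ^ k))"

lemma geo_bounded_mult:
  assumes "geo_bounded c" "geo_bounded d"
  shows "geo_bounded (\<lambda>k. c k * d k)"
proof -
  obtain B q B' q' where *: "q > 0" "\<And>k. \<bar>c k\<bar> \<le> B * q ^ k" "q' > 0" "\<And>k. \<bar>d k\<bar> \<le> B' * q' ^ k"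
    using assms unfolding geo_bounded_def by blast
  have "\<bar>c k * d k\<bar> \<le> (B * B') * (q * q') ^ k" for k
  proof -
    have "\<bar>c k\<bar> * \<bar>d k\<bar> \<le> (B * q ^ k) * (B' * q' ^ k)"
      using *(2)[of k] *(4)[of k] by (intro mult_mono) auto
    then show ?thesis by (simp add: abs_mult power_mult_distrib mult_ac)
  qed
  moreover have "q * q' > 0" using * by simp
  ultimately show ?thesis unfolding geo_bounded_def by blast
qed

lemma geo_bounded_const_bound:
  assumes "\<And>k. \<bar>c k\<bar> \<le> B"
  shows "geo_bounded c"
  unfolding geo_bounded_def by (intro exI[of _ B] exI[of _ 1]) (use assms in auto)

lemma slice_mult_sums:
  assumes "entire f" "geo_bounded c"
  shows "(\<lambda>k. of_real (c k) * slice_coeff f k z) sums slice_mult c f z"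
proof -
  obtain B q where "q > 0" "\<And>k. \<bar>c k\<bar> \<le> B * q ^ k"
    using assms(2) unfolding geo_bounded_def by blast
  from slice_mult_summable[OF assms(1) this, THEN summable_norm_cancel] show ?thesis
    unfolding slice_mult_def by (rule summable_sums)
qed

lemma entire_slice_mult:
  assumes "entire f" "geo_bounded c"
  shows "entire (slice_mult c f)"
  using assms slice_mult_entire unfolding geo_bounded_def by blast

lemma slice_coeff_slice_mult:
  assumes "entire f" "geo_bounded c"
  shows "slice_coeff (slice_mult c f) k z = of_real (c k) * slice_coeff f k z"
proof -
  have "(\<lambda>k. (of_real (c k) * slice_coeff f k z) * w ^ k) sums slice_mult c f (w *s z)" for w
    using slice_mult_sums[OF assms, of "w *s z"]
    by (simp add: slice_coeff_smult[OF assms(1)] mult_ac)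
  from slice_coeff_unique[OF entire_slice_mult[OF assms] this] show ?thesis by simp
qed

lemma slice_mult_slice_mult:
  assumes "entire f" "geo_bounded c"
  shows "slice_mult d (slice_mult c f) = slice_mult (\<lambda>k. d k * c k) f"
  by (rule ext) (simp add: slice_mult_def[of d] slice_mult_def[of "\<lambda>k. d k * c k"]
      slice_coeff_slice_mult[OF assms] mult.assoc)

lemma fock_order_slice_mult_compose:
  fixes c d :: "nat \<Rightarrow> real"
  assumes "fock_order s (slice_mult d :: (complex ^ 'n \<Rightarrow> complex) \<Rightarrow> _)"
    "fock_order t (slice_mult c :: (complex ^ 'n \<Rightarrow> complex) \<Rightarrow> _)" "geo_bounded c"
  shows "fock_order (s + t) (slice_mult (\<lambda>k. d k * c k) :: (complex ^ 'n \<Rightarrow> complex) \<Rightarrow> _)"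
proof -
  have "fock_order (s + t) (\<lambda>f :: complex ^ 'n \<Rightarrow> complex. slice_mult d (slice_mult c f))"
    by (rule fock_order_compose[OF assms(1,2) entire_slice_mult[OF _ assms(3)]])
  then show ?thesis
    unfolding fock_order_def by (simp add: slice_mult_slice_mult[OF _ assms(3)] cong: imp_cong)
qed

lemma slice_mult_one: "entire f \<Longrightarrow> slice_mult (\<lambda>_. 1) f = f"
  using slice_coeff_sums by (auto simp: slice_mult_def sums_iff fun_eq_iff)

section \<open>Linear factors and the radial derivative\<close>

lemma fock_order_one: "fock_order 0 (slice_mult (\<lambda>_. 1))"
proof (rule fock_orderI)
  have p: "(1 + norm z) powr (2 * 0) = 1" for z :: "complex ^ 'n"
  proof -
    have "1 + norm z \<noteq> 0" using norm_ge_zero[of z] by linarith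
    then show ?thesis by simp
  qed
  show "\<exists>C\<ge>0. \<forall>\<omega> (f :: complex ^ 'n \<Rightarrow> complex) z. moderate L \<omega> \<longrightarrow> entire f \<longrightarrow>
     (\<forall>z. norm (f z) \<le> \<omega> z * exp ((norm z)\<^sup>2 / 2)) \<longrightarrow>
     norm (slice_mult (\<lambda>_. 1) f z) \<le> C * \<omega> z * (1 + norm z) powr (2 * 0) * exp ((norm z)\<^sup>2 / 2)" for L
    by (intro exI[of _ 1] conjI allI impI) (simp_all only: slice_mult_one p mult_1_left mult_1_right zero_le_one)
qed

lemma geo_bounded_linear: "geo_bounded (\<lambda>k. d + real k)"
  unfolding geo_bounded_def
proof (intro exI conjI allI)
  fix k
  have "real k \<le> 2 ^ k" using of_nat_less_two_power[of k, where 'a = real] by simp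
  moreover have "\<bar>d\<bar> * 1 \<le> \<bar>d\<bar> * 2 ^ k" by (intro mult_left_mono) auto
  ultimately show "\<bar>d + real k\<bar> \<le> (\<bar>d\<bar> + 1) * 2 ^ k"
    unfolding distrib_right by linarith
qed simp

text \<open>The factor \<open>k\<close> is produced by the radial derivative, that is, by the
  derivative of the slice at \<open>w = 1\<close>; this derivative is expanded about 0 and evaluated
  at 1.\<close>

lemma slice_mult_linear_eq:
  assumes "entire f"
  shows "slice_mult (\<lambda>k. d + real k) f z = of_real d * f z + deriv (\<lambda>w. f (w *s z)) 1"
proof -
  let ?g = "\<lambda>w. f (w *s z)"
  have hol: "?g holomorphic_on S" for S
    using entire_line_holomorphic[OF assms, of 0 z S] by simp
  have "(\<lambda>k. (deriv ^^ k) (deriv ?g) 0 / fact k * (1 - 0) ^ k) sums deriv ?g 1"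
    by (rule holomorphic_power_series[where r = 2]) (auto intro!: holomorphic_deriv hol)
  moreover have "(deriv ^^ k) (deriv ?g) 0 / fact k = of_nat (Suc k) * slice_coeff f (Suc k) z" for k
    by (simp add: slice_coeff_def funpow_swap1 field_simps del: of_nat_Suc)
  ultimately have "(\<lambda>k. of_nat (Suc k) * slice_coeff f (Suc k) z) sums deriv ?g 1" by simp
  then have "(\<lambda>k. of_nat k * slice_coeff f k z) sums deriv ?g 1"
    by (subst (asm) sums_Suc_iff) simp
  from sums_add[OF sums_mult[OF slice_coeff_sums[OF assms], of "of_real d" z] this]
  show ?thesis by (simp add: slice_mult_def sums_iff distrib_right)
qed

text \<open>The circle around \<open>w = 1\<close> of radius \<open>1 / (1 + norm z)\<^sup>2\<close>
  displaces \<open>z\<close> by at most \<open>1 / (1 + norm z)\<close>. Over such a distance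
  \<open>(norm z)\<^sup>2\<close> grows by at most 3 and \<open>\<omega>\<close> by at most the
  factor \<open>exp L\<close>, while dividing by the radius costs the square that order 1
  permits.\<close>

lemma fock_order_linear: "fock_order 1 (slice_mult (\<lambda>k. d + real k))"
proof (rule fock_orderI)
  fix L :: real assume L: "L \<ge> 0"
  define C where "C = \<bar>d\<bar> + exp (L + 3 / 2)"
  show "\<exists>C\<ge>0. \<forall>\<omega> (f :: complex ^ 'n \<Rightarrow> complex) z. moderate L \<omega> \<longrightarrow> entire f \<longrightarrow>
     (\<forall>z. norm (f z) \<le> \<omega> z * exp ((norm z)\<^sup>2 / 2)) \<longrightarrow>
     norm (slice_mult (\<lambda>k. d + real k) f z) \<le> C * \<omega> z * (1 + norm z) powr (2 * 1) * exp ((norm z)\<^sup>2 / 2)"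
  proof (intro exI[of _ C] conjI allI impI)
    fix \<omega> and f :: "complex ^ 'n \<Rightarrow> complex" and z :: "complex ^ 'n"
    assume w: "moderate L \<omega>" and f: "entire f" and fb: "\<forall>z. norm (f z) \<le> \<omega> z * exp ((norm z)\<^sup>2 / 2)"
    define r where "r = norm z"
    have r: "r \<ge> 0" by (simp add: r_def)
    let ?g = "\<lambda>w. f (w *s z)"
    define E where "E = \<omega> z * exp (r\<^sup>2 / 2)"
    have E: "E \<ge> 0" using moderateD(1)[OF w] by (simp add: E_def)
    define \<rho> where "\<rho> = 1 / (1 + r)\<^sup>2"
    have \<rho>: "\<rho> > 0" using r by (auto simp: \<rho>_def intro!: divide_pos_pos zero_less_power)
    have \<rho>r: "\<rho> * r \<le> 1 / (1 + r)"
    proof -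
      have "\<rho> * r \<le> \<rho> * (1 + r)" using \<rho> by simp
      also have "\<dots> = 1 / (1 + r)" using r by (simp add: \<rho>_def power2_eq_square)
      finally show ?thesis .
    qed
    have "norm ((deriv ^^ 1) ?g 1) \<le> fact 1 * (E * exp (L + 3 / 2)) / \<rho> ^ 1"
    proof (rule Cauchy_inequality)
      show "?g holomorphic_on ball 1 \<rho>" "continuous_on (cball 1 \<rho>) ?g"
        using entire_line_holomorphic[OF f, of 0 z]
        by (auto intro: holomorphic_on_imp_continuous_on)
      show "norm (?g x) \<le> E * exp (L + 3 / 2)" if x: "norm (1 - x) = \<rho>" for x
      proof -
        have "x *s z - z = (x - 1) *s z" by (simp add: vector_sub_rdistrib)
        then have n: "norm (x *s z - z) \<le> 1 / (1 + r)"
          using x \<rho>r by (simp only: norm_vector_smult norm_minus_commute[of x 1] r_def)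
        also have "\<dots> \<le> 1" using r by simp
        finally have n1: "norm (x *s z - z) \<le> 1" .
        have "\<omega> (x *s z) \<le> \<omega> z * exp (L * norm (x *s z - z))" by (rule moderateD(2)[OF w])
        also have "\<dots> \<le> \<omega> z * exp L"
          using n1 L moderateD(1)[OF w] by (intro mult_left_mono) (auto intro: mult_left_le)
        finally have 1: "\<omega> (x *s z) \<le> \<omega> z * exp L" .
        have "norm (x *s z) \<le> r + 1 / (1 + r)"
          using n norm_triangle_ineq[of z "x *s z - z"] by (simp add: r_def)
        then have "(norm (x *s z))\<^sup>2 \<le> (r + 1 / (1 + r))\<^sup>2" by (intro power_mono) auto
        also have "\<dots> = r\<^sup>2 + 2 * (r / (1 + r)) + (1 / (1 + r))\<^sup>2"
          by (simp add: power2_sum)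
        also have "\<dots> \<le> r\<^sup>2 + 2 * 1 + 1"
          using r by (intro add_mono mult_left_mono power_le_one) auto
        finally have 2: "exp ((norm (x *s z))\<^sup>2 / 2) \<le> exp (r\<^sup>2 / 2 + 3 / 2)" by simp
        have "norm (?g x) \<le> \<omega> (x *s z) * exp ((norm (x *s z))\<^sup>2 / 2)" using fb by blast
        also have "\<dots> \<le> (\<omega> z * exp L) * exp (r\<^sup>2 / 2 + 3 / 2)"
          using 1 2 moderateD(1)[OF w] by (intro mult_mono) auto
        also have "\<dots> = E * exp (L + 3 / 2)" by (simp add: E_def exp_add mult_ac)
        finally show ?thesis .
      qed
    qed (rule \<rho>)
    then have d: "norm (deriv ?g 1) \<le> E * exp (L + 3 / 2) * (1 + r)\<^sup>2" by (simp add: \<rho>_def)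
    have "E * 1 \<le> E * (1 + r)\<^sup>2" using E r by (intro mult_left_mono one_le_power) auto
    then have "norm (f z) \<le> E * (1 + r)\<^sup>2" using fb[rule_format, of z] by (simp add: E_def r_def)
    then have "norm (of_real d * f z) \<le> \<bar>d\<bar> * (E * (1 + r)\<^sup>2)"
      by (simp add: norm_mult mult_left_mono)
    with d have "norm (slice_mult (\<lambda>k. d + real k) f z) \<le> \<bar>d\<bar> * (E * (1 + r)\<^sup>2) + E * exp (L + 3 / 2) * (1 + r)\<^sup>2"
      unfolding slice_mult_linear_eq[OF f] by (intro order_trans[OF norm_triangle_ineq] add_mono)
    also have "\<dots> = C * \<omega> z * (1 + norm z) powr (2 * 1) * exp ((norm z)\<^sup>2 / 2)"
      using r by (simp add: C_def E_def r_def algebra_simps powr_numeral)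
    finally show "norm (slice_mult (\<lambda>k. d + real k) f z) \<le> C * \<omega> z * (1 + norm z) powr (2 * 1) * exp ((norm z)\<^sup>2 / 2)" .
  qed (simp add: C_def)
qed

lemma pochhammer_multiplier:
  "fock_order (real m) (slice_mult (\<lambda>k. pochhammer (d + real k) m) :: (complex ^ 'n \<Rightarrow> complex) \<Rightarrow> _) \<and>
   geo_bounded (\<lambda>k. pochhammer (d + real k) m)"
proof (induction m)
  case 0
  then show ?case by (auto simp: fock_order_one intro!: geo_bounded_const_bound[of _ 1])
next
  case (Suc m)
  have eq: "(\<lambda>k. pochhammer (d + real k) (Suc m)) = (\<lambda>k. pochhammer (d + real k) m * ((d + real m) + real k))"
    by (simp add: pochhammer_Suc algebra_simps)
  have "fock_order (real m + 1) (slice_mult (\<lambda>k. pochhammer (d + real k) m * ((d + real m) + real k)) :: (complex ^ 'n \<Rightarrow> complex) \<Rightarrow> _)"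
    by (rule fock_order_slice_mult_compose[OF conjunct1[OF Suc] fock_order_linear geo_bounded_linear])
  moreover have "geo_bounded (\<lambda>k. pochhammer (d + real k) m * ((d + real m) + real k))"
    by (rule geo_bounded_mult[OF conjunct2[OF Suc] geo_bounded_linear])
  ultimately show ?case unfolding eq by (simp add: add.commute)
qed

subsection \<open>Multipliers of negative order\<close>

lemma exp_quadratic_bound:
  fixes a r :: real
  shows "exp (a * r) \<le> exp (a\<^sup>2 / 2) * exp (r\<^sup>2 / 2)"
proof -
  have "0 \<le> (a - r)\<^sup>2" by simp
  then have "a * r \<le> a\<^sup>2 / 2 + r\<^sup>2 / 2" by (simp add: power2_diff)
  then show ?thesis by (simp flip: exp_add)
qed

text \<open>The factor \<open>min 1 (norm z) ^ k\<^sub>0\<close> records the zero of order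
  \<open>k\<^sub>0\<close> at the origin. Inside the unit ball it comes from a geometric series of
  Cauchy bounds; outside, the finitely many removed terms grow at most exponentially in
  \<open>norm z\<close>, which the Gaussian absorbs.\<close>

lemma cutoff_bound:
  fixes k\<^sub>0 :: nat
  assumes L: "L \<ge> 0"
  obtains C where "C \<ge> 0" "\<And>\<omega> f z. moderate L \<omega> \<Longrightarrow> entire (f :: complex ^ 'n \<Rightarrow> complex) \<Longrightarrow>
     (\<And>z. norm (f z) \<le> \<omega> z * exp ((norm z)\<^sup>2 / 2)) \<Longrightarrow>
     norm (slice_mult (\<lambda>k. if k\<^sub>0 \<le> k then 1 else 0) f z) \<le> C * min 1 (norm z) ^ k\<^sub>0 * \<omega> z * exp ((norm z)\<^sup>2 / 2)"
proof -
  define C1 where "C1 = 2 * exp (3 * L + 2)"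
  define C2 where "C2 = 1 + real k\<^sub>0 * (exp (2 * L + 2) * exp ((L + real k\<^sub>0)\<^sup>2 / 2))"
  have C2: "C2 \<ge> 0" by (auto simp: C2_def)
  show ?thesis
  proof (rule that[of "C1 + C2"])
    show "C1 + C2 \<ge> 0" using C2 by (simp add: C1_def)
    fix \<omega> and f :: "complex ^ 'n \<Rightarrow> complex" and z :: "complex ^ 'n"
    assume w: "moderate L \<omega>" and f: "entire f" and fb: "\<And>z. norm (f z) \<le> \<omega> z * exp ((norm z)\<^sup>2 / 2)"
    define g where "g = slice_mult (\<lambda>k. if k\<^sub>0 \<le> k then 1 else 0) f"
    define r where "r = norm z"
    have r: "r \<ge> 0" by (simp add: r_def)
    note w0 = moderateD(1)[OF w]
    \<comment> \<open>Bound of \<open>f\<close> on the ball of radius 2, expressed through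
      \<open>\<omega>\<close> at \<open>z\<close> itself: points there are within
      \<open>2 + r\<close> of \<open>z\<close>, and \<open>exp 2\<close> is the Gaussian factor at
      norm 2. Radius 2 makes the series converge with ratio \<open>1 / 2\<close> for
      \<open>r \<le> 1\<close>.\<close>
    define M where "M = \<omega> z * exp (L * (2 + r)) * exp 2"
    have M: "M \<ge> 0" using w0 by (simp add: M_def)
    have M2: "norm (f u) \<le> M" if "norm u \<le> 2" for u
    proof -
      have "norm (u - z) \<le> 2 + r" using that norm_triangle_ineq4[of u z] by (simp add: r_def)
      then have "exp (L * norm (u - z)) \<le> exp (L * (2 + r))" using L by (simp add: mult_left_mono)
      then have "\<omega> z * exp (L * norm (u - z)) \<le> \<omega> z * exp (L * (2 + r))"
        using w0 by (intro mult_left_mono) auto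
      then have 1: "\<omega> u \<le> \<omega> z * exp (L * (2 + r))" using moderateD(2)[OF w, of u z] by linarith
      have "(norm u)\<^sup>2 \<le> 2\<^sup>2" using that by (intro power_mono) auto
      then have 2: "exp ((norm u)\<^sup>2 / 2) \<le> exp 2" by simp
      have "norm (f u) \<le> \<omega> u * exp ((norm u)\<^sup>2 / 2)" by (rule fb)
      also have "\<dots> \<le> M" unfolding M_def using 1 2 w0 by (intro mult_mono) auto
      finally show ?thesis .
    qed
    have coeff: "norm (slice_coeff f k z) \<le> M * (r / 2) ^ k" for k
      unfolding r_def by (rule slice_coeff_bound[OF f _ M2]) auto
    have gb: "geo_bounded (\<lambda>k. if k\<^sub>0 \<le> k then 1 else 0)"
      by (rule geo_bounded_const_bound[of _ 1]) auto
    have gs: "(\<lambda>k. of_real (if k\<^sub>0 \<le> k then 1 else 0) * slice_coeff f k z) sums g z"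
      unfolding g_def by (rule slice_mult_sums[OF f gb])
    have wE: "\<omega> z * exp (r\<^sup>2 / 2) \<ge> 0" using w0 by simp
    have "norm (g z) \<le> (if r \<le> 1 then C1 else C2) * min 1 r ^ k\<^sub>0 * (\<omega> z * exp (r\<^sup>2 / 2))"
    proof (cases "r \<le> 1")
      case True
      have "norm (g z) \<le> (\<Sum>k. (M * r ^ k\<^sub>0) * (1 / 2) ^ k)"
        unfolding sums_unique[OF gs]
      proof (rule norm_suminf_le)
        show "summable (\<lambda>k. (M * r ^ k\<^sub>0) * (1 / 2) ^ k)"
          by (intro summable_mult summable_geometric) simp
        show "norm (of_real (if k\<^sub>0 \<le> k then 1 else 0) * slice_coeff f k z) \<le> (M * r ^ k\<^sub>0) * (1 / 2) ^ k" for k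
        proof (cases "k\<^sub>0 \<le> k")
          case kk: True
          have "M * (r / 2) ^ k = M * r ^ k * (1 / 2) ^ k" by (simp add: power_divide)
          also have "\<dots> \<le> (M * r ^ k\<^sub>0) * (1 / 2) ^ k"
            using r True kk M by (intro mult_right_mono mult_left_mono power_decreasing) auto
          finally show ?thesis using coeff[of k] kk by simp
        qed (use M r in simp)
      qed
      also have "\<dots> = 2 * M * r ^ k\<^sub>0"
        by (subst suminf_mult) (auto simp: suminf_geometric)
      also have "M \<le> \<omega> z * exp (3 * L) * exp 2"
        unfolding M_def using True L w0
        by (intro mult_right_mono mult_left_mono) (auto simp: mult.commute intro: mult_left_mono)
      also have "\<dots> = \<omega> z * exp (3 * L + 2)" by (simp add: exp_add)
      also have "\<dots> \<le> \<omega> z * exp (3 * L + 2) * exp (r\<^sup>2 / 2)"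
        using mult_left_mono[of 1 "exp (r\<^sup>2 / 2)" "\<omega> z * exp (3 * L + 2)"] w0[of z] by simp
      finally have "norm (g z) \<le> 2 * (\<omega> z * exp (3 * L + 2) * exp (r\<^sup>2 / 2)) * r ^ k\<^sub>0"
        using r by (simp add: mult_right_mono)
      then show ?thesis using True r by (simp add: C1_def mult_ac)
    next
      case False
      have "(\<lambda>k. slice_coeff f k z - of_real (if k\<^sub>0 \<le> k then 1 else 0) * slice_coeff f k z) sums (f z - g z)"
        by (rule sums_diff[OF slice_coeff_sums[OF f] gs])
      moreover have "(\<lambda>k. slice_coeff f k z - of_real (if k\<^sub>0 \<le> k then 1 else 0) * slice_coeff f k z) =
         (\<lambda>k. if k \<in> {..<k\<^sub>0} then slice_coeff f k z else 0)" by auto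
      moreover have "(\<lambda>k. if k \<in> {..<k\<^sub>0} then slice_coeff f k z else 0) sums (\<Sum>k<k\<^sub>0. slice_coeff f k z)"
        by (rule sums_If_finite_set) simp
      ultimately have "f z - g z = (\<Sum>k<k\<^sub>0. slice_coeff f k z)" using sums_unique2 by metis
      then have "g z = f z - (\<Sum>k<k\<^sub>0. slice_coeff f k z)" by (simp add: algebra_simps)
      then have "norm (g z) \<le> norm (f z) + norm (\<Sum>k<k\<^sub>0. slice_coeff f k z)"
        using norm_triangle_ineq4[of "f z" "\<Sum>k<k\<^sub>0. slice_coeff f k z"] by simp
      also have "norm (\<Sum>k<k\<^sub>0. slice_coeff f k z) \<le> (\<Sum>k<k\<^sub>0. M * exp (real k\<^sub>0 * r))"
      proof (rule sum_norm_le)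
        fix k assume "k \<in> {..<k\<^sub>0}"
        moreover have "r \<le> exp r" using exp_ge_add_one_self[of r] by linarith
        ultimately have "(r / 2) ^ k \<le> r ^ k" "r ^ k \<le> r ^ k\<^sub>0" "r ^ k\<^sub>0 \<le> exp r ^ k\<^sub>0"
          using False by (auto intro!: power_mono power_increasing)
        then have "(r / 2) ^ k \<le> exp (real k\<^sub>0 * r)" by (simp add: exp_of_nat_mult)
        then show "norm (slice_coeff f k z) \<le> M * exp (real k\<^sub>0 * r)"
          using coeff[of k] M by (meson mult_left_mono order_trans)
      qed
      also have "(\<Sum>k<k\<^sub>0. M * exp (real k\<^sub>0 * r)) = real k\<^sub>0 * (\<omega> z * exp (2 * L + 2) * exp ((L + real k\<^sub>0) * r))"
        by (simp add: M_def exp_add algebra_simps)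
      also have "\<dots> \<le> real k\<^sub>0 * (\<omega> z * exp (2 * L + 2) * (exp ((L + real k\<^sub>0)\<^sup>2 / 2) * exp (r\<^sup>2 / 2)))"
        using w0 by (intro mult_left_mono exp_quadratic_bound) auto
      also have "norm (f z) + \<dots> \<le> \<omega> z * exp (r\<^sup>2 / 2) + \<dots>"
        using fb[of z] by (simp add: r_def)
      also have "\<dots> = C2 * (\<omega> z * exp (r\<^sup>2 / 2))"
        by (simp add: C2_def algebra_simps)
      finally show ?thesis using False by simp
    qed
    also have "\<dots> \<le> (C1 + C2) * min 1 r ^ k\<^sub>0 * (\<omega> z * exp (r\<^sup>2 / 2))"
      using C2 r wE by (intro mult_right_mono) (auto simp: C1_def)
    finally show "norm (slice_mult (\<lambda>k. if k\<^sub>0 \<le> k then 1 else 0) f z) \<le> (C1 + C2) * min 1 (norm z) ^ k\<^sub>0 * \<omega> z * exp ((norm z)\<^sup>2 / 2)"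
      by (simp add: g_def r_def mult_ac)
  qed
qed

section \<open>The Beta integral\<close>

lemma nn_integral_powr_exp_bound:
  fixes \<sigma> q :: real
  assumes "\<sigma> > 0" "q > 0"
  shows "(\<integral>\<^sup>+t. ennreal (indicator {0..1} t * ((1 - t) powr (\<sigma> - 1) * exp (- ((1 - t) * q)))) \<partial>lborel)
     \<le> ennreal (Gamma \<sigma> * q powr (- \<sigma>))"
proof -
  define h where "h y = ennreal (indicator {0..} y * y powr (\<sigma> - 1) / exp y)" for y :: real
  have hm: "h \<in> borel_measurable borel" unfolding h_def by measurable
  have "ennreal (Gamma \<sigma>) = (\<integral>\<^sup>+y. h y \<partial>lborel)"
    unfolding h_def by (rule Gamma_conv_nn_integral_real[OF assms(1)])
  \<comment> \<open>Substitution \<open>y = q * (1 - t)\<close>. The Gamma integral runs over the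
    half line, that is, over all \<open>t \<le> 1\<close>; passing to \<open>{0..1}\<close> only
    decreases it.\<close>
  also have "\<dots> = ennreal \<bar>- q\<bar> * (\<integral>\<^sup>+t. h (q + (- q) * t) \<partial>lborel)"
    by (rule nn_integral_real_affine) (use hm assms in auto)
  finally have G: "ennreal (Gamma \<sigma>) = ennreal q * (\<integral>\<^sup>+t. h (q + (- q) * t) \<partial>lborel)"
    using assms by simp
  have "(\<integral>\<^sup>+t. ennreal (indicator {0..1} t * ((1 - t) powr (\<sigma> - 1) * exp (- ((1 - t) * q)))) \<partial>lborel)
    \<le> (\<integral>\<^sup>+t. ennreal (q powr (1 - \<sigma>)) * h (q + (- q) * t) \<partial>lborel)"
  proof (rule nn_integral_mono)
    fix t :: real
    have "indicator {0..1} t * ((1 - t) powr (\<sigma> - 1) * exp (- ((1 - t) * q))) \<le>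
      q powr (1 - \<sigma>) * (indicator {0..} (q * (1 - t)) * (q * (1 - t)) powr (\<sigma> - 1) / exp (q * (1 - t)))"
    proof (cases "t \<in> {0..1}")
      case True
      have "q powr (1 - \<sigma>) * q powr (\<sigma> - 1) = 1" using assms by (simp flip: powr_add)
      then have "(1 - t) powr (\<sigma> - 1) = q powr (1 - \<sigma>) * (q * (1 - t)) powr (\<sigma> - 1)"
        using True assms by (simp add: powr_mult)
      then show ?thesis using True assms by (simp add: exp_minus divide_inverse mult_ac)
    qed (use assms in auto)
    then show "ennreal (indicator {0..1} t * ((1 - t) powr (\<sigma> - 1) * exp (- ((1 - t) * q))))
      \<le> ennreal (q powr (1 - \<sigma>)) * h (q + (- q) * t)"
      unfolding h_def by (subst ennreal_mult[symmetric]) (auto intro!: ennreal_leI simp: algebra_simps)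
  qed
  also have "\<dots> = ennreal (q powr (1 - \<sigma>)) * (\<integral>\<^sup>+t. h (q + (- q) * t) \<partial>lborel)"
  proof (rule nn_integral_cmult)
    show "(\<lambda>t. h (q + (- q) * t)) \<in> borel_measurable lborel"
      unfolding measurable_lborel1 by (rule measurable_compose[OF _ hm]) measurable
  qed
  also have "\<dots> = ennreal (q powr (- \<sigma>)) * (ennreal q * (\<integral>\<^sup>+t. h (q + (- q) * t) \<partial>lborel))"
  proof -
    have "q powr (1 - \<sigma>) = q powr (- \<sigma>) * q" using assms by (simp add: powr_diff powr_minus divide_inverse)
    then show ?thesis using assms by (simp add: ennreal_mult mult.assoc)
  qed
  also have "\<dots> = ennreal (Gamma \<sigma> * q powr (- \<sigma>))"
    unfolding G[symmetric] using assms by (simp add: Gamma_real_pos ennreal_mult' mult.commute)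
  finally show ?thesis .
qed

text \<open>Its \<open>k\<^sub>0\<close>-th power supplies the \<open>t ^ k\<^sub>0\<close> that
  compensates a negative exponent of \<open>t\<close>. A bound linear in \<open>t\<close> and
  uniform in \<open>r\<close> has to pay with \<open>exp ((1 - t) * r)\<close>, which is harmless
  against the Gaussian.\<close>

lemma min_one_scaled_le:
  fixes t r :: real
  assumes "0 \<le> t" "t \<le> 1" "0 \<le> r"
  shows "min 1 (t * r) \<le> 2 * t * exp ((1 - t) * r)"
proof (cases "t \<ge> 1 / 2")
  case True
  have "1 * 1 \<le> (2 * t) * exp ((1 - t) * r)" using True assms by (intro mult_mono) auto
  then show ?thesis by simp
next
  case False
  have "(1 / 2) * r \<le> (1 - t) * r" using False assms by (intro mult_right_mono) auto
  also have "\<dots> \<le> exp ((1 - t) * r)" using exp_ge_add_one_self[of "(1 - t) * r"] by linarith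
  finally have "2 * t * (1 / 2 * r) \<le> 2 * t * exp ((1 - t) * r)" using assms by (intro mult_left_mono) auto
  then show ?thesis by simp
qed

text \<open>Since \<open>t\<^sup>2 \<le> t\<close>, the Gaussian exponent at \<open>t z\<close> lies
  below that at \<open>z\<close> by at least \<open>(1 - t) * r\<^sup>2 / 2\<close>. Half of this
  gain absorbs the linear loss through \<open>K * r \<le> r\<^sup>2 / 4 + K\<^sup>2\<close>; the
  other half remains. The \<open>1 / 4\<close> pays for having \<open>1 + r\<^sup>2\<close> there,
  which keeps the decay rate positive at \<open>r = 0\<close>.\<close>

lemma beta_kernel_exponent:
  fixes K t r :: real
  assumes "0 \<le> t" "t \<le> 1" "0 \<le> r"
  shows "K * ((1 - t) * r) + (t * r)\<^sup>2 / 2 \<le> K\<^sup>2 + 1 / 4 + r\<^sup>2 / 2 - (1 - t) * ((1 + r\<^sup>2) / 4)"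
proof -
  have "0 \<le> (r / 2 - K)\<^sup>2" by simp
  then have "K * r \<le> r\<^sup>2 / 4 + K\<^sup>2" by (simp add: power2_diff power_divide mult.commute)
  then have 1: "(1 - t) * (K * r) \<le> (1 - t) * (r\<^sup>2 / 4 + K\<^sup>2)"
    using assms by (intro mult_left_mono) auto
  have 2: "(1 - t) * K\<^sup>2 \<le> 1 * K\<^sup>2" using assms by (intro mult_right_mono) auto
  have "t * t \<le> t * 1" using assms by (intro mult_left_mono) auto
  then have "t\<^sup>2 * r\<^sup>2 \<le> t * r\<^sup>2" by (intro mult_right_mono) (auto simp: power2_eq_square)
  then have 3: "(t * r)\<^sup>2 \<le> t * r\<^sup>2" by (simp add: power_mult_distrib)
  define a d where "a = r\<^sup>2" and "d = t * r\<^sup>2"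
  have "K * ((1 - t) * r) = (1 - t) * (K * r)" by (simp only: mult_ac)
  also have "\<dots> \<le> (1 - t) * (r\<^sup>2 / 4) + (1 - t) * K\<^sup>2" using 1 by (simp only: distrib_left)
  also have "(1 - t) * (r\<^sup>2 / 4) = a / 4 - d / 4" by (simp add: a_def d_def left_diff_distrib)
  finally have "K * ((1 - t) * r) \<le> a / 4 - d / 4 + (1 - t) * K\<^sup>2" .
  moreover have "(t * r)\<^sup>2 / 2 \<le> d / 2" using 3 by (simp add: d_def)
  moreover have "(1 - t) * ((1 + r\<^sup>2) / 4) = 1 / 4 - t / 4 + a / 4 - d / 4"
    by (simp add: a_def d_def algebra_simps add_divide_distrib diff_divide_distrib)
  ultimately show ?thesis using 2 assms(1) unfolding a_def[symmetric] by linarith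
qed

lemma Beta_kernel_integral:
  fixes a b :: real
  assumes "a > 0" "b > 0"
  shows "integrable lborel (\<lambda>t. indicator {0..1} t * (t powr (a - 1) * (1 - t) powr (b - 1)))"
    "(LINT t|lborel. indicator {0..1} t * (t powr (a - 1) * (1 - t) powr (b - 1))) = Beta a b"
proof -
  have S: "set_integrable lborel {0..1} (\<lambda>t. t powr (a - 1) * (1 - t) powr (b - 1))"
    by (rule integrable_Beta[OF assms])
  then show "integrable lborel (\<lambda>t. indicator {0..1} t * (t powr (a - 1) * (1 - t) powr (b - 1)))"
    by (simp add: set_integrable_def)
  from set_borel_integral_eq_integral(2)[OF S] has_integral_Beta_real[OF assms]
  show "(LINT t|lborel. indicator {0..1} t * (t powr (a - 1) * (1 - t) powr (b - 1))) = Beta a b"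
    by (simp add: set_lebesgue_integral_def integral_unique)
qed

lemma beta_ratio_bound:
  fixes b \<sigma> :: real
  assumes "b \<ge> 1" "\<sigma> > 0"
  shows "Gamma b / Gamma (b + \<sigma>) = Beta b \<sigma> / Gamma \<sigma>" "0 \<le> Beta b \<sigma>" "Beta b \<sigma> \<le> Beta 1 \<sigma>"
proof -
  have "Gamma \<sigma> > 0" by (rule Gamma_real_pos) fact
  then show "Gamma b / Gamma (b + \<sigma>) = Beta b \<sigma> / Gamma \<sigma>" by (simp add: Beta_def)
  show "0 \<le> Beta b \<sigma>" unfolding Beta_def using assms
    by (intro divide_nonneg_nonneg mult_nonneg_nonneg less_imp_le[OF Gamma_real_pos]) auto
  show "Beta b \<sigma> \<le> Beta 1 \<sigma>" by (rule Beta_real_mono) (use assms in auto)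
qed


lemma beta_multiplier_geo_bounded:
  fixes b \<sigma> :: real and k\<^sub>0 :: nat
  assumes "\<sigma> > 0" "b + real k\<^sub>0 \<ge> 1"
  shows "geo_bounded (\<lambda>k. if k\<^sub>0 \<le> k then Gamma (b + real k) / Gamma (b + real k + \<sigma>) else 0)"
proof (rule geo_bounded_const_bound)
  fix k
  have "Gamma \<sigma> > 0" by (rule Gamma_real_pos) fact
  then show "\<bar>if k\<^sub>0 \<le> k then Gamma (b + real k) / Gamma (b + real k + \<sigma>) else 0\<bar> \<le> Beta 1 \<sigma> / Gamma \<sigma>"
    using beta_ratio_bound[of "b + real k" \<sigma>] beta_ratio_bound[of 1 \<sigma>] assms
    by (auto simp: divide_right_mono)
qed

text \<open>\<open>Gamma \<sigma>\<close> times the multiplier is the Beta integral with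
  \<open>t powr (b + k - 1)\<close>, and the factor \<open>t ^ k\<close> is the homogeneity of the
  \<open>k\<close>-th part, so the sum becomes an integral over \<open>g (t z)\<close>. Summation
  starts at \<open>k\<^sub>0\<close> because below it the Beta integral may diverge.\<close>

lemma beta_multiplier_integral:
  fixes f :: "complex ^ 'n \<Rightarrow> complex" and b \<sigma> :: real and k\<^sub>0 :: nat
  assumes \<sigma>: "\<sigma> > 0" and b: "b + real k\<^sub>0 \<ge> 1" and f: "entire f"
  defines "g \<equiv> slice_mult (\<lambda>k. if k\<^sub>0 \<le> k then 1 else 0) f"
  shows "ennreal (Gamma \<sigma> * norm (slice_mult (\<lambda>k. if k\<^sub>0 \<le> k then Gamma (b + real k) / Gamma (b + real k + \<sigma>) else 0) f z))
    \<le> (\<integral>\<^sup>+t. ennreal (indicator {0..1} t * (t powr (b - 1) * (1 - t) powr (\<sigma> - 1)) * norm (g (of_real t *s z))) \<partial>lborel)"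
proof -
  define c where "c k = (if k\<^sub>0 \<le> k then Gamma (b + real k) / Gamma (b + real k + \<sigma>) else 0)" for k
  have G: "Gamma \<sigma> > 0" by (rule Gamma_real_pos) fact
  define W where "W k t = (if k\<^sub>0 \<le> k then indicator {0..1} t * (t powr (b + real k - 1) * (1 - t) powr (\<sigma> - 1)) else 0)" for k and t :: real
  define F where "F k t = of_real (W k t) * slice_coeff f k z" for k t
  have W0: "W k t \<ge> 0" for k t by (simp add: W_def)
  have Wi: "integrable lborel (W k)" for k
    using Beta_kernel_integral(1)[of "b + real k" \<sigma>] b \<sigma> by (cases "k\<^sub>0 \<le> k") (auto simp: W_def[abs_def])
  have WB: "(LINT t|lborel. W k t) = Gamma \<sigma> * c k" for k
  proof (cases "k\<^sub>0 \<le> k")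
    case True
    then have "b + real k \<ge> 1" using b by simp
    then have "(LINT t|lborel. W k t) = Beta (b + real k) \<sigma>"
      using Beta_kernel_integral(2)[of "b + real k" \<sigma>] \<sigma> True by (simp add: W_def)
    also have "\<dots> = Gamma \<sigma> * (Beta (b + real k) \<sigma> / Gamma \<sigma>)"
      using G by (metis less_irrefl nonzero_mult_div_cancel_left times_divide_eq_right)
    also have "\<dots> = Gamma \<sigma> * c k"
      using beta_ratio_bound(1)[OF \<open>b + real k \<ge> 1\<close> \<sigma>] True by (simp only: c_def if_True)
    finally show ?thesis .
  qed (simp add: W_def c_def)
  have Fi: "integrable lborel (F k)" for k
    unfolding F_def[abs_def] by (intro integrable_mult_left integrable_of_real Wi)
  have FI: "(LINT t|lborel. F k t) = of_real (Gamma \<sigma>) * (of_real (c k) * slice_coeff f k z)" for k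
    unfolding F_def by (simp add: WB mult.assoc)
  have FN: "(LINT t|lborel. norm (F k t)) = Gamma \<sigma> * norm (of_real (c k) * slice_coeff f k z)" for k
  proof -
    have "c k \<ge> 0"
    proof (cases "k\<^sub>0 \<le> k")
      case True
      then have "b + real k \<ge> 1" using b by simp
      from beta_ratio_bound(1,2)[OF this \<sigma>] True G show ?thesis by (simp only: c_def if_True) simp
    qed (simp add: c_def)
    then show ?thesis using W0 by (simp add: F_def norm_mult WB)
  qed
  have gb: "geo_bounded c" unfolding c_def[abs_def] by (rule beta_multiplier_geo_bounded[OF \<sigma> b])
  have summable_coeff: "summable (\<lambda>k. norm (slice_coeff f k z))"
    using slice_mult_summable[OF f, of 1 "\<lambda>_. 1" 1] by simp
  have summable_c: "summable (\<lambda>k. norm (of_real (c k) * slice_coeff f k z))"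
    using gb slice_mult_summable[OF f, of _ c] unfolding geo_bounded_def by blast
  have AEs: "AE t in lborel. summable (\<lambda>k. norm (F k t))"
  proof (rule AE_I2)
    fix t :: real
    have "summable (\<lambda>k. (1 - t) powr (\<sigma> - 1) * norm (slice_coeff f k z))"
      by (intro summable_mult summable_coeff)
    then show "summable (\<lambda>k. norm (F k t))"
    proof (rule summable_comparison_test'[where N = 0])
      fix k
      \<comment> \<open>The exponent \<open>b + k - 1\<close> is nonnegative for
        \<open>k \<ge> k\<^sub>0\<close>, which makes the bound independent of
        \<open>k\<close>.\<close>
      have "W k t \<le> (1 - t) powr (\<sigma> - 1)"
      proof (cases "k\<^sub>0 \<le> k \<and> t \<in> {0..1}")
        case True
        then have "t powr (b + real k - 1) \<le> 1" using b by (intro powr_le1) auto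
        then have "t powr (b + real k - 1) * (1 - t) powr (\<sigma> - 1) \<le> 1 * (1 - t) powr (\<sigma> - 1)"
          by (intro mult_right_mono) auto
        then show ?thesis using True by (simp add: W_def)
      qed (auto simp: W_def)
      then show "norm (norm (F k t)) \<le> (1 - t) powr (\<sigma> - 1) * norm (slice_coeff f k z)"
        using W0[of k t] by (simp add: F_def norm_mult mult_right_mono)
    qed
  qed
  have SN: "summable (\<lambda>k. LINT t|lborel. norm (F k t))"
    unfolding FN by (intro summable_mult summable_c)
  have pt: "(\<Sum>k. F k t) = of_real (indicator {0..1} t * (t powr (b - 1) * (1 - t) powr (\<sigma> - 1))) * g (of_real t *s z)" for t
  proof (cases "0 < t \<and> t \<le> 1")
    case True
    have "F k t = of_real (t powr (b - 1) * (1 - t) powr (\<sigma> - 1)) *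
      (of_real (if k\<^sub>0 \<le> k then 1 else 0) * slice_coeff f k (of_real t *s z))" for k
    proof -
      have "t powr (b + real k - 1) = t powr (b - 1) * t ^ k"
        using True by (simp add: powr_realpow[symmetric] flip: powr_add) (simp add: algebra_simps)
      then show ?thesis using True by (simp add: F_def W_def slice_coeff_smult[OF f])
    qed
    moreover have "(\<lambda>k. of_real (if k\<^sub>0 \<le> k then 1 else 0) * slice_coeff f k (of_real t *s z)) sums g (of_real t *s z)"
      unfolding g_def by (rule slice_mult_sums[OF f]) (rule geo_bounded_const_bound[of _ 1], auto)
    ultimately have "(\<lambda>k. F k t) sums (of_real (t powr (b - 1) * (1 - t) powr (\<sigma> - 1)) * g (of_real t *s z))"
      using sums_mult by simp
    then show ?thesis using True by (simp add: sums_iff)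
  next
    \<comment> \<open>This includes \<open>t = 0\<close>, where \<open>0 powr x = 0\<close> for
      every \<open>x\<close> makes both sides vanish.\<close>
    case False
    then have "W k t = 0" for k by (auto simp: W_def indicator_def)
    then show ?thesis using False by (auto simp: F_def indicator_def)
  qed
  have "(\<lambda>k. LINT t|lborel. F k t) sums (LINT t|lborel. (\<Sum>k. F k t))"
    by (rule sums_integral[OF Fi AEs SN])
  moreover have "(\<lambda>k. LINT t|lborel. F k t) sums (of_real (Gamma \<sigma>) * slice_mult c f z)"
    unfolding FI by (intro sums_mult slice_mult_sums[OF f gb])
  ultimately have eq: "of_real (Gamma \<sigma>) * slice_mult c f z = (LINT t|lborel. (\<Sum>k. F k t))"
    by (rule sums_unique2[symmetric])
  have "ennreal (norm (LINT t|lborel. (\<Sum>k. F k t))) \<le> (\<integral>\<^sup>+t. ennreal (norm (\<Sum>k. F k t)) \<partial>lborel)"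
    by (intro integral_norm_bound_ennreal integrable_suminf Fi AEs SN)
  moreover have "norm (\<Sum>k. F k t) = indicator {0..1} t * (t powr (b - 1) * (1 - t) powr (\<sigma> - 1)) * norm (g (of_real t *s z))" for t
    unfolding pt norm_mult norm_of_real by (simp add: abs_mult)
  ultimately show ?thesis
    using G by (simp add: c_def[abs_def] norm_mult flip: eq)
qed

text \<open>The inequality \<open>(1 + r)\<^sup>2 \<le> 2 * (1 + r\<^sup>2)\<close>, reversed by the
  negative exponent. It turns the decay rate of the kernel into the weight of order
  \<open>- \<sigma>\<close>.\<close>

lemma one_plus_square_powr_le:
  fixes r \<sigma> :: real
  assumes "r \<ge> 0" "\<sigma> > 0"
  shows "((1 + r\<^sup>2) / 4) powr (- \<sigma>) \<le> 8 powr \<sigma> * (1 + r) powr (2 * (- \<sigma>))"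
proof -
  have "0 \<le> (1 - r)\<^sup>2" by simp
  then have "(1 + r)\<^sup>2 / 8 \<le> (1 + r\<^sup>2) / 4" by (simp add: power2_eq_square algebra_simps)
  moreover have "(1 + r)\<^sup>2 / 8 > 0" using assms by simp
  ultimately have "((1 + r\<^sup>2) / 4) powr (- \<sigma>) \<le> ((1 + r)\<^sup>2 / 8) powr (- \<sigma>)"
    using assms by (intro powr_mono2') auto
  also have "(1 + r)\<^sup>2 = (1 + r) powr 2" using assms by (simp add: powr_numeral)
  also have "((1 + r) powr 2 / 8) powr (- \<sigma>) = 8 powr \<sigma> * (1 + r) powr (2 * (- \<sigma>))"
    unfolding powr_divide powr_powr powr_minus[of 8] by (simp only: divide_inverse inverse_inverse_eq mult.commute)
  finally show ?thesis .
qed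

lemma fock_order_beta:
  fixes b \<sigma> :: real and k\<^sub>0 :: nat
  assumes \<sigma>: "\<sigma> > 0" and b: "b + real k\<^sub>0 \<ge> 1"
  shows "fock_order (- \<sigma>) (slice_mult (\<lambda>k. if k\<^sub>0 \<le> k then Gamma (b + real k) / Gamma (b + real k + \<sigma>) else 0)
    :: (complex ^ 'n \<Rightarrow> complex) \<Rightarrow> _)"
proof (rule fock_orderI)
  fix L :: real assume L: "L \<ge> 0"
  define T where "T = (slice_mult (\<lambda>k. if k\<^sub>0 \<le> k then Gamma (b + real k) / Gamma (b + real k + \<sigma>) else 0)
    :: (complex ^ 'n \<Rightarrow> complex) \<Rightarrow> _)"
  have G: "Gamma \<sigma> > 0" by (rule Gamma_real_pos) fact
  obtain C where C: "C \<ge> 0" "\<And>\<omega> f z. moderate L \<omega> \<Longrightarrow> entire (f :: complex ^ 'n \<Rightarrow> complex) \<Longrightarrow>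
     (\<And>z. norm (f z) \<le> \<omega> z * exp ((norm z)\<^sup>2 / 2)) \<Longrightarrow>
     norm (slice_mult (\<lambda>k. if k\<^sub>0 \<le> k then 1 else 0) f z) \<le> C * min 1 (norm z) ^ k\<^sub>0 * \<omega> z * exp ((norm z)\<^sup>2 / 2)"
    by (rule cutoff_bound[OF L, of k\<^sub>0, where 'n = 'n]) blast
  \<comment> \<open>The two exponential losses in \<open>(1 - t) * r\<close>: \<open>L\<close> from
    moving the weight from \<open>t z\<close> to \<open>z\<close>, and \<open>k\<^sub>0\<close> from
    \<open>min_one_scaled_le\<close>, which also causes the \<open>2 ^ k\<^sub>0\<close> in
    \<open>D\<close>.\<close>
  define K where "K = L + real k\<^sub>0"
  define D where "D = C * 2 ^ k\<^sub>0 * exp (K\<^sup>2 + 1 / 4)"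
  have D: "D \<ge> 0" using C by (simp add: D_def)
  show "\<exists>C\<ge>0. \<forall>\<omega> (f :: complex ^ 'n \<Rightarrow> complex) z. moderate L \<omega> \<longrightarrow> entire f \<longrightarrow>
     (\<forall>z. norm (f z) \<le> \<omega> z * exp ((norm z)\<^sup>2 / 2)) \<longrightarrow>
     norm (T f z) \<le> C * \<omega> z * (1 + norm z) powr (2 * (- \<sigma>)) * exp ((norm z)\<^sup>2 / 2)"
  proof (intro exI[of _ "D * 8 powr \<sigma>"] conjI allI impI)
    show "0 \<le> D * 8 powr \<sigma>" using D by simp
    fix \<omega> and f :: "complex ^ 'n \<Rightarrow> complex" and z :: "complex ^ 'n"
    assume w: "moderate L \<omega>" and f: "entire f" and fb: "\<forall>z. norm (f z) \<le> \<omega> z * exp ((norm z)\<^sup>2 / 2)"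
    note w0 = moderateD(1)[OF w]
    define g where "g = slice_mult (\<lambda>k. if k\<^sub>0 \<le> k then 1 else 0) f"
    define r where "r = norm z"
    have r: "r \<ge> 0" by (simp add: r_def)
    define q where "q = (1 + r\<^sup>2) / 4"
    have q: "q > 0" by (simp add: q_def add_pos_nonneg)
    define E where "E = D * \<omega> z * exp (r\<^sup>2 / 2)"
    have E: "E \<ge> 0" using D w0 by (simp add: E_def)
    have g: "norm (g u) \<le> C * min 1 (norm u) ^ k\<^sub>0 * \<omega> u * exp ((norm u)\<^sup>2 / 2)" for u
      unfolding g_def using C(2)[OF w f] fb by blast
    have key: "indicator {0..1} t * (t powr (b - 1) * (1 - t) powr (\<sigma> - 1)) * norm (g (of_real t *s z)) \<le>
      E * (indicator {0..1} t * ((1 - t) powr (\<sigma> - 1) * exp (- ((1 - t) * q))))" for t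
    proof (cases "0 < t \<and> t \<le> 1")
      case True
      have tz: "norm (of_real t *s z) = t * r" using True by (simp add: norm_vector_smult r_def)
      have "of_real t *s z - z = of_real (t - 1) *s z" by (simp add: vector_sub_rdistrib)
      then have tz': "norm (of_real t *s z - z) = (1 - t) * r"
        using True by (simp only: norm_vector_smult norm_of_real r_def) simp
      have 1: "min 1 (t * r) ^ k\<^sub>0 \<le> 2 ^ k\<^sub>0 * t ^ k\<^sub>0 * exp (real k\<^sub>0 * ((1 - t) * r))"
      proof -
        have "min 1 (t * r) ^ k\<^sub>0 \<le> (2 * t * exp ((1 - t) * r)) ^ k\<^sub>0"
          using True r by (intro power_mono min_one_scaled_le) auto
        then show ?thesis by (simp add: power_mult_distrib exp_of_nat_mult)
      qed
      have 2: "\<omega> (of_real t *s z) \<le> \<omega> z * exp (L * ((1 - t) * r))"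
        using moderateD(2)[OF w, of "of_real t *s z" z] by (simp only: tz')
      have "norm (g (of_real t *s z)) \<le> C * min 1 (t * r) ^ k\<^sub>0 * \<omega> (of_real t *s z) * exp ((t * r)\<^sup>2 / 2)"
        using g[of "of_real t *s z"] by (simp only: tz)
      also have "\<dots> \<le> C * (2 ^ k\<^sub>0 * t ^ k\<^sub>0 * exp (real k\<^sub>0 * ((1 - t) * r))) * (\<omega> z * exp (L * ((1 - t) * r))) * exp ((t * r)\<^sup>2 / 2)"
        using 1 2 C(1) w0 True r by (intro mult_right_mono mult_mono mult_left_mono) auto
      also have "\<dots> = C * 2 ^ k\<^sub>0 * \<omega> z * t ^ k\<^sub>0 * exp (K * ((1 - t) * r) + (t * r)\<^sup>2 / 2)"
      proof -
        have *: "exp (K * X + Y) = exp (real k\<^sub>0 * X) * (exp (L * X) * exp Y)" for X Y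
          by (simp add: K_def distrib_right exp_add)
        show ?thesis by (subst *) (simp only: mult_ac)
      qed
      also have "\<dots> \<le> C * 2 ^ k\<^sub>0 * \<omega> z * t ^ k\<^sub>0 * exp (K\<^sup>2 + 1 / 4 + r\<^sup>2 / 2 - (1 - t) * q)"
        using beta_kernel_exponent[of t r K] True r C w0 by (intro mult_left_mono) (auto simp: q_def)
      also have "\<dots> = E * t ^ k\<^sub>0 * exp (- ((1 - t) * q))"
      proof -
        have *: "exp (K\<^sup>2 + 1 / 4 + r\<^sup>2 / 2 - (1 - t) * q) =
          exp (K\<^sup>2 + 1 / 4) * exp (r\<^sup>2 / 2) * exp (- ((1 - t) * q))"
          by (simp only: diff_conv_add_uminus exp_add)
        show ?thesis by (subst *) (simp only: E_def D_def mult_ac)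
      qed
      finally have gt: "norm (g (of_real t *s z)) \<le> E * t ^ k\<^sub>0 * exp (- ((1 - t) * q))" .
      \<comment> \<open>The zero of \<open>g\<close> at the origin cancels the singularity of the
        kernel: \<open>b + k\<^sub>0 \<ge> 1\<close> leaves a nonnegative exponent.\<close>
      have "t powr (b - 1) * t ^ k\<^sub>0 = t powr (b + real k\<^sub>0 - 1)"
        using True by (simp add: powr_realpow[symmetric] flip: powr_add) (simp add: algebra_simps)
      also have "\<dots> \<le> 1" using True b by (intro powr_le1) auto
      finally have tk: "t powr (b - 1) * t ^ k\<^sub>0 \<le> 1" .
      have "(t powr (b - 1) * (1 - t) powr (\<sigma> - 1)) * norm (g (of_real t *s z)) \<le>
        (t powr (b - 1) * (1 - t) powr (\<sigma> - 1)) * (E * t ^ k\<^sub>0 * exp (- ((1 - t) * q)))"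
        by (intro mult_left_mono gt) auto
      also have "\<dots> = (t powr (b - 1) * t ^ k\<^sub>0) * (E * ((1 - t) powr (\<sigma> - 1) * exp (- ((1 - t) * q))))"
        by (simp only: mult_ac)
      also have "\<dots> \<le> 1 * (E * ((1 - t) powr (\<sigma> - 1) * exp (- ((1 - t) * q))))"
        using E by (intro mult_right_mono tk) auto
      finally show ?thesis using True by simp
    next
      case False
      then have "indicator {0..1} t * (t powr (b - 1) * (1 - t) powr (\<sigma> - 1)) = 0" by (auto simp: indicator_def)
      then show ?thesis using E by (simp only: mult_zero_left) (intro mult_nonneg_nonneg, auto)
    qed
    have "ennreal (Gamma \<sigma> * norm (T f z)) \<le>
      (\<integral>\<^sup>+t. ennreal (indicator {0..1} t * (t powr (b - 1) * (1 - t) powr (\<sigma> - 1)) * norm (g (of_real t *s z))) \<partial>lborel)"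
      unfolding T_def g_def by (rule beta_multiplier_integral[OF \<sigma> b f])
    also have "\<dots> \<le> (\<integral>\<^sup>+t. ennreal E * ennreal (indicator {0..1} t * ((1 - t) powr (\<sigma> - 1) * exp (- ((1 - t) * q)))) \<partial>lborel)"
      using key E by (intro nn_integral_mono) (simp add: ennreal_mult[symmetric] ennreal_leI)
    also have "\<dots> = ennreal E * (\<integral>\<^sup>+t. ennreal (indicator {0..1} t * ((1 - t) powr (\<sigma> - 1) * exp (- ((1 - t) * q)))) \<partial>lborel)"
      by (intro nn_integral_cmult) measurable
    also have "\<dots> \<le> ennreal E * ennreal (Gamma \<sigma> * q powr (- \<sigma>))"
      by (intro mult_left_mono nn_integral_powr_exp_bound \<sigma> q) auto
    also have "\<dots> = ennreal (E * (Gamma \<sigma> * q powr (- \<sigma>)))" using E G by (simp add: ennreal_mult)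
    finally have "Gamma \<sigma> * norm (T f z) \<le> E * (Gamma \<sigma> * q powr (- \<sigma>))"
      using E G by (simp add: ennreal_le_iff)
    then have "norm (T f z) \<le> E * q powr (- \<sigma>)" using G by (simp add: mult.left_commute)
    also have "\<dots> \<le> E * (8 powr \<sigma> * (1 + r) powr (2 * (- \<sigma>)))"
      unfolding q_def using E \<sigma> r by (intro mult_left_mono one_plus_square_powr_le) auto
    finally show "norm (T f z) \<le> D * 8 powr \<sigma> * \<omega> z * (1 + norm z) powr (2 * (- \<sigma>)) * exp ((norm z)\<^sup>2 / 2)"
      by (simp add: E_def r_def mult_ac)
  qed
qed

subsection \<open>Mean value inequalities for powers\<close>

lemma continuous_on_vector_smult [continuous_intros]:
  fixes f :: "'a::topological_space \<Rightarrow> complex" and g :: "'a \<Rightarrow> complex ^ 'n"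
  assumes "continuous_on S f" "continuous_on S g"
  shows "continuous_on S (\<lambda>x. f x *s g x)"
  unfolding vector_scalar_mult_def by (intro continuous_intros assms)

lemma nn_integral_lborel_translate:
  fixes h :: "'a::euclidean_space \<Rightarrow> ennreal"
  assumes "h \<in> borel_measurable borel"
  shows "(\<integral>\<^sup>+x. h (a + x) \<partial>lborel) = (\<integral>\<^sup>+x. h x \<partial>lborel)"
proof -
  have "(\<integral>\<^sup>+x. h x \<partial>lborel) = (\<integral>\<^sup>+x. h x \<partial>distr lborel borel ((+) a))"
    by (simp add: lborel_distr_plus)
  also have "\<dots> = (\<integral>\<^sup>+x. h (a + x) \<partial>lborel)"
    by (rule nn_integral_distr) (use assms in auto)
  finally show ?thesis by simp
qed

text \<open>Weil's argument: integrate \<open>1\<^sub>A(x) h(x + c y)\<close> over \<open>(x, y)\<close> in both orders, with \<open>A\<close> the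
  unit ball, which is invariant under the rotation and under \<open>x \<mapsto> -x\<close>.\<close>
lemma nn_integral_lborel_rotate:
  fixes h :: "complex ^ 'n \<Rightarrow> ennreal"
  assumes [measurable]: "h \<in> borel_measurable borel" and c: "norm c = 1"
  shows "(\<integral>\<^sup>+u. h (c *s u) \<partial>lborel) = (\<integral>\<^sup>+u. h u \<partial>lborel)"
proof -
  have [measurable]: "(\<lambda>u :: complex ^ 'n. c *s u) \<in> borel_measurable borel"
    by (intro borel_measurable_continuous_onI continuous_intros)
  define A :: "(complex ^ 'n) set" where "A = ball 0 1"
  have [measurable]: "A \<in> sets borel" by (simp add: A_def)
  define d where "d = inverse c"
  have "c \<noteq> 0" using c by auto
  then have cd: "c *s (d *s u) = u" for u :: "complex ^ 'n"
    by (simp add: d_def vector_smult_assoc)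
  have nd: "norm (d *s u) = norm u" for u :: "complex ^ 'n"
    using c by (simp add: d_def norm_vector_smult norm_inverse)
  define a where "a = emeasure lborel A"
  have a: "a \<noteq> 0" "a \<noteq> \<top>"
  proof -
    define v where "v = unit_ball_vol (real DIM(complex ^ 'n))"
    have "v > 0" unfolding v_def by (rule unit_ball_vol_pos) simp
    moreover have "a = ennreal v"
      using emeasure_ball[of 1 "0 :: complex ^ 'n"] by (simp add: a_def A_def v_def)
    ultimately show "a \<noteq> 0" "a \<noteq> \<top>" by simp_all
  qed
  have 1: "(\<integral>\<^sup>+x. \<integral>\<^sup>+y. indicator A x * h (x + c *s y) \<partial>lborel \<partial>lborel) = a * (\<integral>\<^sup>+u. h (c *s u) \<partial>lborel)"
  proof -
    have "(\<integral>\<^sup>+y. h (x + c *s y) \<partial>lborel) = (\<integral>\<^sup>+y. h (c *s y) \<partial>lborel)" for x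
    proof -
      have "(\<integral>\<^sup>+y. h (x + c *s y) \<partial>lborel) = (\<integral>\<^sup>+y. h (c *s (d *s x + y)) \<partial>lborel)"
        unfolding vector_add_ldistrib cd by (rule refl)
      also have "\<dots> = (\<integral>\<^sup>+y. h (c *s y) \<partial>lborel)"
        by (rule nn_integral_lborel_translate[of "\<lambda>y. h (c *s y)"]) measurable
      finally show ?thesis .
    qed
    then have "(\<integral>\<^sup>+x. \<integral>\<^sup>+y. indicator A x * h (x + c *s y) \<partial>lborel \<partial>lborel) =
      (\<integral>\<^sup>+x. indicator A x * (\<integral>\<^sup>+u. h (c *s u) \<partial>lborel) \<partial>lborel)"
      by (simp add: nn_integral_cmult)
    then show ?thesis by (simp add: nn_integral_multc a_def)
  qed
  have 2: "(\<integral>\<^sup>+y. \<integral>\<^sup>+x. indicator A x * h (x + c *s y) \<partial>lborel \<partial>lborel) = a * (\<integral>\<^sup>+u. h u \<partial>lborel)"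
  proof -
    have "(\<integral>\<^sup>+x. indicator A x * h (x + c *s y) \<partial>lborel) = (\<integral>\<^sup>+x. indicator A (x - c *s y) * h x \<partial>lborel)" for y
      using nn_integral_lborel_translate[of "\<lambda>x. indicator A (x - c *s y) * h x" "c *s y"]
      by (simp add: add.commute)
    then have "(\<integral>\<^sup>+y. \<integral>\<^sup>+x. indicator A x * h (x + c *s y) \<partial>lborel \<partial>lborel) =
       (\<integral>\<^sup>+y. \<integral>\<^sup>+x. indicator A (x - c *s y) * h x \<partial>lborel \<partial>lborel)" by simp
    also have "\<dots> = (\<integral>\<^sup>+x. \<integral>\<^sup>+y. indicator A (x - c *s y) * h x \<partial>lborel \<partial>lborel)"
      by (rule lborel_pair.Fubini') measurable
    also have "\<dots> = (\<integral>\<^sup>+x. a * h x \<partial>lborel)"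
    proof (rule nn_integral_cong)
      fix x
      have "indicator A (x - c *s y) = (indicator A (- (d *s x) + y) :: ennreal)" for y
      proof -
        \<comment> \<open>Rotating by \<open>d\<close> preserves the norm, hence membership in
          \<open>A\<close>; afterwards \<open>y\<close> is merely translated, up to the
          sign.\<close>
        have "d *s (x - c *s y) = d *s x - y"
          using \<open>c \<noteq> 0\<close> by (simp add: vector_ssub_ldistrib vector_smult_assoc d_def)
        then have "norm (x - c *s y) = norm (- (d *s x) + y)"
          using nd[of "x - c *s y"] by (simp add: norm_minus_commute)
        then show ?thesis by (simp add: A_def indicator_def)
      qed
      then have "(\<integral>\<^sup>+y. indicator A (x - c *s y) \<partial>lborel) = (\<integral>\<^sup>+y. indicator A (- (d *s x) + y) \<partial>lborel)" by simp
      also have "\<dots> = a"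
        by (subst nn_integral_lborel_translate) (simp_all add: a_def)
      finally show "(\<integral>\<^sup>+y. indicator A (x - c *s y) * h x \<partial>lborel) = a * h x"
        by (simp add: nn_integral_multc)
    qed
    finally show ?thesis by (simp add: nn_integral_cmult)
  qed
  have "a * (\<integral>\<^sup>+u. h (c *s u) \<partial>lborel) = a * (\<integral>\<^sup>+u. h u \<partial>lborel)"
    unfolding 1[symmetric] 2[symmetric] by (rule lborel_pair.Fubini'[symmetric]) measurable
  with a show ?thesis by (simp add: ennreal_mult_cancel_left)
qed

section \<open>Mean values over circles and balls\<close>

lemma circle_mean_bound:
  fixes h :: "complex ^ 'n \<Rightarrow> complex"
  assumes "entire h"
  shows "ennreal (norm (h 0)) \<le>
    (\<integral>\<^sup>+s. ennreal (norm (h (exp (2 * of_real pi * \<i> * of_real s) *s u))) * indicator {0..1} s \<partial>lborel)"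
proof -
  let ?g = "\<lambda>w. h (w *s u)"
  let ?e = "\<lambda>s. exp (2 * of_real pi * \<i> * of_real s) :: complex"
  have hol: "?g holomorphic_on S" for S
    using entire_line_holomorphic[OF assms, of 0 u S] by simp
  \<comment> \<open>Cauchy's formula for the slice through \<open>u\<close>: its value at 0 is
    \<open>h 0\<close> whatever \<open>u\<close> is, so the bound can later be averaged over
    \<open>u\<close>.\<close>
  have "((\<lambda>w. ?g w / (w - 0)) has_contour_integral 2 * of_real pi * \<i> * ?g 0) (circlepath 0 1)"
    by (rule Cauchy_integral_circlepath_simple) (auto intro: hol)
  then have "((\<lambda>s. ?g (?e s) / ?e s * (2 * of_real pi * \<i> * ?e s)) has_integral 2 * of_real pi * \<i> * ?g 0) {0..1}"
    unfolding has_contour_integral_def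
  proof (rule has_integral_eq[rotated])
    fix s :: real assume "s \<in> {0..1}"
    then have "vector_derivative (circlepath 0 1) (at s within {0..1}) = 2 * of_real pi * \<i> * ?e s"
      using vector_derivative_circlepath01[of s 0 1] by simp
    then show "?g (circlepath 0 1 s) / (circlepath 0 1 s - 0) * vector_derivative (circlepath 0 1) (at s within {0..1}) =
      ?g (?e s) / ?e s * (2 * of_real pi * \<i> * ?e s)"
      by (simp only:) (simp add: circlepath)
  qed
  from has_integral_mult_right[OF this, of "1 / (2 * of_real pi * \<i>)"]
  have I: "((\<lambda>s. ?g (?e s)) has_integral h 0) {0..1}" by simp
  have cont: "continuous_on {0..1} (\<lambda>s. norm (?g (?e s)))"
    by (intro continuous_intros continuous_on_compose2[OF entire_continuous[OF assms, of UNIV]]) auto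
  then obtain J where J: "((\<lambda>s. norm (?g (?e s))) has_integral J) {0..1}"
    using integrable_continuous_interval by blast
  have "norm (h 0) \<le> J"
    using integral_norm_bound_integral[OF has_integral_integrable[OF I] has_integral_integrable[OF J]]
      integral_unique[OF I] integral_unique[OF J] by simp
  then have "ennreal (norm (h 0)) \<le> ennreal J" by (rule ennreal_leI)
  also have "\<dots> = (\<integral>\<^sup>+s\<in>{0..1}. ennreal (norm (?g (?e s))) \<partial>lborel)"
    by (rule nn_integral_has_integral_lebesgue'[symmetric, OF _ J]) simp
  finally show ?thesis .
qed

text \<open>The circle mean is integrated over \<open>u\<close> in the ball and the integrals are
  exchanged; by rotation invariance the inner one does not depend on the angle. This replaces polar
  coordinates.\<close>

lemma ball_mean_bound_0:
  fixes h :: "complex ^ 'n \<Rightarrow> complex"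
  assumes "entire h"
  shows "ennreal (norm (h 0)) * emeasure lborel (ball (0 :: complex ^ 'n) \<rho>) \<le>
    (\<integral>\<^sup>+u. ennreal (norm (h u)) * indicator (ball 0 \<rho>) u \<partial>lborel)"
proof -
  let ?e = "\<lambda>s. exp (2 * of_real pi * \<i> * of_real s) :: complex"
  let ?B = "ball (0 :: complex ^ 'n) \<rho>"
  let ?K = "\<integral>\<^sup>+u. ennreal (norm (h u)) * indicator ?B u \<partial>lborel"
  have [measurable]: "ball x r \<in> sets borel" for x :: "complex ^ 'n" and r by simp
  have hm [measurable]: "h \<in> borel_measurable borel"
    by (intro borel_measurable_continuous_onI entire_continuous assms)
  have jm: "(\<lambda>p. ennreal (norm (h (?e (snd p) *s fst p)))) \<in> borel_measurable borel"
  proof -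
    have "continuous_on UNIV (\<lambda>p. norm (h (?e (snd p) *s (fst p :: complex ^ 'n))))"
      by (intro continuous_intros continuous_on_compose2[OF entire_continuous[OF assms, of UNIV]]) auto
    then have [measurable]: "(\<lambda>p. norm (h (?e (snd p) *s (fst p :: complex ^ 'n)))) \<in> borel_measurable borel"
      by (rule borel_measurable_continuous_onI)
    show ?thesis by measurable
  qed
  then have jm' [measurable]: "(\<lambda>(u, s). ennreal (norm (h (?e s *s u)))) \<in> borel_measurable (borel \<Otimes>\<^sub>M borel)"
    by (simp add: borel_prod case_prod_unfold)
  have "ennreal (norm (h 0)) * emeasure lborel ?B = (\<integral>\<^sup>+u. ennreal (norm (h 0)) * indicator ?B u \<partial>lborel)"
    by (rule nn_integral_cmult_indicator[symmetric]) simp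
  also have "\<dots> \<le> (\<integral>\<^sup>+u. (\<integral>\<^sup>+s. ennreal (norm (h (?e s *s u))) * indicator {0..1} s * indicator ?B u \<partial>lborel) \<partial>lborel)"
  proof (rule nn_integral_mono)
    fix u :: "complex ^ 'n"
    have "ennreal (norm (h 0)) * indicator ?B u \<le>
      (\<integral>\<^sup>+s. ennreal (norm (h (?e s *s u))) * indicator {0..1} s \<partial>lborel) * indicator ?B u"
      by (intro mult_right_mono circle_mean_bound assms) auto
    also have "\<dots> = (\<integral>\<^sup>+s. ennreal (norm (h (?e s *s u))) * indicator {0..1} s * indicator ?B u \<partial>lborel)"
      by (cases "u \<in> ?B") auto
    finally show "ennreal (norm (h 0)) * indicator ?B u \<le>
      (\<integral>\<^sup>+s. ennreal (norm (h (?e s *s u))) * indicator {0..1} s * indicator ?B u \<partial>lborel)" .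
  qed
  also have "\<dots> = (\<integral>\<^sup>+s. (\<integral>\<^sup>+u. ennreal (norm (h (?e s *s u))) * indicator {0..1} s * indicator ?B u \<partial>lborel) \<partial>lborel)"
    by (rule lborel_pair.Fubini'[symmetric]) measurable
  also have "\<dots> = (\<integral>\<^sup>+s. ?K * indicator {0..1 :: real} s \<partial>lborel)"
  proof (rule nn_integral_cong)
    fix s :: real
    have ns: "norm (?e s) = 1" by simp
    have "(\<integral>\<^sup>+u. ennreal (norm (h (?e s *s u))) * indicator ?B u \<partial>lborel) =
      (\<integral>\<^sup>+u. ennreal (norm (h (?e s *s u))) * indicator ?B (?e s *s u) \<partial>lborel)"
      by (simp add: indicator_def norm_vector_smult)
    also have "\<dots> = ?K"
      by (rule nn_integral_lborel_rotate[of "\<lambda>u. ennreal (norm (h u)) * indicator ?B u", OF _ ns]) measurable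
    finally have "(\<integral>\<^sup>+u. ennreal (norm (h (?e s *s u))) * indicator ?B u \<partial>lborel) = ?K" .
    then show "(\<integral>\<^sup>+u. ennreal (norm (h (?e s *s u))) * indicator {0..1} s * indicator ?B u \<partial>lborel) = ?K * indicator {0..1} s"
      by (cases "s \<in> {0..1}") auto
  qed
  also have "\<dots> = ?K" by (simp add: nn_integral_cmult)
  finally show ?thesis .
qed

lemma ball_mean_bound:
  fixes h :: "complex ^ 'n \<Rightarrow> complex"
  assumes "entire h" "\<rho> \<ge> 0"
  shows "ennreal (norm (h a) * (unit_ball_vol DIM(complex ^ 'n) * \<rho> ^ DIM(complex ^ 'n))) \<le>
    (\<integral>\<^sup>+u. ennreal (norm (h u)) * indicator (ball a \<rho>) u \<partial>lborel)"
proof -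
  have [measurable]: "ball x r \<in> sets borel" for x :: "complex ^ 'n" and r by simp
  have hm [measurable]: "h \<in> borel_measurable borel"
    by (intro borel_measurable_continuous_onI entire_continuous assms)
  have "ennreal (norm (h a) * (unit_ball_vol DIM(complex ^ 'n) * \<rho> ^ DIM(complex ^ 'n))) =
    ennreal (norm (h (a + 0))) * emeasure lborel (ball (0 :: complex ^ 'n) \<rho>)"
    using assms by (simp add: emeasure_ball ennreal_mult)
  also have "\<dots> \<le> (\<integral>\<^sup>+u. ennreal (norm (h (a + u))) * indicator (ball 0 \<rho>) u \<partial>lborel)"
    by (rule ball_mean_bound_0[OF entire_translate[OF assms(1)]])
  also have "\<dots> = (\<integral>\<^sup>+u. ennreal (norm (h (a + u))) * indicator (ball a \<rho>) (a + u) \<partial>lborel)"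
    by (simp add: indicator_def dist_norm)
  also have "\<dots> = (\<integral>\<^sup>+u. ennreal (norm (h u)) * indicator (ball a \<rho>) u \<partial>lborel)"
    by (rule nn_integral_lborel_translate[of "\<lambda>u. ennreal (norm (h u)) * indicator (ball a \<rho>) u"]) measurable
  finally show ?thesis .
qed

text \<open>In place of Jensen's inequality, \<open>norm (h u)\<close> is split at the level
  \<open>T\<close>: values above it are at most \<open>T powr (1 - p)\<close> times their
  \<open>p\<close>-th power, and those below contribute at most half of \<open>norm (h 0)\<close> to
  the mean.\<close>

lemma submean_powr_ge_1:
  fixes h :: "complex ^ 'n \<Rightarrow> complex"
  assumes h: "entire h" and p: "p \<ge> 1"
  shows "ennreal (norm (h 0) powr p * (unit_ball_vol DIM(complex ^ 'n) / 2 powr p)) \<le>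
    (\<integral>\<^sup>+u. ennreal (norm (h u) powr p) * indicator (ball 0 1) u \<partial>lborel)" (is "_ \<le> ?I")
proof (cases "h 0 = 0 \<or> ?I = \<top>")
  case False
  define v where "v = unit_ball_vol (real DIM(complex ^ 'n))"
  have v: "v > 0" unfolding v_def by (rule unit_ball_vol_pos) simp
  obtain i where i: "?I = ennreal i" "i \<ge> 0" using False by (cases ?I) auto
  define T where "T = norm (h 0) / 2"
  have T: "T > 0" using False by (simp add: T_def)
  have [measurable]: "ball x r \<in> sets borel" for x :: "complex ^ 'n" and r by simp
  have hm [measurable]: "h \<in> borel_measurable borel"
    by (intro borel_measurable_continuous_onI entire_continuous h)
  have young: "x \<le> T + T powr (1 - p) * x powr p" if "x \<ge> 0" for x
  proof (cases "x \<le> T")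
    case True
    then show ?thesis by (simp add: add_increasing2)
  next
    case False
    have "x = x powr (1 - p) * x powr p" using False T by (simp flip: powr_add)
    also have "\<dots> \<le> T powr (1 - p) * x powr p"
      using False T p by (intro mult_right_mono powr_mono2') auto
    finally show ?thesis using T by simp
  qed
  have "ennreal (norm (h 0) * v) \<le> (\<integral>\<^sup>+u. ennreal (norm (h u)) * indicator (ball 0 1) u \<partial>lborel)"
    using ball_mean_bound[OF h, of 1 0] by (simp add: v_def)
  also have "\<dots> \<le> (\<integral>\<^sup>+u. ennreal T * indicator (ball 0 1) u + ennreal (T powr (1 - p)) * (ennreal (norm (h u) powr p) * indicator (ball 0 1) u) \<partial>lborel)"
  proof (rule nn_integral_mono)
    fix u
    have "ennreal (norm (h u)) \<le> ennreal (T + T powr (1 - p) * norm (h u) powr p)"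
      by (intro ennreal_leI young) simp
    also have "\<dots> = ennreal T + ennreal (T powr (1 - p)) * ennreal (norm (h u) powr p)"
      using T by (simp add: ennreal_mult ennreal_plus)
    finally show "ennreal (norm (h u)) * indicator (ball 0 1) u \<le> ennreal T * indicator (ball 0 1) u + ennreal (T powr (1 - p)) * (ennreal (norm (h u) powr p) * indicator (ball 0 1) u)"
      by (simp add: indicator_def)
  qed
  also have "\<dots> = ennreal T * emeasure lborel (ball (0 :: complex ^ 'n) 1) + ennreal (T powr (1 - p)) * ?I"
    by (subst nn_integral_add) (auto simp: nn_integral_cmult)
  also have "\<dots> = ennreal (T * v + T powr (1 - p) * i)"
    using T v i by (simp add: i emeasure_ball ennreal_mult ennreal_plus v_def)
  finally have "norm (h 0) * v \<le> T * v + T powr (1 - p) * i"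
    using T v i by (subst (asm) ennreal_le_iff) auto
  then have "T * v \<le> T powr (1 - p) * i" by (simp add: T_def)
  then have "T powr (p - 1) * (T * v) \<le> T powr (p - 1) * (T powr (1 - p) * i)"
    by (intro mult_left_mono) auto
  moreover have "T powr (p - 1) * T = T powr p" using T by (simp add: powr_mult_base powr_diff)
  moreover have "T powr (p - 1) * T powr (1 - p) = 1" using T by (simp flip: powr_add)
  ultimately have "T powr p * v \<le> i" by (simp flip: mult.assoc)
  moreover have "T powr p = norm (h 0) powr p / 2 powr p" by (simp add: T_def powr_divide)
  ultimately show ?thesis unfolding i by (intro ennreal_leI) (simp add: v_def)
qed auto

text \<open>For \<open>p < 1\<close> (Fefferman--Stein): at a maximum point \<open>u\<^sub>0\<close> of \<open>(1 - |u|)\<^sup>N |h u|\<^sup>p\<close> one writes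
  \<open>|h| = |h|\<^sup>1\<^sup>-\<^sup>p |h|\<^sup>p\<close> in the mean value inequality on a ball around \<open>u\<^sub>0\<close>, and bounds the first factor
  by maximality.\<close>
lemma submean_powr_less_1:
  fixes h :: "complex ^ 'n \<Rightarrow> complex"
  assumes h: "entire h" and p: "0 < p" "p < 1"
  shows "ennreal (norm (h 0) powr p * (unit_ball_vol DIM(complex ^ 'n) / 2 powr (DIM(complex ^ 'n) / p))) \<le>
    (\<integral>\<^sup>+u. ennreal (norm (h u) powr p) * indicator (ball 0 1) u \<partial>lborel)" (is "_ \<le> ?I")
proof (cases "h 0 = 0 \<or> ?I = \<top>")
  case False
  define N where "N = DIM(complex ^ 'n)"
  define v where "v = unit_ball_vol (real N)"
  have v: "v > 0" unfolding v_def by (rule unit_ball_vol_pos) simp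
  obtain i where i: "?I = ennreal i" "i \<ge> 0" using False by (cases ?I) auto
  have [measurable]: "ball x r \<in> sets borel" for x :: "complex ^ 'n" and r by simp
  have hm [measurable]: "h \<in> borel_measurable borel"
    by (intro borel_measurable_continuous_onI entire_continuous h)
  define \<phi> where "\<phi> u = (1 - norm u) ^ N * norm (h u) powr p" for u
  have "continuous_on (cball 0 1) \<phi>"
    unfolding \<phi>_def[abs_def]
    by (intro continuous_intros continuous_on_powr' entire_continuous h) (use p in auto)
  then obtain u0 where u0: "u0 \<in> cball 0 1" "\<And>u. u \<in> cball 0 1 \<Longrightarrow> \<phi> u \<le> \<phi> u0"
    using continuous_attains_sup[of "cball (0 :: complex ^ 'n) 1" \<phi>] by auto
  define S where "S = \<phi> u0"
  have h0S: "norm (h 0) powr p \<le> S" using u0(2)[of 0] by (simp add: \<phi>_def S_def)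
  then have S: "S > 0" using False by (intro less_le_trans[OF _ h0S]) auto
  have N: "N > 0" by (simp add: N_def)
  have "norm u0 \<noteq> 1" using S N by (auto simp: S_def \<phi>_def zero_power)
  define \<delta> where "\<delta> = 1 - norm u0"
  have \<delta>: "\<delta> > 0" using u0(1) \<open>norm u0 \<noteq> 1\<close> by (simp add: \<delta>_def)
  \<comment> \<open>Upper bound of \<open>norm (h u) powr p\<close> on the ball of radius
    \<open>\<delta> / 2\<close> about \<open>u0\<close>: there
    \<open>1 - norm u \<ge> \<delta> / 2\<close>, and maximality gives
    \<open>S / (\<delta> / 2) ^ N\<close>.\<close>
  define Q where "Q = S * (2 / \<delta>) ^ N"
  have Q: "Q > 0" using S \<delta> by (simp add: Q_def)
  \<comment> \<open>The exponent for which \<open>x = x powr p * (x powr p) powr e\<close> when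
    \<open>x \<ge> 0\<close>.\<close>
  define e where "e = (1 - p) / p"
  have e: "e \<ge> 0" "1 / p = 1 + e" using p by (auto simp: e_def field_simps)
  have near: "norm u < 1" "norm (h u) \<le> norm (h u) powr p * Q powr e" if "u \<in> ball u0 (\<delta> / 2)" for u
  proof -
    have "norm u - norm u0 \<le> norm (u - u0)" by (rule norm_triangle_ineq2)
    with that have nu: "1 - norm u \<ge> \<delta> / 2" by (simp add: \<delta>_def dist_norm norm_minus_commute)
    with \<delta> show n1: "norm u < 1" by simp
    have "(\<delta> / 2) ^ N * norm (h u) powr p \<le> (1 - norm u) ^ N * norm (h u) powr p"
      using nu \<delta> by (intro mult_right_mono power_mono) auto
    also have "\<dots> \<le> S" using u0(2)[of u] n1 by (simp add: \<phi>_def S_def)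
    finally have "norm (h u) powr p \<le> S / (\<delta> / 2) ^ N"
      using \<delta> by (simp add: pos_le_divide_eq mult.commute)
    also have "\<dots> = Q" by (simp add: Q_def power_divide)
    finally have "(norm (h u) powr p) powr e \<le> Q powr e" using e by (intro powr_mono2) auto
    then have "norm (h u) powr p * (norm (h u) powr p) powr e \<le> norm (h u) powr p * Q powr e"
      by (intro mult_left_mono) auto
    moreover have "norm (h u) powr p * (norm (h u) powr p) powr e = norm (h u)"
    proof -
      have "p + p * e = 1" using p by (simp add: e_def)
      then show ?thesis by (simp add: powr_powr flip: powr_add)
    qed
    ultimately show "norm (h u) \<le> norm (h u) powr p * Q powr e" by simp
  qed
  have "ennreal (norm (h u0) * (v * (\<delta> / 2) ^ N)) \<le> (\<integral>\<^sup>+u. ennreal (norm (h u)) * indicator (ball u0 (\<delta> / 2)) u \<partial>lborel)"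
    using ball_mean_bound[OF h, of "\<delta> / 2" u0] \<delta> by (simp add: v_def N_def)
  also have "\<dots> \<le> (\<integral>\<^sup>+u. ennreal (Q powr e) * (ennreal (norm (h u) powr p) * indicator (ball 0 1) u) \<partial>lborel)"
  proof (rule nn_integral_mono)
    fix u
    show "ennreal (norm (h u)) * indicator (ball u0 (\<delta> / 2)) u \<le> ennreal (Q powr e) * (ennreal (norm (h u) powr p) * indicator (ball 0 1) u)"
    proof (cases "u \<in> ball u0 (\<delta> / 2)")
      case True
      have "ennreal (norm (h u)) \<le> ennreal (Q powr e * norm (h u) powr p)"
        using near(2)[OF True] by (intro ennreal_leI) (simp add: mult.commute)
      then show ?thesis using True near(1)[OF True] by (simp add: ennreal_mult)
    qed simp
  qed
  also have "\<dots> = ennreal (Q powr e) * ?I" by (simp add: nn_integral_cmult)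
  also have "\<dots> = ennreal (Q powr e * i)" using i by (simp add: i ennreal_mult)
  finally have main: "norm (h u0) * (v * (\<delta> / 2) ^ N) \<le> Q powr e * i"
    using i v \<delta> by (subst (asm) ennreal_le_iff) auto
  have "norm (h u0) = (norm (h u0) powr p) powr (1 / p)" using p by (simp add: powr_powr)
  \<comment> \<open>At the maximum point the value is exactly \<open>S / \<delta> ^ N\<close>. With
    \<open>1 / p = 1 + e\<close> the factor \<open>Q powr e\<close> then cancels from both sides,
    whatever its size.\<close>
  also have "norm (h u0) powr p = Q / 2 ^ N"
    using \<delta> by (simp add: Q_def S_def \<phi>_def \<delta>_def[symmetric] power_divide)
  also have "(Q / 2 ^ N) powr (1 / p) = Q powr (1 / p) / 2 powr (N / p)"
    using Q by (simp add: powr_divide powr_powr flip: powr_realpow)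
  also have "Q powr (1 / p) = Q powr e * Q" using Q by (simp add: e powr_add mult.commute)
  finally have hu0: "norm (h u0) = Q powr e * Q / 2 powr (N / p)" .
  have "Q powr e * (Q * (\<delta> / 2) ^ N * (v / 2 powr (N / p))) \<le> Q powr e * i"
    using main by (simp add: hu0 mult_ac)
  then have "Q * (\<delta> / 2) ^ N * (v / 2 powr (N / p)) \<le> i"
    by (rule mult_left_le_imp_le) (use Q in simp)
  also have "Q * (\<delta> / 2) ^ N = S"
  proof -
    have "(2 / \<delta>) ^ N * (\<delta> / 2) ^ N = 1" using \<delta> by (simp flip: power_mult_distrib)
    then show ?thesis by (simp add: Q_def mult.assoc)
  qed
  finally have "S * (v / 2 powr (N / p)) \<le> i" .
  moreover have "norm (h 0) powr p * (v / 2 powr (N / p)) \<le> S * (v / 2 powr (N / p))"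
    using h0S v by (intro mult_right_mono) auto
  ultimately show ?thesis unfolding i by (intro ennreal_leI) (simp add: v_def N_def)
qed auto

lemma submean_powr:
  fixes p :: real
  assumes p: "p > 0"
  obtains C where "C > 0" "\<And>h :: complex ^ 'n \<Rightarrow> complex. entire h \<Longrightarrow>
    ennreal (norm (h 0) powr p) \<le> ennreal C * (\<integral>\<^sup>+u. ennreal (norm (h u) powr p) * indicator (ball 0 1) u \<partial>lborel)"
proof -
  define v where "v = unit_ball_vol (real DIM(complex ^ 'n))"
  have v: "v > 0" unfolding v_def by (rule unit_ball_vol_pos) simp
  define c where "c = (if p \<ge> 1 then 2 powr p else 2 powr (DIM(complex ^ 'n) / p))"
  have c: "c > 0" by (simp add: c_def)
  show ?thesis
  proof (rule that[of "c / v"])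
    show "c / v > 0" using c v by simp
    fix h :: "complex ^ 'n \<Rightarrow> complex" assume h: "entire h"
    let ?I = "\<integral>\<^sup>+u. ennreal (norm (h u) powr p) * indicator (ball 0 1) u \<partial>lborel"
    have "ennreal (norm (h 0) powr p * (v / c)) \<le> ?I"
      using submean_powr_ge_1[OF h, of p] submean_powr_less_1[OF h p] by (auto simp: v_def c_def)
    then have "ennreal (c / v) * ennreal (norm (h 0) powr p * (v / c)) \<le> ennreal (c / v) * ?I"
      by (intro mult_left_mono) auto
    moreover have "ennreal (c / v) * ennreal (norm (h 0) powr p * (v / c)) = ennreal (norm (h 0) powr p)"
      using c v by (subst ennreal_mult[symmetric]) auto
    ultimately show "ennreal (norm (h 0) powr p) \<le> ennreal (c / v) * ?I" by simp
  qed
qed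

text \<open>The Gaussian weight is not the modulus of an entire function, but the translate
  \<open>f (z + u)\<close> can be multiplied by the exponential of a linear form in
  \<open>u\<close>. By completing the square this produces the Gaussian at \<open>z + u\<close>
  times factors in \<open>z\<close> and in \<open>u\<close> alone. The former cancels from both
  sides, the latter is bounded on the unit ball.\<close>

lemma gaussian_submean:
  fixes p :: real
  assumes p: "p > 0"
  obtains C where "C > 0" "\<And>(f :: complex ^ 'n \<Rightarrow> complex) z. entire f \<Longrightarrow>
    ennreal ((norm (f z) * exp (- (norm z)\<^sup>2 / 2)) powr p) \<le>
    ennreal C * (\<integral>\<^sup>+u. ennreal ((norm (f u) * exp (- (norm u)\<^sup>2 / 2)) powr p) * indicator (ball z 1) u \<partial>lborel)"
proof -
  obtain C where C: "C > 0" "\<And>h :: complex ^ 'n \<Rightarrow> complex. entire h \<Longrightarrow>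
    ennreal (norm (h 0) powr p) \<le> ennreal C * (\<integral>\<^sup>+u. ennreal (norm (h u) powr p) * indicator (ball 0 1) u \<partial>lborel)"
    by (rule submean_powr[OF p, where 'n = 'n]) blast
  show ?thesis
  proof (rule that[of "C * exp (p / 2)"])
    show "C * exp (p / 2) > 0" using C by simp
    fix f :: "complex ^ 'n \<Rightarrow> complex" and z :: "complex ^ 'n" assume f: "entire f"
    have [measurable]: "ball x r \<in> sets borel" for x :: "complex ^ 'n" and r by simp
    have fm [measurable]: "f \<in> borel_measurable borel"
      by (intro borel_measurable_continuous_onI entire_continuous f)
    define h where "h u = f (z + u) * exp (\<Sum>i\<in>UNIV. u $ i * (- cnj (z $ i)))" for u
    have he: "entire h"
      unfolding h_def[abs_def]
      by (rule entire_mult[OF entire_translate[OF f] entire_exp[OF entire_sum]])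
         (intro entire_mult entire_nth entire_const)
    define W where "W u = (norm (f u) * exp (- (norm u)\<^sup>2 / 2)) powr p" for u
    have nh: "norm (h u) = norm (f (z + u)) * exp (- (norm (z + u))\<^sup>2 / 2) * exp ((norm z)\<^sup>2 / 2) * exp ((norm u)\<^sup>2 / 2)" for u
    proof -
      have "Re (\<Sum>i\<in>UNIV. u $ i * (- cnj (z $ i))) = - (u \<bullet> z)"
        by (simp add: inner_vec_def inner_complex_def sum_negf[symmetric])
      also have "\<dots> = - (norm (z + u))\<^sup>2 / 2 + (norm z)\<^sup>2 / 2 + (norm u)\<^sup>2 / 2"
        by (simp add: power2_norm_eq_inner inner_add inner_commute field_simps)
      finally have E: "norm (exp (\<Sum>i\<in>UNIV. u $ i * (- cnj (z $ i)))) =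
        exp (- (norm (z + u))\<^sup>2 / 2 + (norm z)\<^sup>2 / 2 + (norm u)\<^sup>2 / 2)" by simp
      show ?thesis by (simp only: h_def norm_mult E exp_add mult.assoc)
    qed
    have hp: "norm (h u) powr p = W (z + u) * exp (p * (norm z)\<^sup>2 / 2) * exp (p * (norm u)\<^sup>2 / 2)" for u
      by (simp add: nh W_def powr_mult exp_powr_real mult_ac)
    have "ennreal (exp (p * (norm z)\<^sup>2 / 2)) * ennreal (W z) = ennreal (norm (h 0) powr p)"
      by (subst ennreal_mult[symmetric]) (auto simp: hp W_def mult.commute)
    also have "\<dots> \<le> ennreal C * (\<integral>\<^sup>+u. ennreal (norm (h u) powr p) * indicator (ball 0 1) u \<partial>lborel)"
      by (rule C(2)[OF he])
    also have "\<dots> \<le> ennreal C * (\<integral>\<^sup>+u. ennreal (exp (p * (norm z)\<^sup>2 / 2) * exp (p / 2)) * (ennreal (W (z + u)) * indicator (ball z 1) (z + u)) \<partial>lborel)"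
    proof (intro mult_left_mono nn_integral_mono)
      fix u :: "complex ^ 'n"
      show "ennreal (norm (h u) powr p) * indicator (ball 0 1) u \<le>
        ennreal (exp (p * (norm z)\<^sup>2 / 2) * exp (p / 2)) * (ennreal (W (z + u)) * indicator (ball z 1) (z + u))"
      proof (cases "norm u < 1")
        case True
        then have "p * (norm u)\<^sup>2 \<le> p * 1" using p by (intro mult_left_mono) (auto simp: power_le_one)
        then have "norm (h u) powr p \<le> W (z + u) * exp (p * (norm z)\<^sup>2 / 2) * exp (p / 2)"
          unfolding hp by (intro mult_left_mono) (auto simp: W_def)
        then have "ennreal (norm (h u) powr p) \<le> ennreal (exp (p * (norm z)\<^sup>2 / 2) * exp (p / 2)) * ennreal (W (z + u))"
          by (subst ennreal_mult[symmetric]) (auto simp: W_def mult_ac intro!: ennreal_leI)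
        then show ?thesis using True by (simp add: dist_norm)
      qed simp
    qed auto
    also have "\<dots> = ennreal C * (ennreal (exp (p * (norm z)\<^sup>2 / 2) * exp (p / 2)) *
       (\<integral>\<^sup>+u. ennreal (W (z + u)) * indicator (ball z 1) (z + u) \<partial>lborel))"
      unfolding W_def by (subst nn_integral_cmult) auto
    also have "(\<integral>\<^sup>+u. ennreal (W (z + u)) * indicator (ball z 1) (z + u) \<partial>lborel) =
      (\<integral>\<^sup>+u. ennreal (W u) * indicator (ball z 1) u \<partial>lborel)"
      unfolding W_def
      by (rule nn_integral_lborel_translate[of "\<lambda>u. ennreal ((norm (f u) * exp (- (norm u)\<^sup>2 / 2)) powr p) * indicator (ball z 1) u"]) measurable
    also have "ennreal C * (ennreal (exp (p * (norm z)\<^sup>2 / 2) * exp (p / 2)) * (\<integral>\<^sup>+u. ennreal (W u) * indicator (ball z 1) u \<partial>lborel)) =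
      ennreal (exp (p * (norm z)\<^sup>2 / 2)) * (ennreal (C * exp (p / 2)) * (\<integral>\<^sup>+u. ennreal (W u) * indicator (ball z 1) u \<partial>lborel))"
      using C by (simp add: ennreal_mult mult_ac)
    finally show "ennreal ((norm (f z) * exp (- (norm z)\<^sup>2 / 2)) powr p) \<le> ennreal (C * exp (p / 2)) *
      (\<integral>\<^sup>+u. ennreal ((norm (f u) * exp (- (norm u)\<^sup>2 / 2)) powr p) * indicator (ball z 1) u \<partial>lborel)"
      unfolding W_def by (subst (asm) ennreal_mult_le_mult_iff) auto
  qed
qed

subsection \<open>Boundedness\<close>

text \<open>The condition on \<open>x\<close> is that of the Beta factor, which carries the cutoff;
  the condition on \<open>y\<close> keeps \<open>Gamma (y + real k)\<close> off its poles, so that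
  the Pochhammer factor is a Gamma ratio.\<close>

lemma gamma_ratio_multiplier:
  fixes x y :: real and k\<^sub>0 :: nat
  assumes x: "x + real k\<^sub>0 \<ge> 1" and y: "y + real k\<^sub>0 > 0"
  defines "c \<equiv> \<lambda>k. if k\<^sub>0 \<le> k then Gamma (x + real k) / Gamma (y + real k) else 0"
  shows "fock_order (x - y) (slice_mult c :: (complex ^ 'n \<Rightarrow> complex) \<Rightarrow> _)" "geo_bounded c"
proof -
  \<comment> \<open>Any natural number above \<open>x - y\<close> would do; \<open>nat\<close> also
    covers a negative difference. Then \<open>y + m = x + \<sigma>\<close>, and the Gamma value
    there cancels between the two factors.\<close>
  define m where "m = nat \<lfloor>x - y\<rfloor> + 1"
  define \<sigma> where "\<sigma> = real m - (x - y)"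
  have \<sigma>: "\<sigma> > 0" unfolding \<sigma>_def m_def by linarith
  define b where "b k = (if k\<^sub>0 \<le> k then Gamma (x + real k) / Gamma (x + real k + \<sigma>) else 0)" for k
  have eq: "c = (\<lambda>k. pochhammer (y + real k) m * b k)"
  proof
    fix k
    show "c k = pochhammer (y + real k) m * b k"
    proof (cases "k\<^sub>0 \<le> k")
      case True
      then have yk: "y + real k > 0" using y by linarith
      then have "y + real k \<notin> \<int>\<^sub>\<le>\<^sub>0" by (auto elim!: nonpos_Ints_cases)
      then have "pochhammer (y + real k) m = Gamma (y + real k + real m) / Gamma (y + real k)"
        by (rule pochhammer_Gamma)
      moreover have "y + real k + real m = x + real k + \<sigma>" by (simp add: \<sigma>_def)
      moreover have "Gamma (x + real k + \<sigma>) > 0"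
        using x True \<sigma> by (intro Gamma_real_pos) linarith
      ultimately show ?thesis using True by (simp add: c_def b_def)
    qed (simp add: c_def b_def)
  qed
  have gb: "geo_bounded b" unfolding b_def[abs_def] by (rule beta_multiplier_geo_bounded[OF \<sigma> x])
  have fb: "fock_order (- \<sigma>) (slice_mult b :: (complex ^ 'n \<Rightarrow> complex) \<Rightarrow> _)"
    unfolding b_def[abs_def] by (rule fock_order_beta[OF \<sigma> x])
  have "fock_order (real m + (- \<sigma>)) (slice_mult c :: (complex ^ 'n \<Rightarrow> complex) \<Rightarrow> _)"
    unfolding eq by (rule fock_order_slice_mult_compose[OF conjunct1[OF pochhammer_multiplier] fb gb])
  then show "fock_order (x - y) (slice_mult c :: (complex ^ 'n \<Rightarrow> complex) \<Rightarrow> _)"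
    by (simp add: \<sigma>_def)
  show "geo_bounded c"
    unfolding eq by (rule geo_bounded_mult[OF conjunct2[OF pochhammer_multiplier] gb])
qed

section \<open>An integrable exponential and the averaged majorant\<close>

lemma nn_integral_exp_neg_abs: "(\<integral>\<^sup>+x. ennreal (exp (- \<bar>x\<bar>)) \<partial>lborel) < (\<top> :: ennreal)"
proof -
  let ?f = "\<lambda>x. ennreal (exp (- x)) * indicator {0..} x"
  have f: "(\<integral>\<^sup>+x. ?f x \<partial>lborel) = 1"
    using nn_intergal_power_times_exp_Ici[of 0] by simp
  have "(\<integral>\<^sup>+x. ?f x \<partial>lborel) = ennreal \<bar>- 1\<bar> * (\<integral>\<^sup>+x. ?f (0 + (- 1) * x) \<partial>lborel)"
    by (rule nn_integral_real_affine) auto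
  then have f': "(\<integral>\<^sup>+x. ?f (- x) \<partial>lborel) = 1" unfolding f by simp
  have "(\<integral>\<^sup>+x. ennreal (exp (- \<bar>x\<bar>)) \<partial>lborel) \<le> (\<integral>\<^sup>+x. ?f x + ?f (- x) \<partial>lborel)"
    by (rule nn_integral_mono) (auto simp: indicator_def)
  also have "\<dots> = (\<integral>\<^sup>+x. ?f x \<partial>lborel) + (\<integral>\<^sup>+x. ?f (- x) \<partial>lborel)"
    by (rule nn_integral_add) measurable
  also have "\<dots> < \<top>" unfolding f f' by (simp add: ennreal_add_less_top)
  finally show ?thesis .
qed

text \<open>Each coordinate is at most the norm, so \<open>DIM('a)\<close> times the norm dominates
  the sum of the absolute coordinates, and the integral splits into one-dimensional ones.\<close>

lemma nn_integral_exp_neg_norm: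
  "(\<integral>\<^sup>+z. ennreal (exp (- (real DIM('a) * norm (z :: 'a::euclidean_space)))) \<partial>lborel) < \<top>"
proof -
  have "(\<integral>\<^sup>+z. ennreal (exp (- (real DIM('a) * norm (z :: 'a)))) \<partial>lborel) \<le>
    (\<integral>\<^sup>+z. (\<Prod>b\<in>Basis. ennreal (exp (- \<bar>(z :: 'a) \<bullet> b\<bar>))) \<partial>lborel)"
  proof (rule nn_integral_mono)
    fix z :: 'a
    have "(\<Sum>b\<in>Basis. \<bar>z \<bullet> b\<bar>) \<le> (\<Sum>b\<in>(Basis :: 'a set). norm z)"
      by (intro sum_mono Basis_le_norm)
    then have "exp (- (real DIM('a) * norm z)) \<le> (\<Prod>b\<in>Basis. exp (- \<bar>z \<bullet> b\<bar>))"
      by (simp flip: exp_sum add: sum_negf)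
    then show "ennreal (exp (- (real DIM('a) * norm z))) \<le> (\<Prod>b\<in>Basis. ennreal (exp (- \<bar>z \<bullet> b\<bar>)))"
      by (simp add: prod_ennreal ennreal_leI)
  qed
  also have "\<dots> = (\<Prod>b\<in>(Basis :: 'a set). \<integral>\<^sup>+x. ennreal (exp (- \<bar>x\<bar>)) \<partial>lborel)"
    by (rule nn_integral_lborel_prod) auto
  also have "\<dots> < \<top>"
    using nn_integral_exp_neg_abs by (simp add: power_less_top_ennreal)
  finally show ?thesis .
qed

lemma entire_norm_gauss_measurable:
  assumes "entire f"
  shows "(\<lambda>z. (norm (f z) * exp (- (norm z)\<^sup>2 / 2)) powr p) \<in> borel_measurable borel"
proof -
  have [measurable]: "f \<in> borel_measurable borel"
    by (intro borel_measurable_continuous_onI entire_continuous assms)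
  show ?thesis by measurable
qed

lemma fock_moderate_majorant:
  fixes \<alpha> p :: real
  assumes p: "p > 0"
  obtains L D where "L \<ge> 0" "D \<ge> 0"
    "\<And>f :: complex ^ 'n \<Rightarrow> complex. entire f \<Longrightarrow>
      (\<integral>\<^sup>+z. ennreal ((norm (f z) * exp (- (norm z)\<^sup>2 / 2)) powr p * (1 + norm z) powr (- \<alpha>)) \<partial>lborel) < \<top> \<Longrightarrow>
      \<exists>\<omega>\<in>borel_measurable borel. moderate L \<omega> \<and> (\<forall>z. norm (f z) \<le> \<omega> z * exp ((norm z)\<^sup>2 / 2)) \<and>
        (\<integral>\<^sup>+z. ennreal (\<omega> z powr p * (1 + norm z) powr (- \<alpha>)) \<partial>lborel) \<le>
        ennreal D * (\<integral>\<^sup>+z. ennreal ((norm (f z) * exp (- (norm z)\<^sup>2 / 2)) powr p * (1 + norm z) powr (- \<alpha>)) \<partial>lborel)"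
proof -
  obtain C where C: "C > 0" "\<And>(f :: complex ^ 'n \<Rightarrow> complex) z. entire f \<Longrightarrow>
    ennreal ((norm (f z) * exp (- (norm z)\<^sup>2 / 2)) powr p) \<le>
    ennreal C * (\<integral>\<^sup>+u. ennreal ((norm (f u) * exp (- (norm u)\<^sup>2 / 2)) powr p) * indicator (ball z 1) u \<partial>lborel)"
    by (rule gaussian_submean[OF p, where 'n = 'n]) blast
  define N where "N = real DIM(complex ^ 'n)"
  \<comment> \<open>Decay rate of the averaging kernel: \<open>\<bar>\<alpha>\<bar>\<close> pays for
    moving the weight \<open>(1 + norm z) powr (- \<alpha>)\<close> between \<open>u\<close> and
    \<open>z\<close>, and \<open>N\<close> leaves an integrable exponential.\<close>
  define K where "K = N + \<bar>\<alpha>\<bar>"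
  have K: "K \<ge> \<bar>\<alpha>\<bar>" "K \<ge> 0" by (auto simp: K_def N_def)
  define I where "I = (\<integral>\<^sup>+z. ennreal (exp (- (N * norm (z :: complex ^ 'n)))) \<partial>lborel)"
  have "I < \<top>" unfolding I_def N_def by (rule nn_integral_exp_neg_norm)
  then obtain J where J: "I = ennreal J" "J \<ge> 0" by (cases I) auto
  have weight: "exp (- (\<bar>\<alpha>\<bar> * norm (u - z))) * (1 + norm z) powr (- \<alpha>) \<le> (1 + norm u) powr (- \<alpha>)" for u z :: "complex ^ 'n"
  proof -
    have "(1 + norm z) powr (- \<alpha>) \<le> (1 + norm u) powr (- \<alpha>) * exp (\<bar>\<alpha>\<bar> * norm (u - z))"
      using one_plus_norm_powr_le[of z "- \<alpha>" u] by (simp add: norm_minus_commute)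
    then have "exp (- (\<bar>\<alpha>\<bar> * norm (u - z))) * (1 + norm z) powr (- \<alpha>) \<le>
      exp (- (\<bar>\<alpha>\<bar> * norm (u - z))) * ((1 + norm u) powr (- \<alpha>) * exp (\<bar>\<alpha>\<bar> * norm (u - z)))"
      by (intro mult_left_mono) auto
    then show ?thesis by (simp add: exp_minus field_simps)
  qed
  \<comment> \<open>On the unit ball around \<open>z\<close> the kernel is at least
    \<open>exp (- K)\<close>.\<close>
  define A where "A = C * exp K"
  have A: "A > 0" using C by (simp add: A_def)
  show ?thesis
  \<comment> \<open>The slope \<open>K\<close> belongs to the average of the \<open>p\<close>-th
    powers; taking the \<open>p\<close>-th root divides it by \<open>p\<close>.\<close>
  proof (rule that[of "K / p" "A * J"])
    show "K / p \<ge> 0" "A * J \<ge> 0" using K p A J by auto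
    fix f :: "complex ^ 'n \<Rightarrow> complex"
    define W where "W u = (norm (f u) * exp (- (norm u)\<^sup>2 / 2)) powr p" for u
    define M where "M = (\<integral>\<^sup>+z. ennreal (W z * (1 + norm z) powr (- \<alpha>)) \<partial>lborel)"
    assume f: "entire f" and "(\<integral>\<^sup>+z. ennreal ((norm (f z) * exp (- (norm z)\<^sup>2 / 2)) powr p * (1 + norm z) powr (- \<alpha>)) \<partial>lborel) < \<top>"
    then have M: "M < \<top>" by (simp add: M_def W_def)
    have [measurable]: "W \<in> borel_measurable borel"
      unfolding W_def[abs_def] by (rule entire_norm_gauss_measurable[OF f])
    have W0: "W u \<ge> 0" for u by (simp add: W_def)
    define \<rho> where "\<rho> z = (\<integral>\<^sup>+u. ennreal (W u * exp (- (K * norm (u - z)))) \<partial>lborel)" for z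
    have [measurable]: "\<rho> \<in> borel_measurable borel" unfolding \<rho>_def[abs_def] by measurable
    have fin: "\<rho> z < \<top>" for z
    proof -
      have "\<rho> z \<le> (\<integral>\<^sup>+u. ennreal ((1 + norm z) powr \<alpha>) * ennreal (W u * (1 + norm u) powr (- \<alpha>)) \<partial>lborel)"
        unfolding \<rho>_def
      proof (rule nn_integral_mono)
        fix u
        have "exp (- (K * norm (u - z))) \<le> exp (- (\<bar>\<alpha>\<bar> * norm (u - z)))"
          using K by (simp add: mult_right_mono)
        also have "\<dots> = exp (- (\<bar>\<alpha>\<bar> * norm (u - z))) * (1 + norm z) powr (- \<alpha>) * (1 + norm z) powr \<alpha>"
        proof -
          have "1 + norm z > 0" by (rule add_pos_nonneg) auto
          then have "(1 + norm z) powr (- \<alpha>) * (1 + norm z) powr \<alpha> = 1" by (simp flip: powr_add)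
          then show ?thesis by (simp add: mult.assoc)
        qed
        also have "\<dots> \<le> (1 + norm u) powr (- \<alpha>) * (1 + norm z) powr \<alpha>"
          by (intro mult_right_mono weight) auto
        finally have "W u * exp (- (K * norm (u - z))) \<le> W u * ((1 + norm u) powr (- \<alpha>) * (1 + norm z) powr \<alpha>)"
          using W0 by (intro mult_left_mono) auto
        then show "ennreal (W u * exp (- (K * norm (u - z)))) \<le> ennreal ((1 + norm z) powr \<alpha>) * ennreal (W u * (1 + norm u) powr (- \<alpha>))"
          using W0 by (subst ennreal_mult[symmetric]) (auto intro!: ennreal_leI simp: mult_ac)
      qed
      also have "\<dots> = ennreal ((1 + norm z) powr \<alpha>) * M"
        unfolding M_def by (rule nn_integral_cmult) measurable
      also have "\<dots> < \<top>" using M by (simp add: ennreal_mult_less_top)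
      finally show ?thesis .
    qed
    \<comment> \<open>Lossless, as \<open>\<rho>\<close> is finite everywhere; this is where the
      finite weighted integral of \<open>f\<close> enters.\<close>
    define \<eta> where "\<eta> z = enn2real (\<rho> z)" for z
    have \<eta>: "\<eta> z \<ge> 0" "\<rho> z = ennreal (\<eta> z)" for z using fin[of z] by (auto simp: \<eta>_def)
    have \<eta>_mod: "\<eta> x \<le> \<eta> y * exp (K * norm (x - y))" for x y
    proof -
      have "\<rho> x \<le> (\<integral>\<^sup>+u. ennreal (exp (K * norm (x - y))) * ennreal (W u * exp (- (K * norm (u - y)))) \<partial>lborel)"
        unfolding \<rho>_def
      proof (rule nn_integral_mono)
        fix u
        have "norm (u - y) \<le> norm (u - x) + norm (x - y)"
          using norm_triangle_ineq[of "u - x" "x - y"] by simp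
        then have "K * norm (u - y) \<le> K * (norm (u - x) + norm (x - y))" using K by (intro mult_left_mono) auto
        then have "exp (- (K * norm (u - x))) \<le> exp (K * norm (x - y)) * exp (- (K * norm (u - y)))"
          by (simp add: distrib_left flip: exp_add)
        then have "W u * exp (- (K * norm (u - x))) \<le> W u * (exp (K * norm (x - y)) * exp (- (K * norm (u - y))))"
          using W0 by (intro mult_left_mono) auto
        then show "ennreal (W u * exp (- (K * norm (u - x)))) \<le> ennreal (exp (K * norm (x - y))) * ennreal (W u * exp (- (K * norm (u - y))))"
          using W0 by (subst ennreal_mult[symmetric]) (auto intro!: ennreal_leI simp: mult_ac)
      qed
      also have "\<dots> = ennreal (exp (K * norm (x - y))) * \<rho> y"
        unfolding \<rho>_def by (rule nn_integral_cmult) measurable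
      also have "\<dots> = ennreal (\<eta> y * exp (K * norm (x - y)))"
        using \<eta>[of y] by (simp add: mult.commute flip: ennreal_mult)
      finally show ?thesis using \<eta>[of y] by (simp add: \<eta>(2)[of x] ennreal_le_iff)
    qed
    have dom: "W z \<le> A * \<eta> z" for z
    proof -
      have "ennreal (W z) \<le> ennreal C * (\<integral>\<^sup>+u. ennreal (W u) * indicator (ball z 1) u \<partial>lborel)"
        unfolding W_def by (rule C(2)[OF f])
      also have "\<dots> \<le> ennreal C * (\<integral>\<^sup>+u. ennreal (exp K) * ennreal (W u * exp (- (K * norm (u - z)))) \<partial>lborel)"
      proof (intro mult_left_mono nn_integral_mono)
        fix u
        show "ennreal (W u) * indicator (ball z 1) u \<le> ennreal (exp K) * ennreal (W u * exp (- (K * norm (u - z))))"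
        proof (cases "u \<in> ball z 1")
          case True
          then have "K * norm (u - z) \<le> K * 1"
            using K by (intro mult_left_mono) (auto simp: dist_norm norm_minus_commute)
          then have "1 \<le> exp K * exp (- (K * norm (u - z)))" by (simp flip: exp_add)
          then have "W u * 1 \<le> W u * (exp K * exp (- (K * norm (u - z))))" using W0 by (intro mult_left_mono) auto
          then show ?thesis using True W0
            by (subst ennreal_mult[symmetric]) (auto intro!: ennreal_leI simp: mult_ac)
        qed simp
      qed auto
      also have "(\<integral>\<^sup>+u. ennreal (exp K) * ennreal (W u * exp (- (K * norm (u - z)))) \<partial>lborel) = ennreal (exp K) * \<rho> z"
        unfolding \<rho>_def by (rule nn_integral_cmult) measurable
      also have "ennreal C * (ennreal (exp K) * \<rho> z) = ennreal (A * \<eta> z)"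
        using C \<eta>[of z] by (simp add: A_def mult.assoc flip: ennreal_mult)
      finally show ?thesis using A \<eta>[of z] by (simp add: ennreal_le_iff)
    qed
    define \<omega> where "\<omega> z = (A * \<eta> z) powr (1 / p)" for z
    have "moderate (K / p) \<omega>"
      unfolding moderate_def
    proof (intro conjI allI)
      fix x y
      have "A * \<eta> x \<le> (A * \<eta> y) * exp (K * norm (x - y))"
        using \<eta>_mod[of x y] A by (simp add: mult.assoc)
      then have "\<omega> x \<le> ((A * \<eta> y) * exp (K * norm (x - y))) powr (1 / p)"
        unfolding \<omega>_def using p A \<eta> by (intro powr_mono2) auto
      also have "\<dots> = \<omega> y * exp (K / p * norm (x - y))"
        using A \<eta> by (simp add: \<omega>_def powr_mult exp_powr_real)
      finally show "\<omega> x \<le> \<omega> y * exp (K / p * norm (x - y))" .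
    qed (simp add: \<omega>_def)
    moreover have "norm (f z) \<le> \<omega> z * exp ((norm z)\<^sup>2 / 2)" for z
    proof -
      have "norm (f z) * exp (- (norm z)\<^sup>2 / 2) = W z powr (1 / p)"
        using p by (simp add: W_def powr_powr)
      also have "\<dots> \<le> \<omega> z" unfolding \<omega>_def using p W0 dom by (intro powr_mono2) auto
      finally have "norm (f z) * exp (- (norm z)\<^sup>2 / 2) * exp ((norm z)\<^sup>2 / 2) \<le> \<omega> z * exp ((norm z)\<^sup>2 / 2)"
        by (intro mult_right_mono) auto
      then show ?thesis by (simp add: mult.assoc flip: exp_add)
    qed
    moreover have "(\<integral>\<^sup>+z. ennreal (\<omega> z powr p * (1 + norm z) powr (- \<alpha>)) \<partial>lborel) \<le> ennreal (A * J) * M"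
    proof -
      have "ennreal (\<omega> z powr p * (1 + norm z) powr (- \<alpha>)) = ennreal A * (\<integral>\<^sup>+u. ennreal (W u * exp (- (K * norm (u - z))) * (1 + norm z) powr (- \<alpha>)) \<partial>lborel)" for z
      proof -
        have "\<omega> z powr p = A * \<eta> z" using p A \<eta>[of z] by (simp add: \<omega>_def powr_powr)
        then have "ennreal (\<omega> z powr p * (1 + norm z) powr (- \<alpha>)) = ennreal A * (\<rho> z * ennreal ((1 + norm z) powr (- \<alpha>)))"
          using A \<eta>[of z] by (simp add: mult.assoc ennreal_mult)
        also have "\<rho> z * ennreal ((1 + norm z) powr (- \<alpha>)) = (\<integral>\<^sup>+u. ennreal (W u * exp (- (K * norm (u - z)))) * ennreal ((1 + norm z) powr (- \<alpha>)) \<partial>lborel)"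
          unfolding \<rho>_def by (rule nn_integral_multc[symmetric]) measurable
        finally show ?thesis using W0 by (simp add: ennreal_mult)
      qed
      then have "(\<integral>\<^sup>+z. ennreal (\<omega> z powr p * (1 + norm z) powr (- \<alpha>)) \<partial>lborel) =
        (\<integral>\<^sup>+z. ennreal A * (\<integral>\<^sup>+u. ennreal (W u * exp (- (K * norm (u - z))) * (1 + norm z) powr (- \<alpha>)) \<partial>lborel) \<partial>lborel)"
        by simp
      also have "\<dots> = ennreal A * (\<integral>\<^sup>+z. (\<integral>\<^sup>+u. ennreal (W u * exp (- (K * norm (u - z))) * (1 + norm z) powr (- \<alpha>)) \<partial>lborel) \<partial>lborel)"
        by (rule nn_integral_cmult) measurable
      finally have 1: "(\<integral>\<^sup>+z. ennreal (\<omega> z powr p * (1 + norm z) powr (- \<alpha>)) \<partial>lborel) =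
        ennreal A * (\<integral>\<^sup>+z. (\<integral>\<^sup>+u. ennreal (W u * exp (- (K * norm (u - z))) * (1 + norm z) powr (- \<alpha>)) \<partial>lborel) \<partial>lborel)" .
      have "(\<integral>\<^sup>+z. (\<integral>\<^sup>+u. ennreal (W u * exp (- (K * norm (u - z))) * (1 + norm z) powr (- \<alpha>)) \<partial>lborel) \<partial>lborel) =
        (\<integral>\<^sup>+u. (\<integral>\<^sup>+z. ennreal (W u * exp (- (K * norm (u - z))) * (1 + norm z) powr (- \<alpha>)) \<partial>lborel) \<partial>lborel)"
        by (rule lborel_pair.Fubini') measurable
      \<comment> \<open>With \<open>z\<close> innermost the weight is carried from \<open>z\<close>
        to \<open>u\<close>, and what remains of the kernel has total mass \<open>I\<close>,
        independent of \<open>u\<close>.\<close>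
      also have "\<dots> \<le> (\<integral>\<^sup>+u. ennreal (W u * (1 + norm u) powr (- \<alpha>)) * I \<partial>lborel)"
      proof (rule nn_integral_mono)
        fix u
        have "(\<integral>\<^sup>+z. ennreal (W u * exp (- (K * norm (u - z))) * (1 + norm z) powr (- \<alpha>)) \<partial>lborel) \<le>
          (\<integral>\<^sup>+z. ennreal (W u * (1 + norm u) powr (- \<alpha>)) * ennreal (exp (- (N * norm (- u + z)))) \<partial>lborel)"
        proof (rule nn_integral_mono)
          fix z
          have "exp (- (K * norm (u - z))) * (1 + norm z) powr (- \<alpha>) =
            exp (- (N * norm (u - z))) * (exp (- (\<bar>\<alpha>\<bar> * norm (u - z))) * (1 + norm z) powr (- \<alpha>))"
            by (simp add: K_def distrib_right exp_add exp_diff exp_minus field_simps)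
          also have "\<dots> \<le> exp (- (N * norm (u - z))) * (1 + norm u) powr (- \<alpha>)"
            by (intro mult_left_mono weight) auto
          finally have "W u * (exp (- (K * norm (u - z))) * (1 + norm z) powr (- \<alpha>)) \<le> W u * (exp (- (N * norm (u - z))) * (1 + norm u) powr (- \<alpha>))"
            using W0 by (intro mult_left_mono) auto
          moreover have "norm (u - z) = norm (- u + z)" by (simp add: norm_minus_commute)
          ultimately show "ennreal (W u * exp (- (K * norm (u - z))) * (1 + norm z) powr (- \<alpha>)) \<le>
            ennreal (W u * (1 + norm u) powr (- \<alpha>)) * ennreal (exp (- (N * norm (- u + z))))"
            using W0 by (subst ennreal_mult[symmetric]) (auto intro!: ennreal_leI simp: mult_ac)
        qed
        also have "\<dots> = ennreal (W u * (1 + norm u) powr (- \<alpha>)) * (\<integral>\<^sup>+z. ennreal (exp (- (N * norm (- u + z)))) \<partial>lborel)"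
          by (rule nn_integral_cmult) measurable
        also have "(\<integral>\<^sup>+z. ennreal (exp (- (N * norm (- u + z)))) \<partial>lborel) = I"
          unfolding I_def by (rule nn_integral_lborel_translate) measurable
        finally show "(\<integral>\<^sup>+z. ennreal (W u * exp (- (K * norm (u - z))) * (1 + norm z) powr (- \<alpha>)) \<partial>lborel) \<le>
          ennreal (W u * (1 + norm u) powr (- \<alpha>)) * I" .
      qed
      also have "\<dots> = M * I"
        unfolding M_def by (rule nn_integral_multc) measurable
      finally have "ennreal A * (\<integral>\<^sup>+z. (\<integral>\<^sup>+u. ennreal (W u * exp (- (K * norm (u - z))) * (1 + norm z) powr (- \<alpha>)) \<partial>lborel) \<partial>lborel) \<le>
        ennreal A * (M * I)"
        by (rule mult_left_mono) simp
      also have "\<dots> = ennreal (A * J) * M" using A J by (simp add: J(1) ennreal_mult mult_ac)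
      finally show ?thesis unfolding 1 .
    qed
    moreover have "\<omega> \<in> borel_measurable borel"
      unfolding \<omega>_def[abs_def] \<eta>_def[abs_def] by measurable
    ultimately show "\<exists>\<omega>\<in>borel_measurable borel. moderate (K / p) \<omega> \<and> (\<forall>z. norm (f z) \<le> \<omega> z * exp ((norm z)\<^sup>2 / 2)) \<and>
        (\<integral>\<^sup>+z. ennreal (\<omega> z powr p * (1 + norm z) powr (- \<alpha>)) \<partial>lborel) \<le>
        ennreal (A * J) * (\<integral>\<^sup>+z. ennreal ((norm (f z) * exp (- (norm z)\<^sup>2 / 2)) powr p * (1 + norm z) powr (- \<alpha>)) \<partial>lborel)"
      unfolding M_def W_def by blast
  qed
qed

text \<open>The \<open>p\<close>-th power of \<open>(1 + norm z) powr (2 * s)\<close> is cancelled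
  exactly by the change of the weight exponent from \<open>\<alpha>\<close> to
  \<open>\<alpha> + 2 * s * p\<close>. The majorant depends on \<open>f\<close>, but its slope
  \<open>L\<close> and the constants do not.\<close>

lemma fock_order_Lp_bound:
  fixes \<alpha> p s :: real and T :: "(complex ^ 'n \<Rightarrow> complex) \<Rightarrow> complex ^ 'n \<Rightarrow> complex"
  assumes p: "p > 0" and T: "fock_order s T"
  obtains D where "D \<ge> 0"
    "\<And>f. entire f \<Longrightarrow>
      (\<integral>\<^sup>+z. ennreal ((norm (f z) * exp (- (norm z)\<^sup>2 / 2)) powr p * (1 + norm z) powr (- \<alpha>)) \<partial>lborel) < \<top> \<Longrightarrow>
      (\<integral>\<^sup>+z. ennreal ((norm (T f z) * exp (- (norm z)\<^sup>2 / 2)) powr p * (1 + norm z) powr (- (\<alpha> + 2 * s * p))) \<partial>lborel) \<le>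
        ennreal D * (\<integral>\<^sup>+z. ennreal ((norm (f z) * exp (- (norm z)\<^sup>2 / 2)) powr p * (1 + norm z) powr (- \<alpha>)) \<partial>lborel)"
proof -
  obtain L D where LD: "L \<ge> 0" "D \<ge> 0" and maj: 
    "\<And>f :: complex ^ 'n \<Rightarrow> complex. entire f \<Longrightarrow>
      (\<integral>\<^sup>+z. ennreal ((norm (f z) * exp (- (norm z)\<^sup>2 / 2)) powr p * (1 + norm z) powr (- \<alpha>)) \<partial>lborel) < \<top> \<Longrightarrow>
      \<exists>\<omega>\<in>borel_measurable borel. moderate L \<omega> \<and> (\<forall>z. norm (f z) \<le> \<omega> z * exp ((norm z)\<^sup>2 / 2)) \<and>
        (\<integral>\<^sup>+z. ennreal (\<omega> z powr p * (1 + norm z) powr (- \<alpha>)) \<partial>lborel) \<le>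
        ennreal D * (\<integral>\<^sup>+z. ennreal ((norm (f z) * exp (- (norm z)\<^sup>2 / 2)) powr p * (1 + norm z) powr (- \<alpha>)) \<partial>lborel)"
    by (rule fock_moderate_majorant[OF p, where 'n = 'n, of \<alpha>]) blast
  obtain C where C: "C \<ge> 0" "\<And>\<omega> f z. moderate L \<omega> \<Longrightarrow> entire f \<Longrightarrow>
     (\<And>z. norm (f z) \<le> \<omega> z * exp ((norm z)\<^sup>2 / 2)) \<Longrightarrow>
     norm (T f z) \<le> C * \<omega> z * (1 + norm z) powr (2 * s) * exp ((norm z)\<^sup>2 / 2)"
    using fock_orderE[OF T LD(1)] by blast
  show ?thesis
  proof (rule that[of "C powr p * D"])
    show "C powr p * D \<ge> 0" using LD by simp
    fix f :: "complex ^ 'n \<Rightarrow> complex"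
    let ?M = "\<integral>\<^sup>+z. ennreal ((norm (f z) * exp (- (norm z)\<^sup>2 / 2)) powr p * (1 + norm z) powr (- \<alpha>)) \<partial>lborel"
    assume f: "entire f" and M: "?M < \<top>"
    from maj[OF this] obtain \<omega> where [measurable]: "\<omega> \<in> borel_measurable borel" and w: "moderate L \<omega>" "\<And>z. norm (f z) \<le> \<omega> z * exp ((norm z)\<^sup>2 / 2)"
      "(\<integral>\<^sup>+z. ennreal (\<omega> z powr p * (1 + norm z) powr (- \<alpha>)) \<partial>lborel) \<le> ennreal D * ?M" by blast
    have "(\<integral>\<^sup>+z. ennreal ((norm (T f z) * exp (- (norm z)\<^sup>2 / 2)) powr p * (1 + norm z) powr (- (\<alpha> + 2 * s * p))) \<partial>lborel)
      \<le> (\<integral>\<^sup>+z. ennreal (C powr p) * ennreal (\<omega> z powr p * (1 + norm z) powr (- \<alpha>)) \<partial>lborel)"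
    proof (rule nn_integral_mono)
      fix z :: "complex ^ 'n"
      have pos: "1 + norm z > 0" by (rule add_pos_nonneg) auto
      have "norm (T f z) * exp (- (norm z)\<^sup>2 / 2) \<le> (C * \<omega> z * (1 + norm z) powr (2 * s) * exp ((norm z)\<^sup>2 / 2)) * exp (- (norm z)\<^sup>2 / 2)"
        by (intro mult_right_mono C(2)[OF w(1) f w(2)]) auto
      also have "\<dots> = C * \<omega> z * (1 + norm z) powr (2 * s)" by (simp add: mult.assoc flip: exp_add)
      finally have "(norm (T f z) * exp (- (norm z)\<^sup>2 / 2)) powr p \<le> (C * \<omega> z * (1 + norm z) powr (2 * s)) powr p"
        using p by (intro powr_mono2) auto
      also have "\<dots> = C powr p * \<omega> z powr p * (1 + norm z) powr (2 * s * p)"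
        using C moderateD(1)[OF w(1)] by (simp add: powr_mult powr_powr)
      finally have "(norm (T f z) * exp (- (norm z)\<^sup>2 / 2)) powr p * (1 + norm z) powr (- (\<alpha> + 2 * s * p)) \<le>
        (C powr p * \<omega> z powr p * (1 + norm z) powr (2 * s * p)) * (1 + norm z) powr (- (\<alpha> + 2 * s * p))"
        by (intro mult_right_mono) auto
      also have "\<dots> = C powr p * (\<omega> z powr p * ((1 + norm z) powr (2 * s * p) * (1 + norm z) powr (- (\<alpha> + 2 * s * p))))"
        by (simp only: mult_ac)
      also have "(1 + norm z) powr (2 * s * p) * (1 + norm z) powr (- (\<alpha> + 2 * s * p)) = (1 + norm z) powr (- \<alpha>)"
        by (simp flip: powr_add)
      finally show "ennreal ((norm (T f z) * exp (- (norm z)\<^sup>2 / 2)) powr p * (1 + norm z) powr (- (\<alpha> + 2 * s * p))) \<le>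
        ennreal (C powr p) * ennreal (\<omega> z powr p * (1 + norm z) powr (- \<alpha>))"
        by (subst ennreal_mult[symmetric]) (auto intro!: ennreal_leI)
    qed
    also have "\<dots> = ennreal (C powr p) * (\<integral>\<^sup>+z. ennreal (\<omega> z powr p * (1 + norm z) powr (- \<alpha>)) \<partial>lborel)"
      by (rule nn_integral_cmult) measurable
    also have "\<dots> \<le> ennreal (C powr p) * (ennreal D * ?M)"
      by (intro mult_left_mono w) auto
    also have "\<dots> = ennreal (C powr p * D) * ?M"
      using LD by (simp add: ennreal_mult mult.assoc)
    finally show "(\<integral>\<^sup>+z. ennreal ((norm (T f z) * exp (- (norm z)\<^sup>2 / 2)) powr p * (1 + norm z) powr (- (\<alpha> + 2 * s * p))) \<partial>lborel)
      \<le> ennreal (C powr p * D) * ?M" .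
  qed
qed


section \<open>Transfer to the Fock norms\<close>

lemma nn_integral_gauss_vol_weighted:
  fixes g :: "complex ^ 'n \<Rightarrow> real"
  assumes [measurable]: "g \<in> borel_measurable borel" and "\<And>z. g z \<ge> 0"
  shows "(\<integral>\<^sup>+z. ennreal (g z) \<partial>gauss_vol_weighted \<alpha>) =
    inverse (\<integral>\<^sup>+z. ennreal (exp (- (norm (z :: complex ^ 'n))\<^sup>2)) \<partial>lborel) *
    (\<integral>\<^sup>+z. ennreal (g z * (1 + norm z) powr (- \<alpha>)) \<partial>lborel)"
  unfolding gauss_vol_weighted_def gauss_vol_def
  by (subst nn_integral_density, simp, simp, subst nn_integral_scale_measure, simp)
     (simp add: ennreal_mult assms mult.commute)

lemma sets_gauss_vol_weighted [measurable_cong]: "sets (gauss_vol_weighted \<alpha>) = sets borel"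
  by (simp add: gauss_vol_weighted_def gauss_vol_def)

lemma fock_order_bounded_operator:
  fixes \<alpha> p s :: real
  assumes p: "p > 0" and T: "fock_order s (slice_mult c :: (complex ^ 'n \<Rightarrow> complex) \<Rightarrow> _)" and c: "geo_bounded c"
  shows "bounded_operator (fock p \<alpha>) (fock_norm p \<alpha>) (fock p (\<alpha> + 2 * s * p)) (fock_norm p (\<alpha> + 2 * s * p))
    (slice_mult c :: (complex ^ 'n \<Rightarrow> complex) \<Rightarrow> _)"
proof -
  obtain D where D: "D \<ge> 0"
    "\<And>f :: complex ^ 'n \<Rightarrow> complex. entire f \<Longrightarrow>
      (\<integral>\<^sup>+z. ennreal ((norm (f z) * exp (- (norm z)\<^sup>2 / 2)) powr p * (1 + norm z) powr (- \<alpha>)) \<partial>lborel) < \<top> \<Longrightarrow>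
      (\<integral>\<^sup>+z. ennreal ((norm (slice_mult c f z) * exp (- (norm z)\<^sup>2 / 2)) powr p * (1 + norm z) powr (- (\<alpha> + 2 * s * p))) \<partial>lborel) \<le>
        ennreal D * (\<integral>\<^sup>+z. ennreal ((norm (f z) * exp (- (norm z)\<^sup>2 / 2)) powr p * (1 + norm z) powr (- \<alpha>)) \<partial>lborel)"
    by (rule fock_order_Lp_bound[OF p T, of \<alpha>]) blast
  define W where "W f z = (norm (f z) * exp (- (norm z)\<^sup>2 / 2)) powr p" for f :: "complex ^ 'n \<Rightarrow> complex" and z
  define \<kappa> where "\<kappa> = inverse (\<integral>\<^sup>+z. ennreal (exp (- (norm (z :: complex ^ 'n))\<^sup>2)) \<partial>lborel)"
  \<comment> \<open>As \<open>0 * \<top> = 0\<close> in \<open>ennreal\<close>, a nonzero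
    \<open>\<kappa>\<close> is needed to infer finiteness of the Lebesgue integral from that of
    \<open>I\<close>.\<close>
  have \<kappa>: "\<kappa> \<noteq> 0" unfolding \<kappa>_def nn_integral_gauss by (simp add: ennreal_inverse_eq_0_iff ennreal_power)
  define I where "I \<beta> f = (\<integral>\<^sup>+z. ennreal (W f z) \<partial>gauss_vol_weighted \<beta>)" for \<beta> and f :: "complex ^ 'n \<Rightarrow> complex"
  have W0: "W f z \<ge> 0" for f z by (simp add: W_def)
  have W: "W f \<in> borel_measurable borel" if "entire f" for f
    unfolding W_def[abs_def] by (rule entire_norm_gauss_measurable[OF that])
  have I: "I \<beta> f = \<kappa> * (\<integral>\<^sup>+z. ennreal (W f z * (1 + norm z) powr (- \<beta>)) \<partial>lborel)" if "entire f" for \<beta> f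
    unfolding I_def \<kappa>_def by (rule nn_integral_gauss_vol_weighted[OF W[OF that] W0])
  have F: "norm (f z * of_real (exp (- (norm z)\<^sup>2 / 2))) powr p = W f z" for f :: "complex ^ 'n \<Rightarrow> complex" and z
    by (simp add: W_def norm_mult)
  have fock: "f \<in> fock p \<beta> \<longleftrightarrow> entire f \<and> I \<beta> f < \<top>" for f :: "complex ^ 'n \<Rightarrow> complex" and \<beta>
  proof (cases "entire f")
    case True
    have [measurable]: "W f \<in> borel_measurable (gauss_vol_weighted \<beta>)"
      using W[OF True] by (simp cong: measurable_cong_sets add: sets_gauss_vol_weighted)
    show ?thesis using True unfolding fock_def mem_Collect_eq F
      by (simp add: integrable_iff_bounded I_def W0)
  qed (simp add: fock_def)
  have fnorm: "fock_norm p \<beta> f = enn2real (I \<beta> f) powr (1 / p)" if "entire f" for f :: "complex ^ 'n \<Rightarrow> complex" and \<beta>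
  proof -
    have [measurable]: "W f \<in> borel_measurable (gauss_vol_weighted \<beta>)"
      using W[OF that] by (simp cong: measurable_cong_sets add: sets_gauss_vol_weighted)
    have "(LINT z|gauss_vol_weighted \<beta>. W f z) = enn2real (I \<beta> f)"
      unfolding I_def by (rule integral_eq_nn_integral) (simp_all add: W0)
    then show ?thesis unfolding fock_norm_def F by simp
  qed
  have key: "I (\<alpha> + 2 * s * p) (slice_mult c f) \<le> ennreal D * I \<alpha> f" if f: "f \<in> fock p \<alpha>" for f
  proof -
    have e: "entire f" and fin: "I \<alpha> f < \<top>" using f fock by auto
    have "(\<integral>\<^sup>+z. ennreal (W f z * (1 + norm z) powr (- \<alpha>)) \<partial>lborel) < \<top>"
      using fin \<kappa> unfolding I[OF e] by (auto simp: ennreal_mult_less_top)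
    then have "\<kappa> * (\<integral>\<^sup>+z. ennreal (W (slice_mult c f) z * (1 + norm z) powr (- (\<alpha> + 2 * s * p))) \<partial>lborel) \<le>
      \<kappa> * (ennreal D * (\<integral>\<^sup>+z. ennreal (W f z * (1 + norm z) powr (- \<alpha>)) \<partial>lborel))"
      using D(2)[OF e] unfolding W_def by (intro mult_left_mono) auto
    then show ?thesis unfolding I[OF e] I[OF entire_slice_mult[OF e c]] by (simp only: mult_ac)
  qed
  show ?thesis
    unfolding bounded_operator_def
  proof (intro conjI ballI allI)
    show "slice_mult c ` fock p \<alpha> \<subseteq> (fock p (\<alpha> + 2 * s * p) :: (complex ^ 'n \<Rightarrow> complex) set)"
    proof (rule image_subsetI)
      fix f :: "complex ^ 'n \<Rightarrow> complex" assume f: "f \<in> fock p \<alpha>"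
      then have "ennreal D * I \<alpha> f < \<top>" unfolding fock by (simp add: ennreal_mult_less_top)
      with key[OF f] f c show "slice_mult c f \<in> fock p (\<alpha> + 2 * s * p)"
        unfolding fock by (auto intro: entire_slice_mult)
    qed
    obtain B q where q: "q > 0" "\<And>k. \<bar>c k\<bar> \<le> B * q ^ k" using c unfolding geo_bounded_def by blast
    fix f :: "complex ^ 'n \<Rightarrow> complex" assume "f \<in> fock p \<alpha>"
    then have f: "entire f" using fock by blast
    show "slice_mult c (\<lambda>z. a * f z) = (\<lambda>z. a * slice_mult c f z)" for a
      by (rule ext) (rule slice_mult_cmult[OF f q])
    fix g :: "complex ^ 'n \<Rightarrow> complex" assume "g \<in> fock p \<alpha>"
    then have g: "entire g" using fock by blast
    show "slice_mult c (\<lambda>z. f z + g z) = (\<lambda>z. slice_mult c f z + slice_mult c g z)"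
      by (rule ext) (rule slice_mult_add[OF f g q])
  next
    show "\<exists>C. \<forall>f :: complex ^ 'n \<Rightarrow> complex \<in> fock p \<alpha>. fock_norm p (\<alpha> + 2 * s * p) (slice_mult c f) \<le> C * fock_norm p \<alpha> f"
    proof (intro exI ballI)
      fix f :: "complex ^ 'n \<Rightarrow> complex" assume f: "f \<in> fock p \<alpha>"
      then have e: "entire f" and fin: "I \<alpha> f < \<top>" using fock by auto
      have "enn2real (I (\<alpha> + 2 * s * p) (slice_mult c f)) \<le> enn2real (ennreal D * I \<alpha> f)"
        using key[OF f] fin by (intro enn2real_mono) (auto simp: ennreal_mult_less_top)
      also have "\<dots> = D * enn2real (I \<alpha> f)" using D(1) by (simp add: enn2real_mult)
      finally have "enn2real (I (\<alpha> + 2 * s * p) (slice_mult c f)) powr (1 / p) \<le> (D * enn2real (I \<alpha> f)) powr (1 / p)"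
        using p by (intro powr_mono2) auto
      then show "fock_norm p (\<alpha> + 2 * s * p) (slice_mult c f) \<le> D powr (1 / p) * fock_norm p \<alpha> f"
        using D(1) by (simp add: fnorm e entire_slice_mult c powr_mult)
    qed
  qed
qed

lemma fock_order_bounded_operator_inf:
  fixes \<alpha> s :: real
  assumes T: "fock_order s (slice_mult c :: (complex ^ 'n \<Rightarrow> complex) \<Rightarrow> _)" and c: "geo_bounded c"
  shows "bounded_operator (fock_inf \<alpha>) (fock_inf_norm \<alpha>) (fock_inf (\<alpha> + 2 * s)) (fock_inf_norm (\<alpha> + 2 * s))
    (slice_mult c :: (complex ^ 'n \<Rightarrow> complex) \<Rightarrow> _)"
proof -
  obtain C where C: "C \<ge> 0" "\<And>\<omega> f z. moderate \<bar>\<alpha>\<bar> \<omega> \<Longrightarrow> entire (f :: complex ^ 'n \<Rightarrow> complex) \<Longrightarrow>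
     (\<And>z. norm (f z) \<le> \<omega> z * exp ((norm z)\<^sup>2 / 2)) \<Longrightarrow>
     norm (slice_mult c f z) \<le> C * \<omega> z * (1 + norm z) powr (2 * s) * exp ((norm z)\<^sup>2 / 2)"
    using fock_orderE[OF T, of "\<bar>\<alpha>\<bar>"] by auto
  have pos: "1 + norm z > 0" for z :: "complex ^ 'n" by (rule add_pos_nonneg) auto
  have key: "norm (slice_mult c f z) * exp (- (norm z)\<^sup>2 / 2) / (1 + norm z) powr (\<alpha> + 2 * s) \<le> C * fock_inf_norm \<alpha> f"
    if f: "f \<in> fock_inf \<alpha>" for f :: "complex ^ 'n \<Rightarrow> complex" and z
  proof -
    define A where "A = fock_inf_norm \<alpha> f"
    have e: "entire f" and bdd: "bdd_above (range (\<lambda>z. norm (f z) * exp (- (norm z)\<^sup>2 / 2) / (1 + norm z) powr \<alpha>))"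
      using f by (auto simp: fock_inf_def)
    have up: "norm (f z) * exp (- (norm z)\<^sup>2 / 2) / (1 + norm z) powr \<alpha> \<le> A" for z
      unfolding A_def fock_inf_norm_def by (rule cSUP_upper[OF UNIV_I bdd])
    have A: "A \<ge> 0" by (rule order_trans[OF _ up[of 0]]) simp
    \<comment> \<open>The constant weight 1 is moderate with slope 0. The factor \<open>A\<close> is
      the norm of \<open>f\<close>, so the resulting bound is linear in it.\<close>
    have "moderate (0 + \<bar>\<alpha>\<bar>) (\<lambda>z :: complex ^ 'n. A * 1 * (1 + norm z) powr \<alpha>)"
      by (rule moderate_one_plus_norm_powr[OF _ A]) (simp add: moderate_def)
    then have w: "moderate \<bar>\<alpha>\<bar> (\<lambda>z :: complex ^ 'n. A * (1 + norm z) powr \<alpha>)" by simp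
    have "norm (f z) \<le> A * (1 + norm z) powr \<alpha> * exp ((norm z)\<^sup>2 / 2)" for z
    proof -
      have "norm (f z) * exp (- (norm z)\<^sup>2 / 2) \<le> A * (1 + norm z) powr \<alpha>"
        using up[of z] pos[of z] by (simp add: pos_divide_le_eq)
      then have "norm (f z) * exp (- (norm z)\<^sup>2 / 2) * exp ((norm z)\<^sup>2 / 2) \<le> A * (1 + norm z) powr \<alpha> * exp ((norm z)\<^sup>2 / 2)"
        by (intro mult_right_mono) auto
      then show ?thesis by (simp add: mult.assoc flip: exp_add)
    qed
    from C(2)[OF w e this, of z]
    have "norm (slice_mult c f z) * exp (- (norm z)\<^sup>2 / 2) \<le>
      (C * (A * (1 + norm z) powr \<alpha>) * (1 + norm z) powr (2 * s) * exp ((norm z)\<^sup>2 / 2)) * exp (- (norm z)\<^sup>2 / 2)"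
      by (intro mult_right_mono) auto
    also have "\<dots> = C * A * (1 + norm z) powr (\<alpha> + 2 * s)"
      by (simp add: mult.assoc powr_add flip: exp_add)
    finally show ?thesis using pos[of z] by (simp add: pos_divide_le_eq A_def)
  qed
  show ?thesis
    unfolding bounded_operator_def
  proof (intro conjI ballI allI)
    show "slice_mult c ` fock_inf \<alpha> \<subseteq> (fock_inf (\<alpha> + 2 * s) :: (complex ^ 'n \<Rightarrow> complex) set)"
    proof (rule image_subsetI)
      fix f :: "complex ^ 'n \<Rightarrow> complex" assume f: "f \<in> fock_inf \<alpha>"
      then have "entire (slice_mult c f)" using c by (auto simp: fock_inf_def intro: entire_slice_mult)
      with key[OF f] show "slice_mult c f \<in> fock_inf (\<alpha> + 2 * s)"
        unfolding fock_inf_def by (auto intro!: bdd_aboveI2)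
    qed
    obtain B q where q: "q > 0" "\<And>k. \<bar>c k\<bar> \<le> B * q ^ k" using c unfolding geo_bounded_def by blast
    fix f :: "complex ^ 'n \<Rightarrow> complex" assume "f \<in> fock_inf \<alpha>"
    then have f: "entire f" by (simp add: fock_inf_def)
    show "slice_mult c (\<lambda>z. a * f z) = (\<lambda>z. a * slice_mult c f z)" for a
      by (rule ext) (rule slice_mult_cmult[OF f q])
    fix g :: "complex ^ 'n \<Rightarrow> complex" assume "g \<in> fock_inf \<alpha>"
    then have g: "entire g" by (simp add: fock_inf_def)
    show "slice_mult c (\<lambda>z. f z + g z) = (\<lambda>z. slice_mult c f z + slice_mult c g z)"
      by (rule ext) (rule slice_mult_add[OF f g q])
  next
    show "\<exists>C. \<forall>f :: complex ^ 'n \<Rightarrow> complex \<in> fock_inf \<alpha>. fock_inf_norm (\<alpha> + 2 * s) (slice_mult c f) \<le> C * fock_inf_norm \<alpha> f"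
    proof (intro exI ballI)
      fix f :: "complex ^ 'n \<Rightarrow> complex" assume f: "f \<in> fock_inf \<alpha>"
      show "fock_inf_norm (\<alpha> + 2 * s) (slice_mult c f) \<le> C * fock_inf_norm \<alpha> f"
        unfolding fock_inf_norm_def[of "\<alpha> + 2 * s"] by (rule cSUP_least) (use key[OF f] in auto)
    qed
  qed
qed

text \<open>The identification of \<open>frac_D\<close> and \<open>frac_I\<close> with multipliers
  is made on entire functions only, where \<open>homogeneous_part\<close> is determined. The
  linearity clauses therefore need sums and multiples to be entire again.\<close>

lemma bounded_operator_cong:
  fixes S T :: "(complex ^ 'n \<Rightarrow> complex) \<Rightarrow> complex ^ 'n \<Rightarrow> complex"
  assumes "bounded_operator X NX Y NY T" "\<And>f. f \<in> X \<Longrightarrow> entire f" "\<And>f. entire f \<Longrightarrow> S f = T f"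
  shows "bounded_operator X NX Y NY S"
proof -
  have "S (\<lambda>z. f z + g z) = (\<lambda>z. S f z + S g z)" "S (\<lambda>z. c * f z) = (\<lambda>z. c * S f z)"
    if "f \<in> X" "g \<in> X" for f g c
    using assms that entire_add[of f g] entire_mult[OF entire_const, of f c]
    unfolding bounded_operator_def by metis+
  then show ?thesis
    using assms unfolding bounded_operator_def by (simp add: image_subset_iff)
qed

section \<open>The two operators as multipliers\<close>

definition frac_cutoff :: "real \<Rightarrow> nat" where
  "frac_cutoff s = (if s \<ge> 0 then 0 else nat \<lfloor>\<bar>s\<bar>\<rfloor> + 1)"

text \<open>For \<open>s < 0\<close> the inequality \<open>real k > \<bar>s\<bar>\<close> is strict,
  so the first index kept is the floor plus one, also when \<open>s\<close> is an integer.\<close>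

lemma frac_indices_eq: "k \<in> frac_indices s \<longleftrightarrow> frac_cutoff s \<le> k"
  unfolding frac_indices_def frac_cutoff_def by (auto, linarith+)

text \<open>Together with \<open>card_ge_1\<close> this meets the hypotheses of
  \<open>gamma_ratio_multiplier\<close> for both operators.\<close>

lemma frac_cutoff_bound: "s + real (frac_cutoff s) \<ge> 0"
  unfolding frac_cutoff_def by (auto, linarith)

lemma frac_D_eq_slice_mult:
  fixes f :: "complex ^ 'n \<Rightarrow> complex"
  assumes "entire f"
  shows "frac_D s f = slice_mult (\<lambda>k. if frac_cutoff s \<le> k
    then Gamma (real CARD('n) + s + real k) / Gamma (real CARD('n) + real k) else 0) f"
  unfolding frac_D_def[abs_def] slice_mult_def[abs_def] homogeneous_part_eq_slice_coeff[OF assms] frac_indices_eq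
  by (intro ext suminf_cong) simp

lemma frac_I_eq_slice_mult:
  fixes f :: "complex ^ 'n \<Rightarrow> complex"
  assumes "entire f"
  shows "frac_I s f = slice_mult (\<lambda>k. if frac_cutoff s \<le> k
    then Gamma (real CARD('n) + real k) / Gamma (real CARD('n) + s + real k) else 0) f"
  unfolding frac_I_def[abs_def] slice_mult_def[abs_def] homogeneous_part_eq_slice_coeff[OF assms] frac_indices_eq
  by (intro ext suminf_cong) simp

lemma card_ge_1: "real CARD('n::finite) \<ge> 1"
  using zero_less_card_finite[where 'a = 'n] by linarith

theorem theorem3p13:
  fixes s \<alpha> :: real
  shows "(\<forall>p>0.
            bounded_operator
              (fock p \<alpha>) (fock_norm p \<alpha>)
              (fock p (\<alpha> + 2 * s * p)) (fock_norm p (\<alpha> + 2 * s * p))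
              (frac_D s :: (complex ^ 'n \<Rightarrow> complex) \<Rightarrow> complex ^ 'n \<Rightarrow> complex) \<and>
            bounded_operator
              (fock p \<alpha>) (fock_norm p \<alpha>)
              (fock p (\<alpha> + 2 * s * p)) (fock_norm p (\<alpha> + 2 * s * p))
              (frac_I (- s) :: (complex ^ 'n \<Rightarrow> complex) \<Rightarrow> complex ^ 'n \<Rightarrow> complex)) \<and>
         bounded_operator
           (fock_inf \<alpha>) (fock_inf_norm \<alpha>)
           (fock_inf (\<alpha> + 2 * s)) (fock_inf_norm (\<alpha> + 2 * s))
           (frac_D s :: (complex ^ 'n \<Rightarrow> complex) \<Rightarrow> complex ^ 'n \<Rightarrow> complex) \<and>
         bounded_operator
           (fock_inf \<alpha>) (fock_inf_norm \<alpha>)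
           (fock_inf (\<alpha> + 2 * s)) (fock_inf_norm (\<alpha> + 2 * s))
           (frac_I (- s) :: (complex ^ 'n \<Rightarrow> complex) \<Rightarrow> complex ^ 'n \<Rightarrow> complex)"
proof -
  define n where "n = real CARD('n)"
  have n: "n \<ge> 1" unfolding n_def by (rule card_ge_1)
  define d where "d k = (if frac_cutoff s \<le> k then Gamma (n + s + real k) / Gamma (n + real k) else 0)" for k
  \<comment> \<open>The multiplier of \<open>frac_I (- s)\<close> differs from that of
    \<open>frac_D s\<close>, but its Gamma arguments again differ by \<open>s\<close>. Its cutoff
    follows the sign of \<open>- s\<close>: for nonzero \<open>s\<close> exactly one of the two
    operators drops terms.\<close>
  define e where "e k = (if frac_cutoff (- s) \<le> k then Gamma (n + real k) / Gamma (n + - s + real k) else 0)" for k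
  have "fock_order (n + s - n) (slice_mult d :: (complex ^ 'n \<Rightarrow> complex) \<Rightarrow> _)" and dg: "geo_bounded d"
    unfolding d_def[abs_def]
    by (rule gamma_ratio_multiplier; use n frac_cutoff_bound[of s] in linarith)+
  then have d: "fock_order s (slice_mult d :: (complex ^ 'n \<Rightarrow> complex) \<Rightarrow> _)" by simp
  have "fock_order (n - (n + - s)) (slice_mult e :: (complex ^ 'n \<Rightarrow> complex) \<Rightarrow> _)" and eg: "geo_bounded e"
    unfolding e_def[abs_def]
    by (rule gamma_ratio_multiplier; use n frac_cutoff_bound[of "- s"] in linarith)+
  then have e: "fock_order s (slice_mult e :: (complex ^ 'n \<Rightarrow> complex) \<Rightarrow> _)" by simp
  have D: "frac_D s f = slice_mult d f" and I: "frac_I (- s) f = slice_mult e f"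
    if "entire f" for f :: "complex ^ 'n \<Rightarrow> complex"
    unfolding frac_D_eq_slice_mult[OF that] frac_I_eq_slice_mult[OF that] d_def[abs_def] e_def[abs_def] n_def by (rule refl)+
  have p: "entire f" if "f \<in> fock p \<alpha>" for p and f :: "complex ^ 'n \<Rightarrow> complex"
    using that by (simp add: fock_def)
  have inf: "entire f" if "f \<in> fock_inf \<alpha>" for f :: "complex ^ 'n \<Rightarrow> complex"
    using that by (simp add: fock_inf_def)
  show ?thesis
    by (intro conjI allI impI)
       (rule bounded_operator_cong[OF fock_order_bounded_operator[OF _ d dg] p D]
             bounded_operator_cong[OF fock_order_bounded_operator[OF _ e eg] p I]
             bounded_operator_cong[OF fock_order_bounded_operator_inf[OF d dg] inf D]
             bounded_operator_cong[OF fock_order_bounded_operator_inf[OF e eg] inf I]; assumption)+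
qed

end
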